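(* Let $(x,\Phi)$ be a minimizer of the Crisanti–Sommers functional $\mathscr C$ with constraint $Q$, and let $\mu_P$ be the measure with $\mu_P([0,t])=x(t)$. Suppose that there exist a (strictly) increasing sequence $(u_l^-)_{l\ge1}$ and a (strictly) decreasing sequence $(u_l^+)_{l\ge1}$ of points of $\mathrm{supp}\,\mu_P$ such that $\lim_{l\to\infty}u_l^-=u_0=\lim_{l\to\infty}u_l^+$. Then $\mu_P$ is continuous at $u_0$, i.e. $\mu_P(\{u_0\})=0$.
   Context: Fix $m\ge1$. For each $p\ge2$ let $\vec\beta_p\in\mathbb R^m$, with $\vec\beta_p=0$ for odd $p$ and $\sum_{p\ge2}2^p\vec\beta_p(j)^2<\infty$ for every $1\le j\le m$; let $\vec h\in\mathbb R^m$. (The inverse temperature is absorbed into $\xi$ and $\vec h$.) $\odot$ is the entrywise product, $A^{\circ p}$ the entrywise $p$-th power, $\langle\cdot,\cdot\rangle$ the Frobenius inner product, $|A|$ the determinant. $\vec\beta_p\otimes\vec\beta_p=(\vec\beta_p(i)\vec\beta_p(j))_{i,j}$, $\xi(A)=\sum_p(\vec\beta_p\otimes\vec\beta_p)\odot A^{\circ p}$, $\xi'(A)=\sum_pp(\vec\beta_p\otimes\vec\beta_p)\odot A^{\circ(p-1)}$. $\mathbb S^m_+$ is the set of symmetric positive semidefinite $m\times m$ matrices. $Q\in\mathbb S^m_+$ has entries in $[-1,1]$ and diagonal entries $1$. Admissible pairs $(x,\Phi)$: $x:[0,m]\to[0,1]$ is right-continuous and nondecreasing with $x(0^-)=0$,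 $x(m)=1$, with associated probability measure $\mu_P([0,t])=x(t)$; $\Phi\in\mathscr M$, i.e. $\Phi:[0,m]\to\mathbb S^m_+$ is a continuously differentiable, Lipschitz, monotone (Loewner-nondecreasing) path with Lipschitz derivative, $\Phi(0)=0$, $\Phi(m)=Q$, and $\mathrm{Trace}(\Phi(t))=t$ for $t\in\mathrm{supp}\,\mu_P$; and $|Q-\Phi(t_x)|>0$ where $t_x=\inf\{t:x(t)=1\}$. Put $\hat\Phi(t)=\int_t^mx(s)\Phi'(s)ds$. For $\hat T\in(t_x,m)$ with $|Q-\Phi(\hat T)|>0$ (the value does not depend on $\hat T$), $$\mathscr C(x,\Phi)=\tfrac12\Big[\int_0^mx(t)\langle\xi'(\Phi(t))+\vec h\vec h^T,\Phi'(t)\rangle dt+\log|\Phi(m)-\Phi(\hat T)|+\int_0^{\hat T}\langle\hat\Phi(t)^{-1},\Phi'(t)\rangle dt\Big].$$ A minimizer is a pair minimizing $\mathscr C$ over all admissible pairs. *)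

theory Defs
  imports "HOL-Analysis.Analysis"
begin

text \<open>
  The dimension \<open>m \<ge> 1\<close> is \<open>CARD('m)\<close>. The library's inner product on \<open>real^'m^'m\<close>
  is the Frobenius inner product. Functions on \<open>[0,m]\<close> are functions on the reals of which
  only the values on \<open>[0,m]\<close> matter.
\<close>

definition outer :: "real^'m \<Rightarrow> real^'m \<Rightarrow> real^'m^'m" where
  "outer u v = (\<chi> i j. u $ i * v $ j)"

definition xi' :: "(nat \<Rightarrow> real^'m) \<Rightarrow> real^'m^'m \<Rightarrow> real^'m^'m" where
  "xi' \<beta> A = (\<chi> i j. \<Sum>p. if 2 \<le> p then real p * outer (\<beta> p) (\<beta> p) $ i $ j * (A $ i $ j) ^ (p - 1)
                          else 0)"

definition psd :: "real^'m^'m \<Rightarrow> bool" where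
  "psd A \<longleftrightarrow> transpose A = A \<and> (\<forall>v. 0 \<le> v \<bullet> (A *v v))"

definition loewner_le :: "real^'m^'m \<Rightarrow> real^'m^'m \<Rightarrow> bool" where
  "loewner_le A B \<longleftrightarrow> psd (B - A)"

definition is_constraint :: "real^'m^'m \<Rightarrow> bool" where
  "is_constraint Q \<longleftrightarrow> psd Q \<and> (\<forall>i j. Q $ i $ j \<in> {-1..1}) \<and> (\<forall>i. Q $ i $ i = 1)"

definition is_order_parameter :: "real \<Rightarrow> (real \<Rightarrow> real) \<Rightarrow> bool" where
  "is_order_parameter m x \<longleftrightarrow> x ` {0..m} \<subseteq> {0..1} \<and> mono_on {0..m} x \<and> x m = 1 \<and>
     (\<forall>t\<in>{0..<m}. continuous (at_right t) x)"

text \<open>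
  Extending by 0 to the left of 0 encodes \<open>x(0\<^sup>-) = 0\<close>: the measure has an atom of mass
  \<open>x 0\<close> at 0. See \<open>measure_mu_P_Icc\<close> below.
\<close>
definition mu_P :: "real \<Rightarrow> (real \<Rightarrow> real) \<Rightarrow> real measure" where
  "mu_P m x = interval_measure (\<lambda>t. if t < 0 then 0 else if t > m then 1 else x t)"

definition supp :: "real measure \<Rightarrow> real set" where
  "supp M = {t. \<forall>U. open U \<longrightarrow> t \<in> U \<longrightarrow> emeasure M U > 0}"

definition t_max :: "real \<Rightarrow> (real \<Rightarrow> real) \<Rightarrow> real" where
  "t_max m x = Inf {t \<in> {0..m}. x t = 1}"

text \<open>Derivative on \<open>[0,m]\<close>, one-sided at the endpoints.\<close>
definition path_deriv :: "(real \<Rightarrow> real^'m^'m) \<Rightarrow> real \<Rightarrow> real^'m^'m" where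
  "path_deriv \<Phi> t = vector_derivative \<Phi> (at t within {0..real CARD('m)})"

definition is_path :: "real^'m^'m \<Rightarrow> (real \<Rightarrow> real^'m^'m) \<Rightarrow> bool" where
  "is_path Q \<Phi> \<longleftrightarrow>
     (let I = {0..real CARD('m)} in
        (\<forall>t\<in>I. psd (\<Phi> t)) \<and>
        (\<forall>t\<in>I. \<Phi> differentiable (at t within I)) \<and>
        continuous_on I (path_deriv \<Phi>) \<and>
        (\<exists>L. lipschitz_on L I \<Phi>) \<and>
        (\<exists>L. lipschitz_on L I (path_deriv \<Phi>)) \<and>
        (\<forall>s\<in>I. \<forall>t\<in>I. s \<le> t \<longrightarrow> loewner_le (\<Phi> s) (\<Phi> t)) \<and>
        \<Phi> 0 = 0 \<and> \<Phi> (real CARD('m)) = Q)"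

definition admissible :: "real^'m^'m \<Rightarrow> (real \<Rightarrow> real) \<Rightarrow> (real \<Rightarrow> real^'m^'m) \<Rightarrow> bool" where
  "admissible Q x \<Phi> \<longleftrightarrow>
     is_order_parameter (real CARD('m)) x \<and> is_path Q \<Phi> \<and>
     (\<forall>t\<in>supp (mu_P (real CARD('m)) x). trace (\<Phi> t) = t) \<and>
     det (Q - \<Phi> (t_max (real CARD('m)) x)) > 0"

definition Phi_hat :: "(real \<Rightarrow> real) \<Rightarrow> (real \<Rightarrow> real^'m^'m) \<Rightarrow> real \<Rightarrow> real^'m^'m" where
  "Phi_hat x \<Phi> t = integral {t..real CARD('m)} (\<lambda>s. x s *\<^sub>R path_deriv \<Phi> s)"

definition CS_cutoff ::
  "(nat \<Rightarrow> real^'m) \<Rightarrow> real^'m \<Rightarrow> real \<Rightarrow> (real \<Rightarrow> real) \<Rightarrow> (real \<Rightarrow> real^'m^'m) \<Rightarrow> real" where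
  "CS_cutoff \<beta> h T x \<Phi> = 1/2 *
     (integral {0..real CARD('m)} (\<lambda>t. x t * ((xi' \<beta> (\<Phi> t) + outer h h) \<bullet> path_deriv \<Phi> t))
      + ln (det (\<Phi> (real CARD('m)) - \<Phi> T))
      + integral {0..T} (\<lambda>t. matrix_inv (Phi_hat x \<Phi> t) \<bullet> path_deriv \<Phi> t))"

text \<open>
  For admissible pairs a cutoff \<open>T\<close> as below exists and the value does not depend on it.
\<close>
definition CS :: "(nat \<Rightarrow> real^'m) \<Rightarrow> real^'m \<Rightarrow> real^'m^'m \<Rightarrow> (real \<Rightarrow> real) \<Rightarrow>
    (real \<Rightarrow> real^'m^'m) \<Rightarrow> real" where
  "CS \<beta> h Q x \<Phi> = CS_cutoff \<beta> h
     (SOME T. T \<in> {t_max (real CARD('m)) x<..<real CARD('m)} \<and> det (Q - \<Phi> T) > 0) x \<Phi>"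

definition is_CS_minimizer :: "(nat \<Rightarrow> real^'m) \<Rightarrow> real^'m \<Rightarrow> real^'m^'m \<Rightarrow> (real \<Rightarrow> real) \<Rightarrow>
    (real \<Rightarrow> real^'m^'m) \<Rightarrow> bool" where
  "is_CS_minimizer \<beta> h Q x \<Phi> \<longleftrightarrow> admissible Q x \<Phi> \<and>
     (\<forall>y \<Psi>. admissible Q y \<Psi> \<longrightarrow> CS \<beta> h Q x \<Phi> \<le> CS \<beta> h Q y \<Psi>)"

lemma measure_mu_P_Icc:
  assumes x: "is_order_parameter m x" and t: "t \<in> {0..m}"
  shows "measure (mu_P m x) {0..t} = x t"
proof -
  define F where "F = (\<lambda>t. if t < 0 then 0 else if t > m then 1 else x t)"
  have rng: "s \<in> {0..m} \<Longrightarrow> 0 \<le> x s \<and> x s \<le> 1" for s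
    using x by (force simp: is_order_parameter_def)
  have mono: "F s \<le> F s'" if "s \<le> s'" for s s'
    using that rng x by (auto simp: F_def is_order_parameter_def mono_on_def)
  have rc: "continuous (at_right a) F" for a
  proof -
    consider "a < 0" | "a \<in> {0..<m}" | "a \<ge> m" "a \<ge> 0" by force
    then show ?thesis
    proof cases
      case 1
      have "eventually (\<lambda>s. F s = 0) (at_right a)"
        unfolding eventually_at_right_field using 1 by (auto simp: F_def)
      then show ?thesis using 1 by (simp add: continuous_within F_def tendsto_eventually)
    next
      case 2
      have "eventually (\<lambda>s. x s = F s) (at_right a)"
        unfolding eventually_at_right_field using 2 by (auto simp: F_def intro!: exI[of _ m])
      moreover have "(x \<longlongrightarrow> x a) (at_right a)"
        using x 2 by (auto simp: is_order_parameter_def continuous_within)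
      ultimately have "(F \<longlongrightarrow> x a) (at_right a)" by (rule Lim_transform_eventually[rotated])
      then show ?thesis using 2 by (simp add: continuous_within F_def)
    next
      case 3
      have "eventually (\<lambda>s. F s = 1) (at_right a)"
        unfolding eventually_at_right_field using 3 by (auto simp: F_def intro!: exI[of _ "a+1"])
      moreover have "F a = 1" using 3 x by (auto simp: F_def is_order_parameter_def)
      ultimately show ?thesis by (simp add: continuous_within tendsto_eventually)
    qed
  qed
  have Ioc: "a \<le> b \<Longrightarrow> emeasure (interval_measure F) {a<..b} = ennreal (F b - F a)" for a b
    by (rule emeasure_interval_measure_Ioc) (use mono rc in auto)
  define U where "U = (\<Union>n::nat. {-1<..- 1 / real (Suc n)})"
  have sub: "{-1<..<0} \<subseteq> U"
  proof
    fix y :: real assume y: "y \<in> {-1<..<0}"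
    obtain n where "inverse (real (Suc n)) < - y" using y reals_Archimedean[of "-y"] by auto
    then have "y \<le> - 1 / real (Suc n)" by (simp add: inverse_eq_divide del: of_nat_Suc)
    then have "y \<in> {-1<..- 1 / real (Suc n)}" using y by (simp del: of_nat_Suc)
    then show "y \<in> U" unfolding U_def by (rule UN_I[OF UNIV_I])
  qed
  have "emeasure (interval_measure F) {-1<..- 1 / real (Suc n)} = 0" for n
    by (subst Ioc) (auto simp: F_def)
  then have "emeasure (interval_measure F) U = 0"
    unfolding U_def by (intro emeasure_UN_eq_0) auto
  then have null: "emeasure (interval_measure F) {-1<..<0} = 0"
    by (rule emeasure_eq_0[OF _ _ sub, rotated]) (simp add: U_def)
  have "{-1<..t} = {-1<..<0} \<union> {0..t}" using t by auto
  then have "emeasure (interval_measure F) {-1<..t} = emeasure (interval_measure F) {0..t}"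
    using null emeasure_Un_null_set[of "{0..t}" "interval_measure F" "{-1<..<0}"]
    by (simp add: null_sets_def Un_commute)
  moreover have "F t - F (-1) = x t" using t by (auto simp: F_def)
  ultimately show ?thesis
    using Ioc[of "-1" t] t rng by (simp add: mu_P_def measure_def flip: F_def)
qed

end

theory Submission
  imports Defs
begin

text \<open>
  Write \<open>P\<close> for the derivative of \<open>\<Phi>\<close>, \<open>iv\<close> for the inverse of \<open>\<Phi>\<close>-hat, \<open>M t = \<integral>\<^sub>0\<^sup>t iv P iv\<close> and
  \<open>D = xi'(\<Phi>) + h h\<^sup>T - M\<close>. Since the functional is invariant under reparametrisation, the normalisation
  of the trace is no restriction on variations of the path, and moving the path from \<open>\<Phi>\<close> to \<open>\<Phi> + \<epsilon> \<Psi>\<close>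
  changes it to first order by half of \<open>- \<integral> \<langle>D, \<Psi>\<rangle> d\<mu>\<close>. As the increment of \<open>\<Phi>\<close> after \<open>t_max\<close> is positive
  definite, any positive semidefinite increment of the path may be inserted at any earlier time. Hence
  \<open>K t = - \<integral>\<^bsub>(t, t_max]\<^esub> D d\<mu>\<close> is positive semidefinite, and \<open>K P = 0\<close>.

  The function \<open>D\<close> is continuously differentiable with Lipschitz derivative along the path, even where \<open>x\<close>
  jumps, and \<open>D' = L P\<close> for a self-adjoint operator \<open>L = L\<^sub>t\<close> on matrices. Let \<open>\<mu>\<close> have an atom at \<open>u\<close>
  and let \<open>V = P u\<close>. Expanding \<open>K P = 0\<close> on either side of \<open>u\<close> shows that the one-sided
  derivatives of \<open>t \<mapsto> \<langle>V, L\<^sub>t V\<rangle>\<close> at \<open>u\<close> are nonnegative on the right and nonpositive on the left; here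
  self-adjointness of \<open>L\<close> replaces the second derivative of \<open>\<Phi>\<close>, which need not exist. But the
  right derivative minus the left one is \<open>- 2 \<mu>{u} tr (V iv V iv V iv) < 0\<close>.
\<close>

subsection \<open>Positive semidefinite matrices\<close>

text \<open>The accumulating support points are used in two ways. They make \<open>x\<close>
  nonconstant on both sides of u, so the weights in the expansions of \<open>K\<close> do not
  vanish; and \<open>trace (\<Phi> t) = t\<close> along them gives V trace one, so V is nonzero. The
  obstacle is degeneracy: \<open>K\<close> and \<open>P\<close> are in general singular, their
  ranges may move with t, and \<open>P\<close> is only Lipschitz, so \<open>K ** P = 0\<close>
  cannot simply be differentiated twice. The remedy is a separation of scales. If m is the increment
  of \<open>x\<close> over a distance s from u and \<kappa> the integral of the weight multiplying
  \<open>D'\<close>, then \<kappa> lies between 0 and m s, and the contributions of order 1, m and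
  \<kappa> can be peeled off in turn. The atom enters here as well: D at u is a multiple of the
  difference of the two one-sided limits of \<open>K\<close>, both semidefinite and orthogonal to V,
  hence it annihilates V. Integration by parts turns the integral of D against \<mu> into an
  ordinary integral with weight 1 - x, so that \<open>K\<close> jumps only through the factor 1 - x.
  The functional is evaluated with the cutoff at t_max itself, where
  \<open>det (Q - \<Phi> t_max) > 0\<close> keeps every inverse bounded.\<close>

lemma bounded_bilinear_matrix_mul: "bounded_bilinear ((**) :: real^'n^'m \<Rightarrow> real^'k^'n \<Rightarrow> real^'k^'m)"
proof -
  have "bilinear ((**) :: real^'n^'m \<Rightarrow> real^'k^'n \<Rightarrow> real^'k^'m)"
    unfolding bilinear_def
    by (auto intro!: linearI simp: matrix_matrix_mult_def vec_eq_iff sum.distrib algebra_simps sum_distrib_left)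
  then show ?thesis by (simp add: bilinear_conv_bounded_bilinear)
qed

interpretation matmul: bounded_bilinear "(**) :: real^'m^'m \<Rightarrow> real^'m^'m \<Rightarrow> real^'m^'m"
  by (rule bounded_bilinear_matrix_mul)

lemma bounded_bilinear_matrix_vector_mul: "bounded_bilinear ((*v) :: real^'n^'m \<Rightarrow> real^'n \<Rightarrow> real^'m)"
proof -
  have "bilinear ((*v) :: real^'n^'m \<Rightarrow> real^'n \<Rightarrow> real^'m)"
    unfolding bilinear_def
    by (auto intro!: linearI simp: matrix_vector_mult_def vec_eq_iff sum.distrib algebra_simps sum_distrib_left)
  then show ?thesis by (simp add: bilinear_conv_bounded_bilinear)
qed

interpretation matvec: bounded_bilinear "(*v) :: real^'n^'m \<Rightarrow> real^'n \<Rightarrow> real^'m"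
  by (rule bounded_bilinear_matrix_vector_mul)

lemma linear_transpose: "linear (transpose :: real^'n^'m \<Rightarrow> real^'m^'n)"
  by (auto intro!: linearI simp: transpose_def vec_eq_iff)

lemmas bounded_linear_transpose = linear_conv_bounded_linear[THEN iffD1, OF linear_transpose]
lemmas transp_add = linear_add[OF linear_transpose]
lemmas transp_diff = linear_diff[OF linear_transpose]
lemmas transp_scaleR = linear_scale[OF linear_transpose]
lemmas transp_sum = linear_sum[OF linear_transpose]
lemmas transp_zero = linear_0[OF linear_transpose]
lemmas transp_tendsto = bounded_linear.tendsto[OF bounded_linear_transpose]

lemma linear_trace: "linear (trace :: real^'m^'m \<Rightarrow> real)"
  by (auto intro!: linearI simp: trace_def sum.distrib sum_distrib_left)

lemmas bounded_linear_trace = linear_conv_bounded_linear[THEN iffD1, OF linear_trace]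

lemma inner_matrix: "(A::real^'n^'m) \<bullet> B = (\<Sum>i\<in>UNIV. \<Sum>j\<in>UNIV. A $ i $ j * B $ i $ j)"
  by (simp add: inner_vec_def)

lemma inner_matrix_trace: "(A::real^'m^'m) \<bullet> B = trace (transpose A ** B)"
  unfolding inner_matrix trace_def matrix_matrix_mult_def transpose_def
  by (simp, subst sum.swap, simp)

lemma inner_sym_trace: "transpose A = A \<Longrightarrow> (A::real^'m^'m) \<bullet> B = trace (A ** B)"
  by (simp add: inner_matrix_trace)

lemma inner_transpose: "transpose (A::real^'m^'m) \<bullet> transpose B = A \<bullet> B"
  unfolding inner_matrix transpose_def by (simp, subst sum.swap, simp)

lemma inner_mul_left: "((A::real^'m^'m) ** (B::real^'m^'m)) \<bullet> C = B \<bullet> (transpose A ** C)"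
  by (simp add: inner_matrix_trace matrix_transpose_mul matrix_mul_assoc)

lemma inner_mul_right: "((A::real^'m^'m) ** (B::real^'m^'m)) \<bullet> C = A \<bullet> (C ** transpose B)"
proof -
  have "(A ** B) \<bullet> C = trace (transpose B ** (transpose A ** C))"
    by (simp add: inner_matrix_trace matrix_transpose_mul matrix_mul_assoc)
  also have "\<dots> = trace (transpose A ** (C ** transpose B))"
    by (subst trace_mul_sym) (simp add: matrix_mul_assoc)
  finally show ?thesis by (simp add: inner_matrix_trace)
qed

lemma inner_congruence:
  assumes "transpose P = P"
  shows "((P::real^'m^'m) ** X ** P) \<bullet> Y = X \<bullet> (P ** Y ** P)"
  by (subst inner_mul_right, subst inner_mul_left) (simp add: assms matrix_mul_assoc)

lemma inner_outer: "outer u v \<bullet> A = u \<bullet> (A *v v)"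
  by (simp add: inner_matrix outer_def matrix_vector_mult_def inner_vec_def sum_distrib_left mult_ac)

lemma transpose_outer [simp]: "transpose (outer u v) = outer v u"
  by (simp add: outer_def transpose_def vec_eq_iff mult_ac)

lemma matrix_mul_outer: "A ** outer u v = outer (A *v u) v"
  by (simp add: vec_eq_iff outer_def matrix_matrix_mult_def matrix_vector_mult_def sum_distrib_left mult_ac)

lemma outer_zero_left [simp]: "outer 0 v = 0"
  by (simp add: vec_eq_iff outer_def)

lemma outer_vector_mul: "outer u v *v w = (v \<bullet> w) *\<^sub>R u"
  by (simp add: vec_eq_iff outer_def matrix_vector_mult_def inner_vec_def sum_distrib_left mult_ac)

section \<open>The cone of semidefinite matrices: Cauchy-Schwarz, null vectors, self-duality\<close>

lemma psd_sym: "psd A \<Longrightarrow> transpose A = A"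
  and psd_nonneg: "psd A \<Longrightarrow> 0 \<le> v \<bullet> (A *v v)"
  by (auto simp: psd_def)

lemma psd_0 [simp]: "psd 0" by (simp add: psd_def transpose_def vec_eq_iff)

lemma psd_add: "psd A \<Longrightarrow> psd B \<Longrightarrow> psd (A + B)"
  by (simp add: psd_def transp_add matvec.add_left inner_add_right)

lemma psd_scaleR: "psd A \<Longrightarrow> 0 \<le> c \<Longrightarrow> psd (c *\<^sub>R A)"
  by (simp add: psd_def transp_scaleR matvec.scaleR_left)

lemma psd_outer: "psd (outer u u)"
  by (simp add: psd_def outer_vector_mul inner_commute)

lemma psd_limit:
  assumes "F \<noteq> bot" "(f \<longlongrightarrow> A) F" "eventually (\<lambda>t. psd (f t)) F"
  shows "psd A"
proof -
  have "((\<lambda>t. transpose (f t)) \<longlongrightarrow> transpose A) F" by (intro transp_tendsto assms)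
  moreover have "((\<lambda>t. transpose (f t)) \<longlongrightarrow> A) F"
    using assms(2) by (rule Lim_transform_eventually) (use assms(3) in \<open>auto elim!: eventually_mono simp: psd_sym\<close>)
  ultimately have "transpose A = A" using assms(1) tendsto_unique by blast
  moreover have "0 \<le> v \<bullet> (A *v v)" for v
  proof (rule tendsto_lowerbound[OF _ _ assms(1)])
    show "((\<lambda>t. v \<bullet> (f t *v v)) \<longlongrightarrow> v \<bullet> (A *v v)) F"
      by (intro tendsto_intros matvec.tendsto assms)
  qed (use assms(3) in \<open>auto elim!: eventually_mono simp: psd_nonneg\<close>)
  ultimately show ?thesis by (simp add: psd_def)
qed

lemma psd_congruence: "psd A \<Longrightarrow> psd (B ** A ** transpose B)"
  unfolding psd_def
proof safe
  fix v assume *: "\<forall>v. 0 \<le> v \<bullet> (A *v v)"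
  have "v \<bullet> (B ** A ** transpose B *v v) = (transpose B *v v) \<bullet> (A *v (transpose B *v v))"
    by (metis dot_lmul_matrix matrix_vector_mul_assoc transpose_matrix_vector transpose_transpose)
  then show "0 \<le> v \<bullet> (B ** A ** transpose B *v v)" using * by simp
qed (simp add: matrix_transpose_mul matrix_mul_assoc)

text \<open>Cauchy-Schwarz for a possibly degenerate form: the quadratic polynomial
  \<open>t \<mapsto> (u + t v) \<bullet> A (u + t v)\<close> is nonnegative, so its discriminant is
  not positive. A vanishing leading coefficient is treated apart, since then the polynomial is
  affine.\<close>

lemma psd_bilinear_bound:
  assumes "psd A"
  shows "(u \<bullet> (A *v v))\<^sup>2 \<le> (u \<bullet> (A *v u)) * (v \<bullet> (A *v v))"
proof -
  let ?a = "u \<bullet> (A *v u)" and ?b = "u \<bullet> (A *v v)" and ?c = "v \<bullet> (A *v v)"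
  have s: "v \<bullet> (A *v u) = ?b"
    by (metis assms dot_lmul_matrix inner_commute psd_sym transpose_matrix_vector)
  have q: "0 \<le> ?a + 2 * t * ?b + t\<^sup>2 * ?c" for t
  proof -
    have "(u + t *\<^sub>R v) \<bullet> (A *v (u + t *\<^sub>R v)) = ?a + 2 * t * ?b + t\<^sup>2 * ?c"
      by (simp add: matvec.add_right matvec.scaleR_right inner_add_left inner_add_right s power2_eq_square algebra_simps)
    then show ?thesis using psd_nonneg[OF assms] by metis
  qed
  have c: "0 \<le> ?c" using psd_nonneg[OF assms] .
  show ?thesis
  proof (cases "?c = 0")
    case True
    have "?b = 0"
    proof (rule ccontr)
      assume b: "?b \<noteq> 0"
      \<comment> \<open>At this \<open>t\<close> the affine polynomial takes the value -1.\<close>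
      show False using q[of "- (?a + 1) / (2 * ?b)"] b True by (simp add: field_simps)
    qed
    then show ?thesis using True by simp
  next
    case False
    then have cp: "0 < ?c" using c by simp
    have "0 \<le> ?a - ?b\<^sup>2 / ?c" using q[of "- ?b / ?c"] cp by (simp add: field_simps power2_eq_square)
    then show ?thesis using cp by (simp add: field_simps)
  qed
qed

lemma psd_null_vector:
  assumes "psd A" "v \<bullet> (A *v v) = 0"
  shows "A *v v = 0"
  using psd_bilinear_bound[OF assms(1), of "A *v v" v] assms(2) by simp

lemma quadratic_axis: "axis i 1 \<bullet> (A *v axis j (1::real)) = A $ i $ j"
  by (simp add: matrix_vector_mult_basis column_def inner_axis')

lemma psd_entry_bound: "psd A \<Longrightarrow> (A $ i $ j)\<^sup>2 \<le> A $ i $ i * A $ j $ j"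
  using psd_bilinear_bound[of A "axis i 1" "axis j 1"] by (simp add: quadratic_axis)

lemma psd_diag_nonneg: "psd A \<Longrightarrow> 0 \<le> A $ i $ i"
  using psd_nonneg[of A "axis i 1"] by (simp add: quadratic_axis)

text \<open>One step of symmetric Gaussian elimination removes a nonzero row.\<close>
lemma psd_sum_outer:
  fixes A :: "real^'m^'m"
  assumes "psd A"
  shows "\<exists>f. A = (\<Sum>i\<in>(UNIV::'m set). outer (f i) (f i))"
proof -
  have "\<exists>f. A = (\<Sum>i\<in>(UNIV::'m set). outer (f i) (f i)) \<and> (\<forall>i. A $ i $ i = 0 \<longrightarrow> f i = 0)"
    using assms
  proof (induction "card {i. A $ i $ i \<noteq> 0}" arbitrary: A rule: less_induct)
    case less
    show ?case
    proof (cases "\<forall>i. A $ i $ i = 0")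
      case True
      have "A = 0" using psd_entry_bound[OF less.prems] True by (simp add: vec_eq_iff)
      then show ?thesis by (intro exI[of _ "\<lambda>_. 0"]) simp
    next
      case False
      then obtain k where k: "A $ k $ k \<noteq> 0" by blast
      have kp: "A $ k $ k > 0" using psd_diag_nonneg[OF less.prems, of k] k by simp
      define c where "c = column k A"
      define B where "B = A - (1 / A $ k $ k) *\<^sub>R outer c c"
      have ci: "c $ i = A $ i $ k" for i by (simp add: c_def column_def)
      have sA: "A $ i $ j = A $ j $ i" for i j
        using psd_sym[OF less.prems] by (simp add: transpose_def vec_eq_iff)
      have Bij: "B $ i $ j = A $ i $ j - A $ i $ k * A $ j $ k / A $ k $ k" for i j
        by (simp add: B_def outer_def ci)
      have psdB: "psd B" unfolding psd_def
      proof safe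
        show "transpose B = B" by (simp add: vec_eq_iff transpose_def Bij sA mult_ac)
        fix v
        have "c \<bullet> v = axis k 1 \<bullet> (A *v v)"
          by (simp add: inner_axis') (simp add: inner_vec_def matrix_vector_mult_def ci sA[of k])
        then have "(c \<bullet> v)\<^sup>2 \<le> A $ k $ k * (v \<bullet> (A *v v))"
          using psd_bilinear_bound[OF less.prems, of "axis k 1" v] by (simp add: quadratic_axis)
        moreover have "v \<bullet> (B *v v) = v \<bullet> (A *v v) - (c \<bullet> v)\<^sup>2 / A $ k $ k"
          by (simp add: B_def matvec.diff_left matvec.scaleR_left inner_diff_right outer_vector_mul
              inner_commute power2_eq_square)
        ultimately have "0 \<le> (v \<bullet> (B *v v)) * A $ k $ k" using kp by (simp add: field_simps)
        then show "0 \<le> v \<bullet> (B *v v)" using kp by (simp add: zero_le_mult_iff)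
      qed
      have z: "B $ i $ i = 0" if "A $ i $ i = 0" for i
      proof -
        have "A $ i $ k = 0" using psd_entry_bound[OF less.prems, of i k] that by simp
        then show ?thesis using that by (simp add: Bij)
      qed
      have zk: "B $ k $ k = 0" using k by (simp add: Bij)
      have "{i. B $ i $ i \<noteq> 0} \<subset> {i. A $ i $ i \<noteq> 0}" using z zk k by auto
      then have "card {i. B $ i $ i \<noteq> 0} < card {i. A $ i $ i \<noteq> 0}" by (intro psubset_card_mono) auto
      from less.hyps[OF this psdB] obtain f where
        f: "B = (\<Sum>i\<in>(UNIV::'m set). outer (f i) (f i))" "\<forall>i. B $ i $ i = 0 \<longrightarrow> f i = 0" by blast
      define g where "g = f(k := (1 / sqrt (A $ k $ k)) *\<^sub>R c)"
      have "outer (g k) (g k) = (1 / A $ k $ k) *\<^sub>R outer c c"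
        using kp by (simp add: g_def outer_def vec_eq_iff)
      moreover have "(\<Sum>i\<in>UNIV. outer (g i) (g i)) = outer (g k) (g k) + (\<Sum>i\<in>UNIV-{k}. outer (f i) (f i))"
        by (subst sum.remove[of _ k]) (auto simp: g_def intro!: sum.cong)
      moreover have "(\<Sum>i\<in>UNIV-{k}. outer (f i) (f i)) = B"
        unfolding f(1) using f(2) zk by (subst sum.remove[of UNIV k]) auto
      ultimately have "A = (\<Sum>i\<in>UNIV. outer (g i) (g i))" by (simp add: B_def)
      moreover have "\<forall>i. A $ i $ i = 0 \<longrightarrow> g i = 0" using f(2) z k by (auto simp: g_def)
      ultimately show ?thesis by blast
    qed
  qed
  then show ?thesis by blast
qed

lemma psd_inner_nonneg:
  fixes A :: "real^'m^'m"
  assumes "psd A" "psd B" shows "0 \<le> A \<bullet> B"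
proof -
  obtain f :: "'m \<Rightarrow> real^'m" where f: "A = (\<Sum>i\<in>UNIV. outer (f i) (f i))" using psd_sum_outer[OF assms(1)] by blast
  show ?thesis unfolding f inner_sum_left inner_outer by (intro sum_nonneg psd_nonneg assms)
qed

text \<open>With \<open>A\<close> a sum of rank-one terms, the inner product is a sum of nonnegative
  values of the form \<open>B\<close>; all of them vanish, and a null value of a semidefinite form
  is attained only at a null vector. This converts scalar complementary slackness into a vanishing
  matrix product.\<close>

lemma psd_inner_zero:
  fixes A :: "real^'m^'m"
  assumes "psd A" "psd B" "A \<bullet> B = 0" shows "B ** A = 0"
proof -
  obtain f :: "'m \<Rightarrow> real^'m" where f: "A = (\<Sum>i\<in>UNIV. outer (f i) (f i))" using psd_sum_outer[OF assms(1)] by blast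
  have "(\<Sum>i\<in>UNIV. f i \<bullet> (B *v f i)) = 0" using assms(3) unfolding f inner_sum_left inner_outer .
  then have "f i \<bullet> (B *v f i) = 0" for i
    by (subst (asm) sum_nonneg_eq_0_iff) (auto intro: psd_nonneg assms)
  then have "B *v f i = 0" for i using psd_null_vector[OF assms(2)] by blast
  then show ?thesis unfolding f by (simp add: matmul.sum_right matrix_mul_outer)
qed

lemma psd_inner_zero': "psd A \<Longrightarrow> psd B \<Longrightarrow> A \<bullet> B = 0 \<Longrightarrow> A ** B = 0"
  using psd_inner_zero[of B A] by (simp add: inner_commute)

text \<open>\<open>P\<close> is the orthogonal projection onto the column space of \<open>V\<close>,
  built from an orthonormal basis. The third property is the useful one: whatever is annihilated
  after multiplication by \<open>V\<close> is annihilated after multiplication by \<open>P\<close>,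
  so \<open>V\<close> can be cancelled without a pseudo-inverse.\<close>

lemma range_projection_exists:
  fixes V :: "real^'m^'m"
  obtains P where "transpose P = P" "P ** V = V" "\<And>X::real^'m^'m. X ** V = 0 \<Longrightarrow> X ** P = 0"
proof -
  obtain B where B: "0 \<notin> B" "B \<subseteq> span (columns V)" "pairwise orthogonal B" "\<And>x. x \<in> B \<Longrightarrow> norm x = 1"
     "independent B" "card B = dim (span (columns V))" "span B = span (columns V)"
    using orthonormal_basis_subspace[of "span (columns V)"] subspace_span by (metis dim_span norm_zero zero_neq_one)
  have fin: "finite B" using B(5) independent_imp_finite by blast
  define P where "P = (\<Sum>b\<in>B. outer b b)"
  have Pb: "P *v b = b" if "b \<in> B" for b
  proof -
    have "P *v b = (\<Sum>c\<in>B. (c \<bullet> b) *\<^sub>R c)" by (simp add: P_def matvec.sum_left outer_vector_mul)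
    also have "\<dots> = (\<Sum>c\<in>B. if c = b then c else 0)"
    proof (rule sum.cong)
      fix c assume c: "c \<in> B"
      show "(c \<bullet> b) *\<^sub>R c = (if c = b then c else 0)"
        using B(3) c that B(4)[OF that] by (auto simp: pairwise_def orthogonal_def norm_eq_1)
    qed simp
    finally show ?thesis using fin that by simp
  qed
  have Pspan: "P *v v = v" if "v \<in> span B" for v
    using that
  proof (induction rule: span_induct_alt)
    case base then show ?case by (simp add: matvec.zero_right)
  next
    case (step c x y) then show ?case by (simp add: matvec.add_right matvec.scaleR_right Pb)
  qed
  have col: "column j V \<in> span B" for j
    using B(7) span_base[of "column j V" "columns V"] by (auto simp: columns_def)
  have PV: "P ** V = V"
  proof -
    have "column j (P ** V) = column j V" for j
      using Pspan[OF col[of j]] by (simp add: vec_eq_iff column_def matrix_matrix_mult_def matrix_vector_mult_def)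
    then show ?thesis by (simp add: vec_eq_iff column_def)
  qed
  have XP: "X ** P = 0" if "X ** V = 0" for X :: "real^'m^'m"
  proof -
    have Xc: "X *v column j V = 0" for j
    proof -
      have "X *v column j V = column j (X ** V)"
        by (simp add: vec_eq_iff column_def matrix_matrix_mult_def matrix_vector_mult_def)
      then show ?thesis using that by (simp add: vec_eq_iff column_def)
    qed
    have "X *v v = 0" if "v \<in> span (columns V)" for v
      using that
    proof (induction rule: span_induct_alt)
      case base then show ?case by (simp add: matvec.zero_right)
    next
      case (step c x y) then show ?case by (auto simp: matvec.add_right matvec.scaleR_right columns_def Xc)
    qed
    then have "X *v b = 0" if "b \<in> B" for b using B(2) that by blast
    then show ?thesis by (simp add: P_def matmul.sum_right matrix_mul_outer)
  qed
  show ?thesis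
    by (rule that[OF _ PV XP]) (simp add: P_def transp_sum)
qed

subsection \<open>The sign of a one-sided second derivative at a jump\<close>

lemmas mat_algebra = matmul.add_left matmul.add_right matmul.diff_left matmul.diff_right
  matmul.scaleR_left matmul.scaleR_right matmul.minus_left matmul.minus_right
  matmul.zero_left matmul.zero_right matrix_mul_assoc

text \<open>
  The sign of a second one-sided derivative at a jump. With \<open>P\<close> the orthogonal projection onto the
  range of \<open>V\<close> and \<open>Wi\<close> a limit point of \<open>(W s - V) / s\<close>, the complementary slackness
  \<open>K s ** W s = 0\<close> is expanded in \<open>s\<close>: the block \<open>B = (1 - P) Wi (1 - P)\<close> is killed by \<open>Kp\<close>, hence
  \<open>B D0 B = 0\<close>, hence also by \<open>Km\<close>, and then \<open>B E B = 0\<close>; the mixed block of \<open>E \<bullet> Wi\<close> is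
  nonpositive because \<open>K s \<bullet> V \<ge> 0\<close>. So \<open>E \<bullet> Wi \<le> 0\<close>, whereas \<open>lam < 0\<close> and \<open>K s \<bullet> V \<ge> 0\<close>
  would force \<open>E \<bullet> Wi > 0\<close> along some sequence.
\<close>
lemma one_sided_sign:
  fixes K W F :: "real \<Rightarrow> real^'m^'m" and w :: "real \<Rightarrow> real \<Rightarrow> real" and m :: "real \<Rightarrow> real"
  assumes eta: "0 < \<eta>"
    and psdK: "\<And>s. 0 < s \<Longrightarrow> s < \<eta> \<Longrightarrow> psd (K s)"
    and psdW: "\<And>s. 0 < s \<Longrightarrow> s < \<eta> \<Longrightarrow> psd (W s)"
    and KW: "\<And>s. 0 < s \<Longrightarrow> s < \<eta> \<Longrightarrow> K s \<bullet> W s = 0"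
    and Wlip: "\<And>s. 0 < s \<Longrightarrow> s < \<eta> \<Longrightarrow> norm (W s - V) \<le> L * s"
    and Flip: "\<And>s. 0 \<le> s \<Longrightarrow> s < \<eta> \<Longrightarrow> norm (F s - E) \<le> L * s"
    and Keq: "\<And>s. 0 < s \<Longrightarrow> s < \<eta> \<Longrightarrow> K s = Kp + m s *\<^sub>R D0 + integral {0..s} (\<lambda>r. w s r *\<^sub>R F r)"
    and wFint: "\<And>s. 0 < s \<Longrightarrow> s < \<eta> \<Longrightarrow> (\<lambda>r. w s r *\<^sub>R F r) integrable_on {0..s}"
    and wint: "\<And>s. 0 < s \<Longrightarrow> s < \<eta> \<Longrightarrow> w s integrable_on {0..s}"
    and wb: "\<And>s r. 0 < s \<Longrightarrow> s < \<eta> \<Longrightarrow> 0 \<le> r \<Longrightarrow> r \<le> s \<Longrightarrow> 0 \<le> w s r \<and> w s r \<le> m s"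
    and wanti: "\<And>s r r'. 0 < s \<Longrightarrow> s < \<eta> \<Longrightarrow> 0 \<le> r \<Longrightarrow> r \<le> r' \<Longrightarrow> r' \<le> s \<Longrightarrow> w s r' \<le> w s r"
    and wpos: "\<And>s. 0 < s \<Longrightarrow> s < \<eta> \<Longrightarrow> \<exists>d>0. d \<le> s \<and> 0 < w s d"
    and mlim: "(m \<longlongrightarrow> 0) (at_right 0)"
    and psdKp: "psd Kp" and psdKm: "psd Km" and jump: "Kp - Km = \<Delta> *\<^sub>R D0" and \<Delta>: "0 < \<Delta>"
    and psdV: "psd V" and KpV: "Kp \<bullet> V = 0" and KmV: "Km \<bullet> V = 0"
    and symE: "transpose E = E"
    and lim: "((\<lambda>s. (F s \<bullet> V - E \<bullet> W s) / s) \<longlongrightarrow> lam) (at_right 0)"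
  shows "0 \<le> lam"
proof (rule ccontr)
  assume neg: "\<not> 0 \<le> lam"
  \<comment> \<open>\<open>\<kappa> s\<close> is the total weight and \<open>G s\<close> the
    corresponding weighted mean of \<open>F\<close>. Thus
    \<open>K s = Kp + m s D0 + \<kappa> s G s\<close>, where \<open>G\<close> tends to
    \<open>E\<close> because \<open>F\<close> does.\<close>
  define \<kappa> where "\<kappa> s = integral {0..s} (w s)" for s
  define G where "G s = (1 / \<kappa> s) *\<^sub>R integral {0..s} (\<lambda>r. w s r *\<^sub>R F r)" for s
  have L0: "0 \<le> L" using Flip[of "\<eta>/2"] eta by (smt (verit, best) field_sum_of_halves norm_ge_zero zero_le_mult_iff)
  have KpV0: "Kp ** V = 0" by (rule psd_inner_zero'[OF psdKp psdV KpV])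
  have KmV0: "Km ** V = 0" by (rule psd_inner_zero'[OF psdKm psdV KmV])
  have D0eq: "D0 = (1 / \<Delta>) *\<^sub>R (Kp - Km)" using jump \<Delta> by simp
  have D0V: "D0 ** V = 0" by (simp add: D0eq mat_algebra KpV0 KmV0)
  have symV: "transpose V = V" and symKp: "transpose Kp = Kp" and symKm: "transpose Km = Km"
    using psdV psdKp psdKm by (auto intro: psd_sym)
  have symD: "transpose D0 = D0" by (simp add: D0eq transp_scaleR transp_diff symKp symKm)
  obtain P where Psym: "transpose P = P" and PV: "P ** V = V"
    and XP: "\<And>X::real^'m^'m. X ** V = 0 \<Longrightarrow> X ** P = 0" by (rule range_projection_exists[of V], rule that)
  have VP: "V ** P = V" using arg_cong[OF PV, of transpose] by (simp add: matrix_transpose_mul Psym symV)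
  have KpP: "Kp ** P = 0" and D0P: "D0 ** P = 0" by (rule XP, rule KpV0, rule XP, rule D0V)
  have PKp: "P ** Kp = 0" using arg_cong[OF KpP, of transpose] by (simp add: matrix_transpose_mul Psym symKp transp_zero)
  have PD0: "P ** D0 = 0" using arg_cong[OF D0P, of transpose] by (simp add: matrix_transpose_mul Psym symD transp_zero)
  define P' where "P' = mat 1 - P"
  have VP': "V ** P' = 0" and P'sym: "transpose P' = P'" and KpP': "Kp ** P' = Kp" and D0P': "D0 ** P' = D0"
    by (simp_all add: P'_def mat_algebra VP transp_diff Psym transpose_mat KpP D0P PKp PD0)
  \<comment> \<open>These bounds separate the three scales: \<open>\<kappa> s / s\<close> and
    \<open>\<kappa> s / m s\<close> both tend to 0. Positivity comes from one positive value of the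
    antitone weight, which persists on the whole interval to its left.\<close>
  have \<kappa>: "0 < \<kappa> s" "\<kappa> s \<le> m s * s" "0 < m s" if s: "0 < s" "s < \<eta>" for s
  proof -
    obtain d where d: "0 < d" "d \<le> s" "0 < w s d" using wpos[OF s] by blast
    have "w s d * d = integral {0..d} (\<lambda>_. w s d)" using d by simp
    also have "\<dots> \<le> integral {0..d} (w s)"
      by (rule integral_le) (use d s wanti in \<open>auto intro: integrable_on_subinterval[OF wint[OF s]]\<close>)
    also have "\<dots> \<le> \<kappa> s" unfolding \<kappa>_def
      by (rule integral_subset_le) (use d s wb in \<open>auto intro: integrable_on_subinterval[OF wint[OF s]] wint\<close>)
    finally show "0 < \<kappa> s" using d by (smt (verit) mult_pos_pos)
    have "\<kappa> s \<le> integral {0..s} (\<lambda>_. m s)" unfolding \<kappa>_def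
      by (rule integral_le) (use s wb wint in auto)
    then show "\<kappa> s \<le> m s * s" using s by (simp add: mult.commute)
    show "0 < m s" using wb[OF s, of d] d by simp
  qed
  have Kexp: "K s = Kp + m s *\<^sub>R D0 + \<kappa> s *\<^sub>R G s" if s: "0 < s" "s < \<eta>" for s
    using Keq[OF s] \<kappa>(1)[OF s] by (simp add: G_def)
  have Glip: "norm (G s - E) \<le> L * s" if s: "0 < s" "s < \<eta>" for s
  proof -
    have "integral {0..s} (\<lambda>r. w s r *\<^sub>R (F r - E)) = integral {0..s} (\<lambda>r. w s r *\<^sub>R F r) - integral {0..s} (\<lambda>r. w s r *\<^sub>R E)"
      unfolding scaleR_diff_right
      by (rule integral_diff) (use wFint[OF s] integrable_on_scaleR_left[OF wint[OF s]] in auto)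
    also have "integral {0..s} (\<lambda>r. w s r *\<^sub>R E) = \<kappa> s *\<^sub>R E"
      unfolding \<kappa>_def by (rule integral_unique[OF has_integral_scaleR_left[OF integrable_integral[OF wint[OF s]]]])
    finally have e: "\<kappa> s *\<^sub>R (G s - E) = integral {0..s} (\<lambda>r. w s r *\<^sub>R (F r - E))"
      using \<kappa>(1)[OF s] by (simp add: G_def scaleR_diff_right)
    have "norm (integral {0..s} (\<lambda>r. w s r *\<^sub>R (F r - E))) \<le> integral {0..s} (\<lambda>r. w s r * (L * s))"
    proof (rule integral_norm_bound_integral)
      show "(\<lambda>r. w s r *\<^sub>R (F r - E)) integrable_on {0..s}"
        unfolding scaleR_diff_right
        by (rule integrable_diff) (use wFint[OF s] integrable_on_scaleR_left[OF wint[OF s]] in auto)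
      show "(\<lambda>r. w s r * (L * s)) integrable_on {0..s}" using wint[OF s] by (rule integrable_on_mult_left)
      fix r assume r: "r \<in> {0..s}"
      have "norm (F r - E) \<le> L * s" using Flip[of r] r s L0 by (smt (verit, best) atLeastAtMost_iff mult_left_mono)
      then show "norm (w s r *\<^sub>R (F r - E)) \<le> w s r * (L * s)" using wb[OF s, of r] r
        by (simp add: mult_left_mono)
    qed
    also have "\<dots> = \<kappa> s * (L * s)" unfolding \<kappa>_def using wint[OF s] by simp
    finally have "\<kappa> s * norm (G s - E) \<le> \<kappa> s * (L * s)" unfolding e[symmetric] using \<kappa>(1)[OF s] by simp
    then show ?thesis using \<kappa>(1)[OF s] by simp
  qed
  have KW0: "K s ** W s = 0" if s: "0 < s" "s < \<eta>" for s
    using psd_inner_zero'[OF psdK[OF s] psdW[OF s] KW[OF s]] .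
  have ev: "eventually (\<lambda>s. 0 < s \<and> s < \<eta>) (at_right 0)"
    using eta by (auto simp: eventually_at_right_field)
  have Glim: "(G \<longlongrightarrow> E) (at_right 0)"
  proof -
    have "((\<lambda>s. L * s) \<longlongrightarrow> L * 0) (at_right 0)" by (intro tendsto_intros)
    then have l: "((\<lambda>s. L * s) \<longlongrightarrow> 0) (at_right 0)" by simp
    have "eventually (\<lambda>s. norm (G s - E) \<le> L * s) (at_right 0)"
      using ev by eventually_elim (simp add: Glip)
    then show ?thesis by (rule LIM_zero_cancel[OF Lim_null_comparison[OF _ l]])
  qed
  have Wlim: "(W \<longlongrightarrow> V) (at_right 0)"
  proof -
    have "((\<lambda>s. L * s) \<longlongrightarrow> L * 0) (at_right 0)" by (intro tendsto_intros)
    then have l: "((\<lambda>s. L * s) \<longlongrightarrow> 0) (at_right 0)" by simp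
    have "eventually (\<lambda>s. norm (W s - V) \<le> L * s) (at_right 0)"
      using ev by eventually_elim (simp add: Wlip)
    then show ?thesis by (rule LIM_zero_cancel[OF Lim_null_comparison[OF _ l]])
  qed
  have PK: "X ** K s = \<kappa> s *\<^sub>R (X ** G s)" if "0 < s" "s < \<eta>" "X ** Kp = 0" "X ** D0 = 0" for X :: "real^'m^'m" and s
    using that by (simp add: Kexp mat_algebra)
  \<comment> \<open>A left factor that annihilates \<open>Kp\<close> and \<open>D0\<close> leaves
    only the \<open>\<kappa>\<close>-term of \<open>K s ** W s = 0\<close>; this term is divided by
    \<open>\<kappa> s\<close> before passing to the limit. The fact serves twice, with
    \<open>P\<close> and later with \<open>B\<close>.\<close>
  have XEV: "X ** E ** V = 0" if X: "X ** Kp = 0" "X ** D0 = 0" for X :: "real^'m^'m"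
  proof -
    have a: "eventually (\<lambda>s. X ** G s ** W s = 0) (at_right 0)"
      using ev
    proof eventually_elim
      case (elim s)
      have "\<kappa> s *\<^sub>R (X ** G s ** W s) = X ** (K s ** W s)"
        using PK[of s X] elim X by (simp add: mat_algebra)
      then show ?case using KW0 \<kappa>(1)[of s] elim by (simp add: mat_algebra)
    qed
    have b: "((\<lambda>s. X ** G s ** W s) \<longlongrightarrow> X ** E ** V) (at_right 0)"
      by (intro matmul.tendsto tendsto_const Glim Wlim)
    show ?thesis
      by (rule tendsto_unique[OF trivial_limit_at_right_real b tendsto_eventually[OF a]])
  qed
  have PEP: "P ** E ** P = 0" using XP[of "P ** E"] XEV[OF PKp PD0] by (simp add: mat_algebra)
  have EV: "E \<bullet> V = 0"
  proof -
    have "E \<bullet> V = E \<bullet> (P ** V ** P)" by (simp add: PV VP)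
    also have "\<dots> = (P ** E ** P) \<bullet> V" by (metis inner_congruence[OF Psym] inner_commute)
    finally show ?thesis by (simp add: PEP)
  qed
  \<comment> \<open>Chosen such that \<open>lam / 2 = - 2 * c\<close>: from
    \<open>F r \<bullet> V - E \<bullet> W r < - 2 * c * r\<close> and
    \<open>E \<bullet> W r < c * r\<close> there follows
    \<open>F r \<bullet> V < - c * r\<close>.\<close>
  define c where "c = - lam / 4"
  have cpos: "0 < c" using neg by (simp add: c_def)
  \<comment> \<open>If \<open>E \<bullet> W r\<close> stayed below \<open>c * r\<close> near 0, then
    \<open>F r \<bullet> V\<close> would be negative there. As \<open>Kp\<close> and
    \<open>D0\<close> are orthogonal to \<open>V\<close>, the inner product
    \<open>K t \<bullet> V\<close> is the weighted integral of \<open>F r \<bullet> V\<close>, hence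
    negative, against semidefiniteness.\<close>
  have ex: "\<exists>s. 0 < s \<and> s < \<eta> \<and> s < d \<and> c * s \<le> E \<bullet> W s" if d: "0 < d" for d
  proof (rule ccontr)
    assume contra: "\<not> ?thesis"
    have "eventually (\<lambda>s. (F s \<bullet> V - E \<bullet> W s) / s < lam / 2) (at_right 0)"
      using neg by (intro order_tendstoD(2)[OF lim]) auto
    then obtain b where b: "0 < b" "\<And>s. 0 < s \<Longrightarrow> s < b \<Longrightarrow> (F s \<bullet> V - E \<bullet> W s) / s < lam / 2"
      by (auto simp: eventually_at_right_field)
    define t where "t = min b (min d \<eta>) / 2"
    have t: "0 < t" "t < b" "t < d" "t < \<eta>" using b d eta by (auto simp: t_def)
    have FV: "F r \<bullet> V \<le> - c * r" if r: "0 \<le> r" "r \<le> t" for r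
    proof (cases "r = 0")
      case True
      have "F 0 = E" using Flip[of 0] eta by simp
      then show ?thesis using EV True by simp
    next
      case False
      then have r0: "0 < r" using r by simp
      have "F r \<bullet> V - E \<bullet> W r < lam / 2 * r" using b(2)[of r] r0 r t by (simp add: field_simps)
      moreover have "E \<bullet> W r < c * r" using contra r0 r t by (meson le_less_trans not_le)
      ultimately show ?thesis by (simp add: c_def field_simps)
    qed
    obtain e where e: "0 < e" "e \<le> t" "0 < w t e" using wpos[of t] t by blast
    have "K t \<bullet> V = integral {0..t} (\<lambda>r. w t r *\<^sub>R F r) \<bullet> V"
      using Keq[of t] t KpV inner_mul_left[of D0 V "mat 1"] D0V
      by (simp add: inner_add_left D0eq inner_diff_left KmV)
    also have "\<dots> = integral {0..t} (\<lambda>r. (w t r *\<^sub>R F r) \<bullet> V)"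
      using integral_component_eq[OF wFint[OF t(1,4)]] 
        integral_linear[OF wFint[OF t(1,4)] bounded_linear_inner_left[of V]] by (simp add: o_def)
    \<comment> \<open>A strict inequality needs a piece of positive length on which weight and
      distance from 0 are both bounded below: on \<open>{e/2..e}\<close> the antitone weight is at
      least \<open>w t e\<close> and \<open>r\<close> is at least \<open>e/2\<close>.\<close>
    also have "\<dots> \<le> integral {0..t} (\<lambda>r. if r \<in> {e/2..e} then - c * (e/2) * w t e else 0)"
    proof (rule integral_le)
      show "(\<lambda>r. (w t r *\<^sub>R F r) \<bullet> V) integrable_on {0..t}"
        using integrable_linear[OF wFint[OF t(1,4)] bounded_linear_inner_left[of V]] by (simp add: o_def)
      show "(\<lambda>r. if r \<in> {e/2..e} then - c * (e/2) * w t e else 0) integrable_on {0..t}"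
        using e by (subst integrable_restrict_Int) (auto simp: Int_absorb2 Int_absorb1 intro: integrable_const_ivl)
      fix r assume r: "r \<in> {0..t}"
      have w0: "0 \<le> w t r" using wb[of t r] t r by auto
      have le: "(w t r *\<^sub>R F r) \<bullet> V \<le> w t r * (- c * r)" using mult_left_mono[OF FV[of r] w0] r by simp
      show "(w t r *\<^sub>R F r) \<bullet> V \<le> (if r \<in> {e/2..e} then - c * (e/2) * w t e else 0)"
      proof (cases "r \<in> {e/2..e}")
        case True
        have "w t e \<le> w t r" using wanti[of t r e] t r e True by auto
        then have "(c * (e/2)) * w t e \<le> (c * r) * w t r"
          using True cpos e by (intro mult_mono) auto
        then show ?thesis using le True by (simp add: mult_ac)
      next
        case False
        have "0 \<le> w t r * (c * r)" using w0 cpos r by auto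
        moreover have "(if r \<in> {e/2..e} then - c * (e/2) * w t e else 0) = 0" using False by (rule if_not_P)
        ultimately show ?thesis using le by linarith
      qed
    qed
    also have "\<dots> = integral {e/2..e} (\<lambda>r. - c * (e/2) * w t e)"
      using e by (subst integral_restrict_Int) (auto simp: Int_absorb2 Int_absorb1)
    also have "\<dots> < 0" using e cpos by (simp add: mult_pos_pos)
    finally show False using psd_inner_nonneg[OF psdK psdV, of t] t by simp
  qed
  define s where "s n = (SOME s. 0 < s \<and> s < \<eta> \<and> s < 1 / real (Suc n) \<and> c * s \<le> E \<bullet> W s)" for n
  have s: "0 < s n" "s n < \<eta>" "s n < 1 / real (Suc n)" "c * s n \<le> E \<bullet> W (s n)" for n
    using someI_ex[OF ex[of "1 / real (Suc n)"]] unfolding s_def by auto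
  have "s \<longlonglongrightarrow> 0"
    by (rule tendsto_sandwich[OF _ _ tendsto_const lim_1_over_n[THEN LIMSEQ_Suc]])
       (use s in \<open>auto intro!: always_eventually less_imp_le\<close>)
  then have slim: "filterlim s (at_right 0) sequentially"
    using s(1) by (auto simp: filterlim_at less_imp_neq[symmetric])
  \<comment> \<open>\<open>W\<close> need not be differentiable at 0. The Lipschitz bound confines
    its difference quotients to a ball, and a limit point \<open>Wi\<close> along a subsequence
    takes the place of the derivative.\<close>
  define Z where "Z n = (1 / s n) *\<^sub>R (W (s n) - V)" for n
  have "norm (Z n) \<le> L" for n
    using Wlip[OF s(1,2)[of n]] s(1)[of n] by (simp add: Z_def divide_simps)
  then have "\<forall>n. Z n \<in> cball 0 L" by simp
  then obtain Wi r where r: "strict_mono r" and Zlim: "(Z \<circ> r) \<longlonglongrightarrow> Wi"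
    using compact_cball[of "0::real^'m^'m" L] unfolding compact_def by blast
  define t where "t = s \<circ> r"
  define Y where "Y = Z \<circ> r"
  have Ylim: "Y \<longlonglongrightarrow> Wi" using Zlim by (simp add: Y_def)
  have tlim: "filterlim t (at_right 0) sequentially" unfolding t_def o_def
    using filterlim_compose[OF slim filterlim_subseq[OF r]] .
  have t: "0 < t n" "t n < \<eta>" "c * t n \<le> E \<bullet> W (t n)" for n using s by (auto simp: t_def)
  have Wt: "W (t n) = V + t n *\<^sub>R Y n" for n using t(1)[of n] by (simp add: Y_def Z_def t_def)
  have t0: "t \<longlonglongrightarrow> 0" using tlim by (simp add: filterlim_at)
  have mt: "(\<lambda>n. m (t n)) \<longlonglongrightarrow> 0" by (rule filterlim_compose[OF mlim tlim])
  have Gt: "(\<lambda>n. G (t n)) \<longlonglongrightarrow> E" by (rule filterlim_compose[OF Glim tlim])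
  have Wtl: "(\<lambda>n. W (t n)) \<longlonglongrightarrow> V" by (rule filterlim_compose[OF Wlim tlim])
  have kt: "(\<lambda>n. \<kappa> (t n) / t n) \<longlonglongrightarrow> 0"
    by (rule tendsto_sandwich[OF _ _ tendsto_const mt])
       (use \<kappa>[OF t(1,2)] t(1) in \<open>auto intro!: always_eventually simp: divide_simps less_imp_le\<close>)
  have km: "(\<lambda>n. \<kappa> (t n) / m (t n)) \<longlonglongrightarrow> 0"
    by (rule tendsto_sandwich[OF _ _ tendsto_const t0])
       (use \<kappa>[OF t(1,2)] t(1) in \<open>auto intro!: always_eventually simp: divide_simps less_imp_le mult_ac\<close>)
  have KpW: "Kp ** Wi = 0"
  proof -
    have "Kp ** Y n = - (m (t n) *\<^sub>R (D0 ** Y n)) - (\<kappa> (t n) / t n) *\<^sub>R (G (t n) ** W (t n))" for n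
    proof -
      have "t n *\<^sub>R (Kp ** Y n + m (t n) *\<^sub>R (D0 ** Y n) + (\<kappa> (t n) / t n) *\<^sub>R (G (t n) ** W (t n))) = K (t n) ** W (t n)"
        using t(1)[of n] unfolding Kexp[OF t(1,2)]
        by (simp add: mat_algebra Wt KpV0 D0V scaleR_add_right mult_ac)
      also have "\<dots> = 0" using KW0[OF t(1,2)] .
      finally have "Kp ** Y n + m (t n) *\<^sub>R (D0 ** Y n) + (\<kappa> (t n) / t n) *\<^sub>R (G (t n) ** W (t n)) = 0"
        using t(1)[of n] by (simp only: scaleR_eq_0_iff) auto
      then show ?thesis by (simp only: diff_conv_add_uminus minus_add_distrib[symmetric] eq_neg_iff_add_eq_0 add.assoc)
    qed
    moreover have "(\<lambda>n. - (m (t n) *\<^sub>R (D0 ** Y n)) - (\<kappa> (t n) / t n) *\<^sub>R (G (t n) ** W (t n)))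
        \<longlonglongrightarrow> - (0 *\<^sub>R (D0 ** Wi)) - 0 *\<^sub>R (E ** V)"
      by (intro tendsto_intros matmul.tendsto mt kt Ylim Gt Wtl)
    ultimately have "(\<lambda>n. Kp ** Y n) \<longlonglongrightarrow> 0" by simp
    moreover have "(\<lambda>n. Kp ** Y n) \<longlonglongrightarrow> Kp ** Wi" by (intro matmul.tendsto tendsto_const Ylim)
    ultimately show ?thesis using LIMSEQ_unique by blast
  qed
  \<comment> \<open>The block of \<open>Wi\<close> on the orthogonal complement of the range of
    \<open>V\<close>. It is semidefinite although \<open>Wi\<close> need not be: the compression by
    \<open>P'\<close> removes \<open>V\<close> from \<open>W (t n) = V + t n Y n\<close>.\<close>
  define B where "B = P' ** Wi ** P'"
  have psdB: "psd B"
  proof (rule psd_limit[OF sequentially_bot])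
    show "(\<lambda>n. P' ** Y n ** P') \<longlonglongrightarrow> B" unfolding B_def by (intro matmul.tendsto tendsto_const Ylim)
    have P'V: "P' ** V = 0" by (simp add: P'_def mat_algebra PV)
    have "P' ** Y n ** P' = (1 / t n) *\<^sub>R (P' ** W (t n) ** transpose P')" for n
      using t(1)[of n] by (simp add: Wt mat_algebra P'sym P'V)
    moreover have "psd ((1 / t n) *\<^sub>R (P' ** W (t n) ** transpose P'))" for n
      using t(1)[of n] by (intro psd_scaleR psd_congruence psdW t) auto
    ultimately show "\<forall>\<^sub>F n in sequentially. psd (P' ** Y n ** P')" by simp
  qed
  have symB: "transpose B = B" by (rule psd_sym[OF psdB])
  have KpB: "Kp ** B = 0"
    using KpW by (simp add: B_def matrix_mul_assoc KpP' matmul.zero_left)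
  have BKp: "B ** Kp = 0" using arg_cong[OF KpB, of transpose] by (simp add: matrix_transpose_mul symB symKp transp_zero)
  \<comment> \<open>Multiplication by \<open>B\<close> on the left removes \<open>Kp\<close>, by
    \<open>P'\<close> on the right removes \<open>V\<close>. The leading order of what remains of
    \<open>K ** W = 0\<close> is \<open>m (t n) * t n\<close>, and division by it leaves a remainder
    of order \<open>\<kappa> / m\<close>.\<close>
  have BDB: "B ** D0 ** B = 0"
  proof -
    have "B ** D0 ** Y n ** P' = - ((\<kappa> (t n) / m (t n)) *\<^sub>R (B ** G (t n) ** Y n ** P'))" for n
    proof -
      have "(m (t n) * t n) *\<^sub>R (B ** D0 ** Y n ** P' + (\<kappa> (t n) / m (t n)) *\<^sub>R (B ** G (t n) ** Y n ** P'))
         = B ** (K (t n) ** W (t n)) ** P'"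
        using \<kappa>(3)[OF t(1,2), of n] unfolding Kexp[OF t(1,2)]
        by (simp add: mat_algebra Wt BKp scaleR_add_right mult_ac) (simp add: matrix_mul_assoc[symmetric] VP' matmul.zero_right mat_algebra(5,6) D0V)
      also have "\<dots> = 0" using KW0[OF t(1,2)] by (simp add: mat_algebra)
      finally have "B ** D0 ** Y n ** P' + (\<kappa> (t n) / m (t n)) *\<^sub>R (B ** G (t n) ** Y n ** P') = 0"
        using t(1)[of n] \<kappa>(3)[OF t(1,2), of n] by (simp only: scaleR_eq_0_iff) auto
      then show ?thesis by (simp only: eq_neg_iff_add_eq_0)
    qed
    moreover have "(\<lambda>n. - ((\<kappa> (t n) / m (t n)) *\<^sub>R (B ** G (t n) ** Y n ** P'))) \<longlonglongrightarrow> - (0 *\<^sub>R (B ** E ** Wi ** P'))"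
      by (intro tendsto_intros matmul.tendsto km Ylim Gt)
    ultimately have "(\<lambda>n. B ** D0 ** Y n ** P') \<longlonglongrightarrow> 0" by simp
    moreover have "(\<lambda>n. B ** D0 ** Y n ** P') \<longlonglongrightarrow> B ** D0 ** Wi ** P'"
      by (intro matmul.tendsto tendsto_const Ylim)
    ultimately have "B ** D0 ** Wi ** P' = 0" using LIMSEQ_unique by blast
    moreover have "B ** D0 ** B = B ** (D0 ** P') ** Wi ** P'" by (simp add: B_def matrix_mul_assoc)
    ultimately show ?thesis by (simp add: D0P')
  qed
  \<comment> \<open>\<open>Km\<close> differs from \<open>Kp\<close> by a multiple of
    \<open>D0\<close>, so its quadratic form vanishes on the range of \<open>B\<close>;
    semidefiniteness of \<open>Km\<close> makes these vectors null vectors. This is where the second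
    one-sided limit of the jump is needed.\<close>
  have KmB: "Km ** B = 0"
  proof -
    have Km: "Km = Kp - \<Delta> *\<^sub>R D0" by (simp flip: jump)
    have "B ** Km ** B = 0" unfolding Km by (simp add: mat_algebra BKp BDB)
    then have "B ** Km ** B *v z = 0" for z by (simp add: matvec.zero_left)
    then have z: "z \<bullet> (B *v (Km *v (B *v z))) = 0" for z by (simp add: matrix_vector_mul_assoc matrix_mul_assoc)
    have "(B *v z) \<bullet> (Km *v (B *v z)) = 0" for z
      using z[of z] by (metis dot_lmul_matrix symB transpose_matrix_vector)
    then have "Km *v (B *v z) = 0" for z by (rule psd_null_vector[OF psdKm])
    then show ?thesis by (simp add: matrix_eq matrix_vector_mul_assoc matvec.zero_left)
  qed
  have BKm: "B ** Km = 0" using arg_cong[OF KmB, of transpose] by (simp add: matrix_transpose_mul symB symKm transp_zero)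
  have BD0: "B ** D0 = 0" by (simp add: D0eq mat_algebra BKp BKm)
  have BEP: "B ** E ** P = 0" using XP[of "B ** E"] XEV[OF BKp BD0] by (simp add: mat_algebra)
  \<comment> \<open>Now \<open>B\<close> annihilates both \<open>Kp\<close> and \<open>D0\<close>,
    so the compressed equation is an exact multiple of \<open>B ** G ** Y ** P'\<close> for each
    \<open>n\<close>, with no remainder.\<close>
  have BEB: "B ** E ** B = 0"
  proof -
    have "B ** G (t n) ** Y n ** P' = 0" for n
    proof -
      have "(\<kappa> (t n) * t n) *\<^sub>R (B ** G (t n) ** Y n ** P') = B ** K (t n) ** W (t n) ** P'"
        using PK[OF t(1,2) BKp BD0, of n]
        by (simp add: mat_algebra Wt) (simp add: matrix_mul_assoc[symmetric] VP' matmul.zero_right mult_ac)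
      also have "\<dots> = 0" using KW0[OF t(1,2), of n] by (metis matmul.zero_left matmul.zero_right matrix_mul_assoc)
      finally show ?thesis using t(1)[of n] \<kappa>(1)[OF t(1,2), of n] by (simp only: scaleR_eq_0_iff) auto
    qed
    moreover have "(\<lambda>n. B ** G (t n) ** Y n ** P') \<longlonglongrightarrow> B ** E ** Wi ** P'"
      by (intro matmul.tendsto tendsto_const Ylim Gt)
    ultimately have "B ** E ** Wi ** P' = 0" by (simp add: LIMSEQ_const_iff)
    moreover have "B ** E ** B = B ** E ** Wi ** P' - B ** E ** P ** Wi ** P'"
      by (simp add: B_def P'_def mat_algebra)
    ultimately show ?thesis by (simp add: BEP matmul.zero_left)
  qed
  \<comment> \<open>The second factor \<open>B\<close> in \<open>B ** E ** B = 0\<close> is replaced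
    by the projection \<open>R\<close> onto its range; the trace of \<open>B ** E ** R\<close> is
    then \<open>E \<bullet> B\<close>.\<close>
  have EB: "E \<bullet> B = 0"
  proof -
    obtain R where R: "transpose R = R" "R ** B = B" "\<And>X::real^'m^'m. X ** B = 0 \<Longrightarrow> X ** R = 0"
      by (rule range_projection_exists[of B], rule that)
    have "B ** E ** R = 0" using R(3)[OF BEB] .
    have "E \<bullet> B = (E ** transpose R) \<bullet> B" using R(1,2) by (metis inner_commute inner_mul_right matrix_transpose_mul symB transpose_transpose)
    also have "\<dots> = trace (B ** E ** R)" 
      by (metis R(1) inner_commute inner_matrix_trace matrix_mul_assoc symB)
    finally show ?thesis using \<open>B ** E ** R = 0\<close> by (simp add: trace_def)
  qed
  \<comment> \<open>The trace of \<open>P ** K ** W = 0\<close> splits into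
    \<open>K \<bullet> V\<close>, which is nonnegative, and \<open>t n\<close> times the trace of
    \<open>P ** K ** Y\<close>, which is therefore not positive. As \<open>P\<close> annihilates
    \<open>Kp\<close> and \<open>D0\<close>, only the \<open>\<kappa>\<close>-term enters the
    latter.\<close>
  have PEW: "(P ** E) \<bullet> Wi \<le> 0"
  proof -
    have symK: "transpose (K (t n)) = K (t n)" for n by (rule psd_sym[OF psdK[OF t(1,2)]])
    have "(P ** G (t n)) \<bullet> Y n \<le> 0" for n
    proof -
      have "0 = trace (P ** K (t n) ** W (t n))"
        using KW0[OF t(1,2), of n]
        by (simp add: matrix_mul_assoc[symmetric] matmul.zero_right linear_0[OF linear_trace])
      also have "\<dots> = trace (P ** K (t n) ** V) + t n * trace (P ** K (t n) ** Y n)"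
        by (simp add: Wt mat_algebra trace_add linear_scale[OF linear_trace])
      also have "trace (P ** K (t n) ** V) = K (t n) \<bullet> V"
        using trace_mul_sym[of P "K (t n) ** V"]
        by (simp add: inner_sym_trace[OF symK] matrix_mul_assoc[symmetric] VP)
      finally have "t n * trace (P ** K (t n) ** Y n) \<le> 0"
        using psd_inner_nonneg[OF psdK[OF t(1,2)] psdV, of n] by simp
      then have "trace (P ** K (t n) ** Y n) \<le> 0" using t(1)[of n] by (simp add: mult_le_0_iff not_less)
      then have "\<kappa> (t n) * trace (P ** G (t n) ** Y n) \<le> 0"
        using PK[OF t(1,2) PKp PD0, of n] by (simp add: mat_algebra linear_scale[OF linear_trace])
      then have tr: "trace (P ** G (t n) ** Y n) \<le> 0" using \<kappa>(1)[OF t(1,2), of n] by (simp add: mult_le_0_iff)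
      have symY: "transpose (Y n) = Y n"
        by (simp add: Y_def Z_def transp_scaleR transp_diff symV psd_sym[OF psdW] s)
      have "(P ** G (t n)) \<bullet> Y n = trace (P ** G (t n) ** Y n)"
        using trace_mul_sym[of "P ** G (t n)" "Y n"] by (subst inner_commute) (simp add: inner_sym_trace[OF symY])
      then show ?thesis using tr by simp
    qed
    moreover have "(\<lambda>n. (P ** G (t n)) \<bullet> Y n) \<longlonglongrightarrow> (P ** E) \<bullet> Wi"
      by (intro tendsto_intros matmul.tendsto Ylim Gt)
    ultimately show ?thesis by (intro LIMSEQ_le_const2[where X="\<lambda>n. (P ** G (t n)) \<bullet> Y n"]) auto
  qed
  have symWi: "transpose Wi = Wi"
  proof -
    have "transpose (Y n) = Y n" for n
      by (simp add: Y_def Z_def transp_scaleR transp_diff symV psd_sym[OF psdW] s)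
    then have "(\<lambda>n. Y n) \<longlonglongrightarrow> transpose Wi" using transp_tendsto[OF Ylim] by simp
    then show ?thesis by (rule LIMSEQ_unique[OF _ Ylim])
  qed
  have "E \<bullet> Wi \<le> 0"
  proof -
    \<comment> \<open>Block decomposition with respect to the range of \<open>V\<close>: the two
      mixed terms contribute equally by symmetry, the corner on the complement pairs with
      \<open>B\<close> and gives 0, and \<open>P ** E ** P\<close> is 0.\<close>
    have EE: "E = P ** E + E ** P + P' ** E ** P' - P ** E ** P"
      by (simp add: P'_def mat_algebra)
    have "(E ** P) \<bullet> Wi = (P ** E) \<bullet> Wi"
      using inner_transpose[of "P ** E" Wi] by (simp add: matrix_transpose_mul symE Psym symWi)
    moreover have "(P' ** E ** P') \<bullet> Wi = E \<bullet> B"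
      by (simp add: B_def inner_congruence[OF P'sym])
    ultimately have "E \<bullet> Wi = 2 * ((P ** E) \<bullet> Wi)"
      by (subst EE) (simp add: inner_add_left inner_diff_left EB PEP)
    then show ?thesis using PEW by simp
  qed
  moreover have "c \<le> E \<bullet> Wi"
  proof (rule LIMSEQ_le_const)
    show "(\<lambda>n. E \<bullet> Y n) \<longlonglongrightarrow> E \<bullet> Wi" by (intro tendsto_intros Ylim)
    have "c * t n \<le> t n * (E \<bullet> Y n)" for n using t(3)[of n] by (simp add: Wt inner_add_right EV)
    then show "\<exists>N. \<forall>n\<ge>N. c \<le> E \<bullet> Y n" using t(1) by (simp add: mult.commute)
  qed
  ultimately show False using cpos by simp
qed

subsection \<open>Integration, determinants and inverses\<close>

text \<open>If the function increased, some value taken by no exceptional point would be attained for the last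
  time with slope at least \<open>c > 0\<close>.\<close>
lemma zero_deriv_countable_le:
  fixes f :: "real \<Rightarrow> real"
  assumes "a \<le> b" and cont: "continuous_on {a..b} f" and S: "countable S"
    and der: "\<And>t. t \<in> {a<..<b} - S \<Longrightarrow> (f has_real_derivative 0) (at t)"
  shows "f b \<le> f a"
proof (rule ccontr)
  assume "\<not> f b \<le> f a"
  then have lt: "f a < f b" by simp
  with \<open>a \<le> b\<close> have ab: "a < b" by (cases "a = b") auto
  \<comment> \<open>Half the mean slope: subtracting the line of slope \<open>c\<close> still leaves
    \<open>g a = 0 < g b\<close>, while \<open>g\<close> has derivative \<open>- c\<close> off
    \<open>S\<close>.\<close>
  define c where "c = (f b - f a) / (2 * (b - a))"
  define g where "g t = f t - f a - c * (t - a)" for t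
  have c: "0 < c" using lt ab by (simp add: c_def)
  have "c * (b - a) = (f b - f a) / 2" using ab by (simp add: c_def field_simps)
  then have gb: "0 < g b" using lt by (simp add: g_def)
  have gc: "continuous_on {a..b} g" unfolding g_def by (intro continuous_intros cont)
  have "countable (g ` S)" using S by simp
  then have "\<not> {0<..<g b} \<subseteq> g ` S"
    using uncountable_open_interval[of 0 "g b"] gb countable_subset by blast
  then obtain v where v: "0 < v" "v < g b" "v \<notin> g ` S"
    by (metis greaterThanLessThan_iff subsetI)
  define X where "X = {t \<in> {a..b}. g t \<le> v}"
  have "closed X" unfolding X_def by (intro continuous_on_closed_Collect_le gc continuous_intros)
  then have "compact X" unfolding X_def by (auto simp: compact_eq_bounded_closed intro: bounded_subset[of "{a..b}"])
  moreover have "a \<in> X" using v ab by (simp add: X_def g_def)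
  ultimately obtain t where t: "t \<in> X" "\<And>s. s \<in> X \<Longrightarrow> s \<le> t"
    using compact_attains_sup[of X] by blast
  have tab: "a \<le> t" "t \<le> b" "g t \<le> v" using t(1) by (auto simp: X_def)
  have "\<exists>z\<ge>t. z \<le> b \<and> g z = v"
    using v tab by (intro IVT') (auto intro: continuous_on_subset[OF gc])
  then obtain z where z: "t \<le> z" "z \<le> b" "g z = v" by blast
  then have "z \<in> X" using tab by (simp add: X_def)
  then have gt: "g t = v" using t(2)[of z] z by simp
  have ta: "a < t" using gt v tab by (cases "t = a") (auto simp: g_def)
  have tb: "t < b" using gt v tab by (cases "t = b") auto
  have "t \<notin> S" using gt v by auto
  then have d: "(f has_real_derivative 0) (at t)" using der ta tb by simp
  have "(g has_real_derivative - c) (at t)" unfolding g_def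
    by (rule derivative_eq_intros d refl | simp)+
  from DERIV_neg_dec_right[OF this] c obtain d where d: "0 < d" "\<And>h. 0 < h \<Longrightarrow> h < d \<Longrightarrow> g (t + h) < g t"
    by auto
  define h where "h = min d (b - t) / 2"
  have h: "0 < h" "h < d" "t + h \<le> b" using d tb by (auto simp: h_def min_def field_simps)
  have "t + h \<in> X" using d(2)[OF h(1,2)] h ta gt by (simp add: X_def)
  then show False using t(2)[of "t + h"] h by simp
qed

text \<open>The fundamental theorem of calculus across the possible jumps of \<open>x\<close>, which
  form a countable set. The difference of \<open>G\<close> and the indefinite integral is continuous
  with derivative 0 off \<open>S\<close>; each component, taken with both signs, cannot
  increase.\<close>

lemma has_integral_deriv_countable:
  fixes G :: "real \<Rightarrow> 'a::euclidean_space"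
  assumes ab: "a \<le> b" and cont: "continuous_on {a..b} G" and S: "countable S"
    and der: "\<And>t. t \<in> {a<..<b} - S \<Longrightarrow> (G has_vector_derivative g t) (at t)"
    and gc: "\<And>t. t \<in> {a<..<b} - S \<Longrightarrow> isCont g t"
    and int: "g integrable_on {a..b}"
  shows "(g has_integral (G b - G a)) {a..b}"
proof -
  define I where "I t = integral {a..t} g" for t
  have Ic: "continuous_on {a..b} I" unfolding I_def by (rule indefinite_integral_continuous_1[OF int])
  have Id: "(I has_vector_derivative g t) (at t)" if t: "t \<in> {a<..<b} - S" for t
  proof -
    have "((\<lambda>u. integral {a..u} g) has_vector_derivative g t) (at t within ({a..b} - {}))"
      by (rule integral_has_vector_derivative_continuous_at[OF int])
         (use t gc[OF t] in \<open>auto intro: continuous_at_imp_continuous_at_within\<close>)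
    then have "(I has_vector_derivative g t) (at t within {a..b})" by (simp add: I_def[abs_def])
    then show ?thesis using t by (simp add: at_within_Icc_at)
  qed
  have "(G b - I b) \<bullet> e = (G a - I a) \<bullet> e" if "e \<in> Basis" for e
  proof -
    define E where "E t = (G t - I t) \<bullet> e" for t
    have E: "continuous_on {a..b} E" unfolding E_def by (intro continuous_intros cont Ic)
    have E': "(E has_real_derivative 0) (at t)" if t: "t \<in> {a<..<b} - S" for t
    proof -
      have "((\<lambda>t. G t - I t) has_vector_derivative g t - g t) (at t)"
        by (intro has_vector_derivative_diff der Id t)
      from bounded_linear.has_vector_derivative[OF bounded_linear_inner_left this, of e]
      show ?thesis by (simp add: E_def[abs_def] has_real_derivative_iff_has_vector_derivative)
    qed
    have "E b \<le> E a" by (rule zero_deriv_countable_le[OF ab E S E'])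
    moreover have "- E b \<le> - E a"
    proof (rule zero_deriv_countable_le[OF ab _ S])
      show "continuous_on {a..b} (\<lambda>x. - E x)" by (intro continuous_intros E)
      show "((\<lambda>x. - E x) has_real_derivative 0) (at t)" if "t \<in> {a<..<b} - S" for t
        using DERIV_minus[OF E'[OF that]] by simp
    qed
    ultimately show ?thesis by (simp add: E_def)
  qed
  then have "G b - I b = G a - I a" by (rule euclidean_eqI)
  moreover have "I a = 0" by (simp add: I_def)
  ultimately have "I b = G b - G a" by (simp add: algebra_simps)
  then show ?thesis using integrable_integral[OF int] by (simp add: I_def)
qed

text \<open>\<open>x\<close> may jump, so measurability is taken from monotonicity and boundedness
  from compactness. Absolute integrability is what the change of variables under a time change asks
  for.\<close>

lemma mono_scaleR_absolutely_integrable: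
  fixes f :: "real \<Rightarrow> 'a::euclidean_space"
  assumes x: "mono_on {a..b} (x :: real \<Rightarrow> real)" and f: "continuous_on {a..b} f"
  shows "(\<lambda>t. x t *\<^sub>R f t) absolutely_integrable_on {a..b}"
proof (cases "a \<le> b")
  case ab: True
  have m: "(\<lambda>t. x t *\<^sub>R f t) \<in> borel_measurable (lebesgue_on {a..b})"
    by (intro borel_measurable_scaleR borel_measurable_integrable[OF integrable_mono_on[OF x]]
        continuous_imp_measurable_on_sets_lebesgue f) auto
  obtain C where C: "\<And>t. t \<in> {a..b} \<Longrightarrow> norm (f t) \<le> C"
    using compact_continuous_image[OF f compact_Icc] compact_imp_bounded bounded_iff by (metis imageI)
  define X where "X = max \<bar>x a\<bar> \<bar>x b\<bar>"
  have X: "\<bar>x t\<bar> \<le> X" if "t \<in> {a..b}" for t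
    using mono_onD[OF x, of a t] mono_onD[OF x, of t b] that by (auto simp: X_def)
  have b: "norm (x t *\<^sub>R f t) \<le> X * C" if "t \<in> {a..b}" for t
    using X[OF that] C[OF that] by (auto intro!: mult_mono)
  have 1: "(\<lambda>t. x t *\<^sub>R f t) integrable_on {a..b}"
    by (rule measurable_bounded_by_integrable_imp_integrable[OF m, of "\<lambda>_. X * C"]) (use b in auto)
  show ?thesis
    by (rule absolutely_integrable_integrable_bound[OF b 1]) auto
qed auto

lemma mono_scaleR_integrable:
  fixes f :: "real \<Rightarrow> 'a::euclidean_space"
  assumes "mono_on {a..b} (x :: real \<Rightarrow> real)" "continuous_on {a..b} f"
  shows "(\<lambda>t. x t *\<^sub>R f t) integrable_on {a..b}"
  using mono_scaleR_absolutely_integrable[OF assms] by (rule set_lebesgue_integral_eq_integral)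

text \<open>In the Leibniz sum a permutation other than the identity moves at least two indices.
  After one factor has been differentiated, an off-diagonal entry of the identity matrix is still
  present, so only the diagonal term survives.\<close>

lemma det_has_derivative_id: "(det has_derivative trace) (at (mat 1 :: real^'m^'m))"
proof -
  let ?U = "UNIV :: 'm set"
  have lin: "bounded_linear (\<lambda>A::real^'m^'m. A $ i $ j)" for i j
    by (rule bounded_linear_compose[OF bounded_linear_vec_nth bounded_linear_vec_nth])
  have d: "((\<lambda>A::real^'m^'m. \<Sum>p | p permutes ?U. of_int (sign p) * (\<Prod>i\<in>?U. A $ i $ p i)) has_derivative
     (\<lambda>Y. \<Sum>p | p permutes ?U. of_int (sign p) *
        (\<Sum>i\<in>?U. Y $ i $ p i * (\<Prod>j\<in>?U - {i}. (mat 1 :: real^'m^'m) $ j $ p j)))) (at (mat 1))"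
    by (intro has_derivative_sum has_derivative_mult_right has_derivative_prod bounded_linear_imp_has_derivative lin)
  have z: "(\<Prod>j\<in>?U - {i}. (mat 1 :: real^'m^'m) $ j $ p j) = 0" if p: "p permutes ?U" "p \<noteq> id" for p i
  proof -
    obtain k where k: "p k \<noteq> k" using p(2) by (auto simp: fun_eq_iff)
    have "p (p k) \<noteq> p k" using k permutes_inj[OF p(1)] by (auto dest: injD)
    then obtain j where "j \<noteq> i" "p j \<noteq> j" using k by metis
    then have "\<exists>j\<in>?U - {i}. (mat 1 :: real^'m^'m) $ j $ p j = 0" by (intro bexI[of _ j]) (auto simp: mat_def)
    then show ?thesis by (simp add: prod_zero_iff)
  qed
  have "(\<Sum>p | p permutes ?U. of_int (sign p) *
        (\<Sum>i\<in>?U. Y $ i $ p i * (\<Prod>j\<in>?U - {i}. (mat 1 :: real^'m^'m) $ j $ p j))) = trace Y" for Y :: "real^'m^'m"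
  proof -
    have "(\<Sum>p | p permutes ?U. of_int (sign p) *
        (\<Sum>i\<in>?U. Y $ i $ p i * (\<Prod>j\<in>?U - {i}. (mat 1 :: real^'m^'m) $ j $ p j)))
      = (\<Sum>p\<in>{id}. of_int (sign p) * (\<Sum>i\<in>?U. Y $ i $ p i * (\<Prod>j\<in>?U - {i}. (mat 1 :: real^'m^'m) $ j $ p j)))"
      by (rule sum.mono_neutral_right) (auto simp: z permutes_id finite_permutations)
    also have "\<dots> = trace Y" by (simp add: sign_id trace_def mat_def)
    finally show ?thesis .
  qed
  then show ?thesis using d by (simp add: det_def[abs_def])
qed

lemma continuous_on_det: "continuous_on S (det :: real^'m^'m \<Rightarrow> real)"
  unfolding det_def[abs_def] by (intro continuous_intros)

lemma tendsto_det: "(f \<longlongrightarrow> A) F \<Longrightarrow> ((\<lambda>t. det (f t)) \<longlongrightarrow> det (A :: real^'m^'m)) F"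
  unfolding det_def by (intro tendsto_intros) auto

lemma matrix_inv_mult:
  assumes "det (A::real^'m^'m) \<noteq> 0"
  shows "A ** matrix_inv A = mat 1" "matrix_inv A ** A = mat 1"
proof -
  have "\<exists>A'. A ** A' = mat 1 \<and> A' ** A = mat 1" using assms invertible_det_nz[of A] by (simp add: invertible_def)
  from someI_ex[OF this] show "A ** matrix_inv A = mat 1" "matrix_inv A ** A = mat 1"
    by (auto simp: matrix_inv_def)
qed

text \<open>Jacobi's formula: factoring out \<open>det (A t)\<close> moves the base point to the
  identity matrix, where the derivative is the trace.\<close>

lemma det_has_vector_derivative:
  fixes A :: "real \<Rightarrow> real^'m^'m"
  assumes A: "(A has_vector_derivative A') (at t within S)" and nz: "det (A t) \<noteq> 0"
  shows "((\<lambda>s. det (A s)) has_real_derivative det (A t) * trace (matrix_inv (A t) ** A')) (at t within S)"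
proof -
  define B where "B s = matrix_inv (A t) ** A s" for s
  have Bt: "B t = mat 1" by (simp add: B_def matrix_inv_mult[OF nz])
  have "(B has_vector_derivative matrix_inv (A t) ** A') (at t within S)"
    unfolding B_def[abs_def]
    by (rule bounded_linear.has_vector_derivative[OF matmul.bounded_linear_right A])
  then have "(B has_derivative (\<lambda>h. h *\<^sub>R (matrix_inv (A t) ** A'))) (at t within S)"
    by (simp add: has_vector_derivative_def)
  from has_derivative_compose[OF this, of det trace] det_has_derivative_id
  have "((\<lambda>s. det (B s)) has_derivative (\<lambda>h. trace (h *\<^sub>R (matrix_inv (A t) ** A')))) (at t within S)"
    by (simp add: Bt)
  then have "((\<lambda>s. det (B s)) has_vector_derivative trace (matrix_inv (A t) ** A')) (at t within S)"
    unfolding has_vector_derivative_def linear_scale[OF linear_trace] .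
  then have "((\<lambda>s. det (B s)) has_real_derivative trace (matrix_inv (A t) ** A')) (at t within S)"
    by (simp only: has_real_derivative_iff_has_vector_derivative)
  then have "((\<lambda>s. det (A t) * det (B s)) has_real_derivative det (A t) * trace (matrix_inv (A t) ** A')) (at t within S)"
    by (rule DERIV_cmult)
  moreover have "det (A t) * det (B s) = det (A s)" for s
    by (simp add: B_def matrix_mul_assoc matrix_inv_mult[OF nz] flip: det_mul)
  ultimately show ?thesis by simp
qed

section \<open>Positive definiteness with an explicit lower bound, and inverses\<close>

definition pos_def :: "real \<Rightarrow> real^'m^'m \<Rightarrow> bool" where
  "pos_def c A \<longleftrightarrow> psd A \<and> (\<forall>v. c * (v \<bullet> v) \<le> v \<bullet> (A *v v))"

lemma pos_def_add_psd: "pos_def c A \<Longrightarrow> psd B \<Longrightarrow> pos_def c (A + B)"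
  by (auto simp: pos_def_def psd_add matvec.add_left inner_add_right intro: add_increasing2 psd_nonneg)

lemma pos_def_mono: "pos_def c A \<Longrightarrow> psd (B - A) \<Longrightarrow> pos_def c B"
  using pos_def_add_psd[of c A "B - A"] by simp

lemma pos_def_norm_bound:
  assumes "pos_def c A" "0 < c" shows "c * norm v \<le> norm (A *v v)"
proof (cases "v = 0")
  case False
  have "c * (norm v * norm v) \<le> v \<bullet> (A *v v)" using assms by (simp add: pos_def_def dot_square_norm power2_eq_square)
  also have "\<dots> \<le> norm v * norm (A *v v)" by (rule norm_cauchy_schwarz)
  finally show ?thesis using False by (simp add: mult_ac)
qed simp

lemma pos_def_det_nz: assumes "pos_def c A" "0 < c" shows "det A \<noteq> 0"
proof -
  have "v = 0" if "A *v v = 0" for v using pos_def_norm_bound[OF assms, of v] that assms(2) by (simp add: mult_le_0_iff)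
  then have "invertible A" by (metis invertible_left_inverse matrix_left_invertible_ker)
  then show ?thesis by (simp add: invertible_det_nz)
qed

lemma psd_mat_1: "psd (mat 1)"
  by (simp add: psd_def transpose_mat)

text \<open>The segment from the identity matrix to \<open>A\<close> consists of positive definite
  matrices, on which the determinant has no zero; it starts at 1, so by the intermediate value
  theorem it stays positive.\<close>

lemma pos_def_det_pos: assumes A: "pos_def c A" "0 < c" shows "det A > 0"
proof (rule ccontr)
  assume "\<not> 0 < det A"
  define B where "B s = (1 - s) *\<^sub>R mat 1 + s *\<^sub>R A" for s :: real
  have pd: "pos_def (min 1 c) (B s)" if s: "0 \<le> s" "s \<le> 1" for s
    unfolding pos_def_def
  proof safe
    show "psd (B s)" using A s by (auto simp: B_def pos_def_def intro!: psd_add psd_scaleR psd_mat_1)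
    fix v :: "real^'a"
    have "min 1 c * (v \<bullet> v) = (1 - s) * (min 1 c * (v \<bullet> v)) + s * (min 1 c * (v \<bullet> v))" by (simp add: algebra_simps)
    also have "\<dots> \<le> (1 - s) * (1 * (v \<bullet> v)) + s * (c * (v \<bullet> v))"
      using s by (intro add_mono mult_left_mono mult_right_mono) auto
    also have "\<dots> \<le> (1 - s) * (v \<bullet> v) + s * (v \<bullet> (A *v v))"
      using s A by (auto simp: pos_def_def intro!: mult_left_mono)
    also have "\<dots> = v \<bullet> (B s *v v)" by (simp add: B_def matvec.add_left matvec.scaleR_left inner_add_right)
    finally show "min 1 c * (v \<bullet> v) \<le> v \<bullet> (B s *v v)" .
  qed
  have "\<exists>s\<ge>0. s \<le> 1 \<and> det (B s) = 0"
  proof (rule IVT2')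
    show "det (B 1) \<le> 0" using \<open>\<not> 0 < det A\<close> by (simp add: B_def)
    show "0 \<le> det (B 0)" by (simp add: B_def)
    show "continuous_on {0..1} (\<lambda>s. det (B s))"
      by (rule continuous_on_compose2[OF continuous_on_det[of UNIV]]) (auto simp: B_def intro!: continuous_intros)
  qed auto
  then show False using pos_def_det_nz[OF pd] A by auto
qed

text \<open>\<open>c\<close> is the minimum of the quadratic form on the unit sphere. It is
  attained, and it cannot be 0, since a minimizer would then lie in the kernel.\<close>

lemma psd_det_pos_def:
  assumes A: "psd (A::real^'m^'m)" "det A \<noteq> 0" shows "\<exists>c>0. pos_def c A"
proof -
  let ?S = "sphere (0::real^'m) 1"
  have c: "continuous_on ?S (\<lambda>v. v \<bullet> (A *v v))" by (intro continuous_intros matvec.continuous_on)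
  have "?S \<noteq> {}" by simp
  from continuous_attains_inf[OF compact_sphere this c] obtain u where
    u: "u \<in> ?S" "\<And>v. v \<in> ?S \<Longrightarrow> u \<bullet> (A *v u) \<le> v \<bullet> (A *v v)" by blast
  have "u \<bullet> (A *v u) \<noteq> 0"
  proof
    assume "u \<bullet> (A *v u) = 0"
    then have "A *v u = 0" by (rule psd_null_vector[OF A(1)])
    then have "u = 0" using A(2) by (metis invertible_det_nz invertible_left_inverse matrix_left_invertible_ker)
    then show False using u by simp
  qed
  then have pos: "0 < u \<bullet> (A *v u)" using psd_nonneg[OF A(1), of u] by simp
  have "u \<bullet> (A *v u) * (v \<bullet> v) \<le> v \<bullet> (A *v v)" for v
  proof (cases "v = 0")
    case False
    have "u \<bullet> (A *v u) \<le> ((1 / norm v) *\<^sub>R v) \<bullet> (A *v ((1 / norm v) *\<^sub>R v))" using False by (intro u(2)) simp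
    also have "\<dots> = (v \<bullet> (A *v v)) / (v \<bullet> v)"
      by (simp add: matvec.scaleR_right dot_square_norm power2_eq_square)
    finally show ?thesis using False by (simp add: field_simps)
  qed simp
  then show ?thesis using pos A by (intro exI[of _ "u \<bullet> (A *v u)"]) (simp add: pos_def_def)
qed

lemma matrix_norm_le:
  assumes "\<And>v. norm ((A::real^'m^'m) *v v) \<le> B * norm v"
  shows "norm A \<le> real CARD('m) * (real CARD('m) * B)"
proof -
  have "norm A \<le> (\<Sum>i\<in>UNIV. \<Sum>j\<in>UNIV. \<bar>A $ i $ j\<bar>)"
    unfolding norm_vec_def[of A] by (rule order_trans[OF L2_set_le_sum]) (auto intro!: sum_mono norm_le_l1_cart)
  also have "\<dots> \<le> (\<Sum>i\<in>(UNIV::'m set). \<Sum>j\<in>(UNIV::'m set). B)"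
  proof (intro sum_mono)
    fix i j :: 'm
    have "\<bar>A $ i $ j\<bar> = \<bar>axis i 1 \<bullet> (A *v axis j 1)\<bar>" by (simp add: quadratic_axis)
    also have "\<dots> \<le> norm (axis i 1 :: real^'m) * norm (A *v axis j 1)" by (rule Cauchy_Schwarz_ineq2)
    also have "\<dots> \<le> 1 * (B * norm (axis j 1 :: real^'m))" by (intro mult_mono assms) auto
    finally show "\<bar>A $ i $ j\<bar> \<le> B" by simp
  qed
  finally show ?thesis by simp
qed

text \<open>The bound depends on \<open>c\<close> alone. This gives estimates of inverses that are
  uniform in time and in the perturbation parameter.\<close>

lemma norm_matrix_inv_le:
  assumes "pos_def c (A::real^'m^'m)" "0 < c"
  shows "norm (matrix_inv A) \<le> real CARD('m) * (real CARD('m) * (1 / c))"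
proof (rule matrix_norm_le)
  fix w
  have "A *v (matrix_inv A *v w) = w"
    by (simp add: matrix_vector_mul_assoc matrix_inv_mult[OF pos_def_det_nz[OF assms]])
  then show "norm (matrix_inv A *v w) \<le> 1 / c * norm w"
    using pos_def_norm_bound[OF assms, of "matrix_inv A *v w"] assms(2) by (simp add: field_simps)
qed

text \<open>The resolvent identity. Continuity, Lipschitz bound, derivative and exact difference
  quotient of the inverse are all obtained from it.\<close>

lemma matrix_inv_diff:
  assumes "det (A::real^'m^'m) \<noteq> 0" "det B \<noteq> 0"
  shows "matrix_inv A - matrix_inv B = matrix_inv A ** (B - A) ** matrix_inv B"
proof -
  have "matrix_inv A ** (B - A) ** matrix_inv B = matrix_inv A ** (B ** matrix_inv B) - (matrix_inv A ** A) ** matrix_inv B"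
    by (simp add: matmul.diff_left matmul.diff_right matrix_mul_assoc)
  then show ?thesis by (simp add: matrix_inv_mult assms)
qed

lemma matrix_inv_sym:
  assumes "transpose A = A" "det (A::real^'m^'m) \<noteq> 0" shows "transpose (matrix_inv A) = matrix_inv A"
proof -
  have "transpose (matrix_inv A) ** A = mat 1"
    using arg_cong[OF matrix_inv_mult(1)[OF assms(2)], of transpose] assms(1)
    by (simp add: matrix_transpose_mul transpose_mat)
  then have "transpose (matrix_inv A) ** (A ** matrix_inv A) = mat 1 ** matrix_inv A"
    by (simp only: matrix_mul_assoc)
  then show ?thesis by (simp add: matrix_inv_mult[OF assms(2)])
qed

text \<open>\<open>f\<close> may have jumps, as the integrands contain \<open>x\<close>; hence the
  change of variables for absolutely integrable functions, with the absolute value of the derivative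
  removed by \<open>pos\<close>.\<close>

lemma integral_substitution_mono:
  fixes f :: "real \<Rightarrow> 'a::euclidean_space"
  assumes ab: "a \<le> b" and der: "\<And>t. t \<in> {a..b} \<Longrightarrow> (g has_real_derivative g' t) (at t within {a..b})"
    and pos: "\<And>t. t \<in> {a..b} \<Longrightarrow> 0 \<le> g' t" and inj: "inj_on g {a..b}" and img: "g ` {a..b} = {g a..g b}"
    and f: "f absolutely_integrable_on {g a..g b}"
  shows "integral {a..b} (\<lambda>t. g' t *\<^sub>R f (g t)) = integral {g a..g b} f"
    and "(\<lambda>t. g' t *\<^sub>R f (g t)) integrable_on {a..b}"
proof -
  have *: "(\<lambda>t. \<bar>g' t\<bar> *\<^sub>R f (g t)) absolutely_integrable_on {a..b} \<and>
      integral {a..b} (\<lambda>t. \<bar>g' t\<bar> *\<^sub>R f (g t)) = integral {g a..g b} f"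
    using has_absolute_integral_change_of_variables_real[of "{a..b}" g g' f "integral {g a..g b} f"] der inj f
    by (simp add: img)
  have eq: "\<bar>g' t\<bar> *\<^sub>R f (g t) = g' t *\<^sub>R f (g t)" if "t \<in> {a..b}" for t using pos[OF that] by simp
  show "integral {a..b} (\<lambda>t. g' t *\<^sub>R f (g t)) = integral {g a..g b} f"
    using * integral_cong[of "{a..b}", OF eq] by simp
  have "(\<lambda>t. \<bar>g' t\<bar> *\<^sub>R f (g t)) integrable_on {a..b}" using * by (auto intro: set_lebesgue_integral_eq_integral)
  then show "(\<lambda>t. g' t *\<^sub>R f (g t)) integrable_on {a..b}"
    by (rule integrable_eq) (simp add: eq)
qed

subsection \<open>Monotone paths and power series entries\<close>

lemma has_vector_derivative_matrixI:
  fixes f :: "real \<Rightarrow> real^'n^'m"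
  assumes "\<And>i j. ((\<lambda>t. f t $ i $ j) has_real_derivative D $ i $ j) (at t within S)"
  shows "(f has_vector_derivative D) (at t within S)"
proof -
  define E :: "'m \<Rightarrow> 'n \<Rightarrow> real^'n^'m" where "E i j = (\<chi> k l. if k = i \<and> l = j then 1 else 0)" for i j
  have E: "A = (\<Sum>i\<in>UNIV. \<Sum>j\<in>UNIV. A $ i $ j *\<^sub>R E i j)" for A :: "real^'n^'m"
  proof -
    have "(\<Sum>i\<in>UNIV. \<Sum>j\<in>UNIV. A $ i $ j *\<^sub>R E i j) $ k $ l = A $ k $ l" for k l
    proof -
      have "(\<Sum>i\<in>UNIV. \<Sum>j\<in>UNIV. A $ i $ j *\<^sub>R E i j) $ k $ l = (\<Sum>i\<in>UNIV. \<Sum>j\<in>UNIV. if k = i then if l = j then A $ i $ j else 0 else 0)"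
        by (auto simp: E_def intro!: sum.cong)
      also have "\<dots> = (\<Sum>i\<in>UNIV. if k = i then A $ i $ l else 0)"
        by (intro sum.cong refl) auto
      finally show ?thesis by simp
    qed
    then show ?thesis by (simp add: vec_eq_iff)
  qed
  have "((\<lambda>t. \<Sum>i\<in>UNIV. \<Sum>j\<in>UNIV. f t $ i $ j *\<^sub>R E i j) has_vector_derivative
     (\<Sum>i\<in>UNIV. \<Sum>j\<in>UNIV. D $ i $ j *\<^sub>R E i j)) (at t within S)"
    by (intro has_vector_derivative_sum)
       (use has_vector_derivative_scaleR[OF assms has_vector_derivative_const] in simp)
  then show ?thesis by (simp flip: E)
qed

lemma has_real_derivative_matrixD:
  fixes f :: "real \<Rightarrow> real^'n^'m"
  assumes "(f has_vector_derivative D) (at t within S)"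
  shows "((\<lambda>t. f t $ i $ j) has_real_derivative D $ i $ j) (at t within S)"
proof -
  have "bounded_linear (\<lambda>A::real^'n^'m. A $ i $ j)"
    by (rule bounded_linear_compose[OF bounded_linear_vec_nth bounded_linear_vec_nth])
  from bounded_linear.has_vector_derivative[OF this assms] show ?thesis
    by (simp add: has_real_derivative_iff_has_vector_derivative)
qed

lemma has_vector_derivative_iff_quotient:
  "(f has_vector_derivative y) (at t within S) \<longleftrightarrow>
     ((\<lambda>s. (1 / (s - t)) *\<^sub>R (f s - f t)) \<longlongrightarrow> y) (at t within S)"
proof -
  have eq: "norm ((1 / norm (s - t)) *\<^sub>R (f s - (f t + (s - t) *\<^sub>R y))) = norm ((1 / (s - t)) *\<^sub>R (f s - f t) - y)"
    if "s \<noteq> t" for s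
  proof -
    have "(1 / (s - t)) *\<^sub>R (f s - f t) - y = (1 / (s - t)) *\<^sub>R (f s - (f t + (s - t) *\<^sub>R y))"
    proof -
      have y: "(1 / (s - t)) *\<^sub>R ((s - t) *\<^sub>R y) = y" using that by simp
      show ?thesis by (simp only: diff_diff_eq[symmetric] scaleR_diff_right[of _ "f s - f t"] y)
    qed
    then show ?thesis by simp
  qed
  have "(f has_vector_derivative y) (at t within S) \<longleftrightarrow>
      ((\<lambda>s. norm ((1 / norm (s - t)) *\<^sub>R (f s - (f t + (s - t) *\<^sub>R y)))) \<longlongrightarrow> 0) (at t within S)"
    unfolding has_vector_derivative_def has_derivative_within tendsto_norm_zero_iff
    by (simp add: bounded_linear_scaleR_left)
  also have "\<dots> \<longleftrightarrow> ((\<lambda>s. norm ((1 / (s - t)) *\<^sub>R (f s - f t) - y)) \<longlongrightarrow> 0) (at t within S)"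
    by (intro tendsto_cong, unfold eventually_at_filter) (intro always_eventually allI impI eq)
  finally show ?thesis by (simp only: tendsto_norm_zero_iff LIM_zero_iff)
qed

lemma psd_integral:
  fixes f :: "real \<Rightarrow> real^'m^'m"
  assumes f: "f integrable_on S" and psd: "\<And>t. t \<in> S \<Longrightarrow> psd (f t)"
  shows "psd (integral S f)"
  unfolding psd_def
proof safe
  have "transpose (integral S f) = integral S (transpose \<circ> f)"
    using integral_linear[OF f bounded_linear_transpose] by simp
  also have "\<dots> = integral S f" by (rule integral_cong) (simp add: psd_sym psd)
  finally show "transpose (integral S f) = integral S f" .
  fix v
  have bl: "bounded_linear (\<lambda>A::real^'m^'m. v \<bullet> (A *v v))"
    by (rule bounded_linear_compose[OF bounded_linear_inner_right matvec.bounded_linear_left])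
  have "0 \<le> integral S ((\<lambda>A::real^'m^'m. v \<bullet> (A *v v)) \<circ> f)"
    by (rule integral_nonneg[OF integrable_linear[OF f bl]]) (simp add: psd_nonneg psd)
  also have "\<dots> = v \<bullet> (integral S f *v v)" using integral_linear[OF f bl] by simp
  finally show "0 \<le> v \<bullet> (integral S f *v v)" .
qed

section \<open>Entrywise products and the power series of \<xi>'\<close>

definition hadamard :: "real^'m^'m \<Rightarrow> real^'m^'m \<Rightarrow> real^'m^'m" where
  "hadamard A B = (\<chi> i j. A $ i $ j * B $ i $ j)"

lemma bounded_bilinear_hadamard: "bounded_bilinear (hadamard :: real^'m^'m \<Rightarrow> _)"
proof -
  have "bilinear (hadamard :: real^'m^'m \<Rightarrow> _)"
    unfolding bilinear_def
    by (auto intro!: linearI simp: hadamard_def vec_eq_iff algebra_simps)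
  then show ?thesis by (simp add: bilinear_conv_bounded_bilinear)
qed

interpretation hadamard: bounded_bilinear "hadamard :: real^'m^'m \<Rightarrow> _" by (rule bounded_bilinear_hadamard)

lemma transpose_hadamard: "transpose (hadamard A B) = hadamard (transpose A) (transpose B)"
  by (simp add: hadamard_def transpose_def vec_eq_iff)

text \<open>The entries of \<open>xi'\<close> are power series with radius of convergence at least 2.\<close>
lemma xi'_entries:
  fixes \<beta> :: "nat \<Rightarrow> real^'m"
  assumes summ: "\<And>j. summable (\<lambda>p. 2 ^ p * (\<beta> p $ j)\<^sup>2)"
  shows "\<exists>z0 z1 z2 :: 'm \<Rightarrow> 'm \<Rightarrow> real \<Rightarrow> real.
     (\<forall>A i j. \<bar>A $ i $ j\<bar> < 2 \<longrightarrow> xi' \<beta> A $ i $ j = z0 i j (A $ i $ j)) \<and>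
     (\<forall>i j a. \<bar>a\<bar> < 2 \<longrightarrow> (z0 i j has_real_derivative z1 i j a) (at a)) \<and>
     (\<forall>i j a. \<bar>a\<bar> < 2 \<longrightarrow> (z1 i j has_real_derivative z2 i j a) (at a)) \<and>
     (\<forall>i j. z0 i j = z0 j i) \<and> (\<forall>i j. z1 i j = z1 j i)"
proof -
  define b where "b i j p = (if 2 \<le> p then \<beta> p $ i * \<beta> p $ j else 0)" for i j p
  have bs: "b i j = b j i" for i j by (auto simp: b_def fun_eq_iff)
  have s2: "summable (\<lambda>p. b i j p * 2 ^ p)" for i j
  proof (rule summable_comparison_test)
    show "summable (\<lambda>p. 2 ^ p * (\<beta> p $ i)\<^sup>2 + 2 ^ p * (\<beta> p $ j)\<^sup>2)" by (intro summable_add summ)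
    \<comment> \<open>The inequality between arithmetic and geometric mean reduces mixed products to
      the assumed summability of the squares.\<close>
    have "norm (b i j p * 2 ^ p) \<le> 2 ^ p * (\<beta> p $ i)\<^sup>2 + 2 ^ p * (\<beta> p $ j)\<^sup>2" for p
    proof -
      have "0 \<le> (\<bar>\<beta> p $ i\<bar> - \<bar>\<beta> p $ j\<bar>)\<^sup>2" by simp
      then have "2 * (\<bar>\<beta> p $ i\<bar> * \<bar>\<beta> p $ j\<bar>) \<le> (\<beta> p $ i)\<^sup>2 + (\<beta> p $ j)\<^sup>2" by (simp add: power2_diff)
      moreover have "0 \<le> \<bar>\<beta> p $ i\<bar> * \<bar>\<beta> p $ j\<bar>" by simp
      ultimately have "\<bar>\<beta> p $ i\<bar> * \<bar>\<beta> p $ j\<bar> \<le> (\<beta> p $ i)\<^sup>2 + (\<beta> p $ j)\<^sup>2" by linarith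
      then have "2 ^ p * (\<bar>\<beta> p $ i\<bar> * \<bar>\<beta> p $ j\<bar>) \<le> 2 ^ p * ((\<beta> p $ i)\<^sup>2 + (\<beta> p $ j)\<^sup>2)" by (intro mult_left_mono) auto
      then show ?thesis by (auto simp: b_def abs_mult algebra_simps)
    qed
    then show "\<exists>N. \<forall>p\<ge>N. norm (b i j p * 2 ^ p) \<le> 2 ^ p * (\<beta> p $ i)\<^sup>2 + 2 ^ p * (\<beta> p $ j)\<^sup>2" by blast
  qed
  have c0: "summable (\<lambda>p. b i j p * a ^ p)" if "\<bar>a\<bar> < 2" for i j a
    using powser_inside[OF s2, of a] that by simp
  have c1: "summable (\<lambda>p. diffs (b i j) p * a ^ p)" if "\<bar>a\<bar> < 2" for i j a
    using termdiff_converges[of a 2 "b i j"] c0 that by auto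
  have c2: "summable (\<lambda>p. diffs (diffs (b i j)) p * a ^ p)" if "\<bar>a\<bar> < 2" for i j a
    using termdiff_converges[of a 2 "diffs (b i j)"] c1 that by auto
  define z0 where "z0 i j a = (\<Sum>p. diffs (b i j) p * a ^ p)" for i j a
  define z1 where "z1 i j a = (\<Sum>p. diffs (diffs (b i j)) p * a ^ p)" for i j a
  define z2 where "z2 i j a = (\<Sum>p. diffs (diffs (diffs (b i j))) p * a ^ p)" for i j a
  have mid: "\<exists>K::real. \<bar>a\<bar> < K \<and> K < 2" if "\<bar>a\<bar> < 2" for a :: real
    using that by (rule dense)
  have d0: "(z0 i j has_real_derivative z1 i j a) (at a)" if a: "\<bar>a\<bar> < 2" for i j a
  proof -
    obtain K :: real where K: "\<bar>a\<bar> < K" "K < 2" using mid[OF a] by blast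
    show ?thesis unfolding z0_def[abs_def] z1_def
      by (rule termdiffs_strong[of _ K]) (use K c1[of K i j] in auto)
  qed
  have d1: "(z1 i j has_real_derivative z2 i j a) (at a)" if a: "\<bar>a\<bar> < 2" for i j a
  proof -
    obtain K :: real where K: "\<bar>a\<bar> < K" "K < 2" using mid[OF a] by blast
    show ?thesis unfolding z1_def[abs_def] z2_def
      by (rule termdiffs_strong[of _ K]) (use K c2[of K i j] in auto)
  qed
  have e: "xi' \<beta> A $ i $ j = z0 i j (A $ i $ j)" if a: "\<bar>A $ i $ j\<bar> < 2" for A i j
  proof -
    let ?f = "\<lambda>p. if 2 \<le> p then real p * outer (\<beta> p) (\<beta> p) $ i $ j * (A $ i $ j) ^ (p - 1) else 0"
    \<comment> \<open>Shift by one: the series of \<xi>' has coefficient \<open>p * b i j p\<close>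
      at exponent \<open>p - 1\<close>, so at index \<open>Suc p\<close> it is the formal derivative
      of the series of \<xi>. At \<open>p = 0\<close> both sides vanish, as the sum starts at
      2.\<close>
    have "?f (Suc p) = diffs (b i j) p * (A $ i $ j) ^ p" for p
      by (auto simp: diffs_def b_def outer_def)
    moreover have "(\<lambda>p. diffs (b i j) p * (A $ i $ j) ^ p) sums z0 i j (A $ i $ j)"
      unfolding z0_def using c1[OF a] by (rule summable_sums)
    ultimately have "(\<lambda>p. ?f (Suc p)) sums z0 i j (A $ i $ j)" by simp
    then have "?f sums (z0 i j (A $ i $ j) + ?f 0)" by (subst (asm) sums_Suc_iff) simp
    then have "?f sums z0 i j (A $ i $ j)" by simp
    then show ?thesis by (simp add: xi'_def sums_iff)
  qed
  show ?thesis
    using e d0 d1 by (intro exI[of _ z0] exI[of _ z1] exI[of _ z2]) (auto simp: z0_def z1_def bs)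
qed

lemma lipschitz_matrix_path:
  fixes f :: "real \<Rightarrow> real^'m^'m"
  assumes "\<And>t. t \<in> {a..b} \<Longrightarrow> (f has_vector_derivative f' t) (at t within {a..b})"
    and "\<And>t. t \<in> {a..b} \<Longrightarrow> norm (f' t) \<le> C"
    and st: "s \<in> {a..b}" "t \<in> {a..b}"
  shows "norm (f t - f s) \<le> C * \<bar>t - s\<bar>"
proof -
  have "norm (f t - f s) \<le> C * norm (t - s)"
  proof (rule differentiable_bound[of "{a..b}" f "\<lambda>t h. h *\<^sub>R f' t"])
    fix r assume r: "r \<in> {a..b}"
    have "norm (h *\<^sub>R f' r) \<le> C * norm h" for h
      using mult_left_mono[OF assms(2)[OF r], of "norm h"] by (simp add: mult.commute)
    then show "onorm (\<lambda>h. h *\<^sub>R f' r) \<le> C" by (rule onorm_le)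
  qed (use assms in \<open>auto simp: has_vector_derivative_def\<close>)
  then show ?thesis by simp
qed

text \<open>The derivative of a Loewner-monotone path is a limit of semidefinite difference
  quotients; for a point to the left, increment and denominator change sign together, and the cone
  is closed.\<close>

lemma is_pathD:
  fixes \<Phi> :: "real \<Rightarrow> real^'m^'m"
  assumes "is_path Q \<Phi>"
  shows "\<And>t. t \<in> {0..real CARD('m)} \<Longrightarrow> (\<Phi> has_vector_derivative path_deriv \<Phi> t) (at t within {0..real CARD('m)})"
    and "\<exists>L. L-lipschitz_on {0..real CARD('m)} (path_deriv \<Phi>)"
    and "\<And>t. t \<in> {0..real CARD('m)} \<Longrightarrow> psd (path_deriv \<Phi> t)"
    and "\<Phi> 0 = 0" "\<Phi> (real CARD('m)) = Q"
proof -
  let ?I = "{0..real CARD('m)}"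
  show d: "\<And>t. t \<in> ?I \<Longrightarrow> (\<Phi> has_vector_derivative path_deriv \<Phi> t) (at t within ?I)"
    using assms unfolding is_path_def Let_def path_deriv_def by (auto intro: vector_derivative_works[THEN iffD1])
  show "\<exists>L. L-lipschitz_on ?I (path_deriv \<Phi>)" "\<Phi> 0 = 0" "\<Phi> (real CARD('m)) = Q"
    using assms by (auto simp: is_path_def Let_def)
  fix t assume t: "t \<in> ?I"
  have n: "0 < real CARD('m)" by simp
  show "psd (path_deriv \<Phi> t)"
  proof (rule psd_limit)
    show "at t within ?I \<noteq> bot" using t n by (simp add: trivial_limit_within)
    show "((\<lambda>s. (1 / (s - t)) *\<^sub>R (\<Phi> s - \<Phi> t)) \<longlongrightarrow> path_deriv \<Phi> t) (at t within ?I)"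
      using d[OF t] by (simp add: has_vector_derivative_iff_quotient)
    have "psd ((1 / (s - t)) *\<^sub>R (\<Phi> s - \<Phi> t))" if s: "s \<in> ?I" "s \<noteq> t" for s
    proof (cases "s > t")
      case True
      then have "psd (\<Phi> s - \<Phi> t)" using assms s t by (auto simp: is_path_def Let_def loewner_le_def)
      then show ?thesis using True by (intro psd_scaleR) auto
    next
      case False
      then have "psd (\<Phi> t - \<Phi> s)" using assms s t by (auto simp: is_path_def Let_def loewner_le_def)
      then have "psd ((1 / (t - s)) *\<^sub>R (\<Phi> t - \<Phi> s))" using False s by (intro psd_scaleR) auto
      moreover have "(1 / (t - s)) *\<^sub>R (\<Phi> t - \<Phi> s) = (1 / (s - t)) *\<^sub>R (\<Phi> s - \<Phi> t)"
      proof -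
        have e1: "1 / (t - s) = - (1 / (s - t))" by (metis minus_diff_eq minus_divide_right)
        have e2: "\<Phi> t - \<Phi> s = - (\<Phi> s - \<Phi> t)" by simp
        show ?thesis by (simp only: e1 e2 scaleR_minus_left scaleR_minus_right minus_minus)
      qed
      ultimately show ?thesis by simp
    qed
    then show "\<forall>\<^sub>F s in at t within ?I. psd ((1 / (s - t)) *\<^sub>R (\<Phi> s - \<Phi> t))"
      by (auto simp: eventually_at_filter)
  qed
qed

text \<open>Serves to recognise competitors: a Lipschitz semidefinite derivative and the right end
  values suffice. Monotonicity is recovered by integration, the Lipschitz property of
  \<open>\<Phi>\<close> from boundedness of \<open>P\<close>.\<close>

lemma is_pathI:
  fixes \<Phi> P :: "real \<Rightarrow> real^'m^'m"
  assumes d: "\<And>t. t \<in> {0..real CARD('m)} \<Longrightarrow> (\<Phi> has_vector_derivative P t) (at t within {0..real CARD('m)})"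
    and L: "L-lipschitz_on {0..real CARD('m)} P"
    and psd: "\<And>t. t \<in> {0..real CARD('m)} \<Longrightarrow> psd (P t)"
    and "\<Phi> 0 = 0" "\<Phi> (real CARD('m)) = Q"
  shows "is_path Q \<Phi>" and "\<And>t. t \<in> {0..real CARD('m)} \<Longrightarrow> path_deriv \<Phi> t = P t"
proof -
  let ?I = "{0..real CARD('m)}"
  have n: "0 < real CARD('m)" by simp
  show pd: "path_deriv \<Phi> t = P t" if "t \<in> ?I" for t
    unfolding path_deriv_def
    using vector_derivative_within_cbox[of 0 "real CARD('m)" t \<Phi> "P t"] d[OF that] that n by simp
  have Pc: "continuous_on ?I P" by (rule lipschitz_on_continuous_on[OF L])
  have mono: "psd (\<Phi> t - \<Phi> s)" if st: "s \<in> ?I" "t \<in> ?I" "s \<le> t" for s t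
  proof -
    have "(P has_integral (\<Phi> t - \<Phi> s)) {s..t}"
      by (rule fundamental_theorem_of_calculus)
         (use st in \<open>auto intro!: has_vector_derivative_within_subset[OF d]\<close>)
    then have "\<Phi> t - \<Phi> s = integral {s..t} P" "P integrable_on {s..t}" by (auto simp: integral_unique has_integral_integrable)
    then show ?thesis using psd_integral[of P "{s..t}"] psd st by auto
  qed
  obtain C where C: "\<And>t. t \<in> ?I \<Longrightarrow> norm (P t) \<le> C"
    using compact_continuous_image[OF Pc compact_Icc] compact_imp_bounded bounded_iff by (metis imageI)
  have C0: "0 \<le> C" using C[of 0] n by (smt (verit) atLeastAtMost_iff norm_ge_zero)
  have lip: "C-lipschitz_on ?I \<Phi>"
    using lipschitz_matrix_path[OF d C] C0 by (intro lipschitz_onI) (auto simp: dist_norm)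
  have "continuous_on ?I (path_deriv \<Phi>)" using Pc by (subst continuous_on_cong[OF refl pd]) auto
  moreover have "L-lipschitz_on ?I (path_deriv \<Phi>)" using L pd by (simp add: lipschitz_on_def)
  moreover have "\<Phi> differentiable (at t within ?I)" if "t \<in> ?I" for t
    using d[OF that] by (auto simp: has_vector_derivative_def differentiable_def)
  moreover have "psd (\<Phi> t)" if "t \<in> ?I" for t using mono[of 0 t] that assms(4) by simp
  ultimately show "is_path Q \<Phi>"
    using lip mono assms(4,5) unfolding is_path_def Let_def loewner_le_def by blast
qed

subsection \<open>The functional without cutoff\<close>

lemma matrix_inv_lipschitz:
  assumes c: "0 < c"
  shows "\<exists>C\<ge>0. \<forall>A B. pos_def c (A::real^'m^'m) \<longrightarrow> pos_def c B \<longrightarrow> norm (matrix_inv A - matrix_inv B) \<le> C * norm (A - B)"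
proof -
  have "\<exists>K>0. \<forall>(X::real^'m^'m) (Y::real^'m^'m). norm (X ** Y) \<le> norm X * norm Y * K" by (rule matmul.pos_bounded)
  then obtain K where K: "0 < K" "\<And>(X::real^'m^'m) (Y::real^'m^'m). norm (X ** Y) \<le> norm X * norm Y * K" by blast
  define N where "N = real CARD('m) * (real CARD('m) * (1 / c))"
  have N0: "0 \<le> N" using c by (simp add: N_def)
  have "norm (matrix_inv A - matrix_inv B) \<le> K\<^sup>2 * N\<^sup>2 * norm (A - B)"
    if pd: "pos_def c A" "pos_def c B" for A B :: "real^'m^'m"
  proof -
    have N: "norm (matrix_inv A) \<le> N" "norm (matrix_inv B) \<le> N"
      unfolding N_def using pd c by (auto intro!: norm_matrix_inv_le simp del: mult_1_right times_divide_eq_right)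
    have "norm (matrix_inv A - matrix_inv B) = norm (matrix_inv A ** (B - A) ** matrix_inv B)"
      using pd c by (subst matrix_inv_diff) (auto dest: pos_def_det_nz)
    also have "\<dots> \<le> norm (matrix_inv A ** (B - A)) * norm (matrix_inv B) * K" by (rule K)
    also have "\<dots> \<le> (norm (matrix_inv A) * norm (B - A) * K) * norm (matrix_inv B) * K"
      using K by (intro mult_right_mono) auto
    also have "\<dots> \<le> (N * norm (B - A) * K) * N * K"
      using K N N0 by (intro mult_right_mono mult_mono) auto
    also have "\<dots> = K\<^sup>2 * N\<^sup>2 * norm (A - B)" by (simp add: power2_eq_square norm_minus_commute)
    finally show ?thesis .
  qed
  then show ?thesis by (intro exI[of _ "K\<^sup>2 * N\<^sup>2"]) auto
qed

lemma matrix_inv_tendsto: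
  assumes c: "0 < c" "pos_def c (A::real^'m^'m)" and ev: "eventually (\<lambda>s. pos_def c (f s)) F" and f: "(f \<longlongrightarrow> A) F"
  shows "((\<lambda>s. matrix_inv (f s)) \<longlongrightarrow> matrix_inv A) F"
proof -
  obtain C where C: "\<And>(X::real^'m^'m) (Y::real^'m^'m). pos_def c X \<Longrightarrow> pos_def c Y \<Longrightarrow> norm (matrix_inv X - matrix_inv Y) \<le> C * norm (X - Y)"
    using matrix_inv_lipschitz[OF c(1)] by blast
  have "((\<lambda>s. C * norm (f s - A)) \<longlongrightarrow> C * norm (A - A)) F" by (intro tendsto_intros f)
  then have l: "((\<lambda>s. C * norm (f s - A)) \<longlongrightarrow> 0) F" by simp
  have "eventually (\<lambda>s. norm (matrix_inv (f s) - matrix_inv A) \<le> C * norm (f s - A)) F"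
    using ev by eventually_elim (rule C[OF _ c(2)])
  then show ?thesis by (rule LIM_zero_cancel[OF Lim_null_comparison[OF _ l]])
qed

lemma matrix_inv_has_vector_derivative:
  fixes A :: "real \<Rightarrow> real^'m^'m"
  assumes c: "0 < c" and pd: "\<And>s. s \<in> S \<Longrightarrow> pos_def c (A s)" and t: "t \<in> S"
    and A: "(A has_vector_derivative A') (at t within S)"
  shows "((\<lambda>s. matrix_inv (A s)) has_vector_derivative - (matrix_inv (A t) ** A' ** matrix_inv (A t))) (at t within S)"
  unfolding has_vector_derivative_iff_quotient
proof (rule Lim_transform_eventually)
  have ev: "eventually (\<lambda>s. pos_def c (A s)) (at t within S)" using pd by (auto simp: eventually_at_filter)
  have "(A \<longlongrightarrow> A t) (at t within S)" using has_vector_derivative_continuous[OF A] by (simp add: continuous_within)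
  then have "((\<lambda>s. matrix_inv (A s)) \<longlongrightarrow> matrix_inv (A t)) (at t within S)"
    using c pd t by (intro matrix_inv_tendsto[OF _ _ ev]) auto
  then show "((\<lambda>s. - (matrix_inv (A s) ** ((1 / (s - t)) *\<^sub>R (A s - A t)) ** matrix_inv (A t)))
      \<longlongrightarrow> - (matrix_inv (A t) ** A' ** matrix_inv (A t))) (at t within S)"
    by (intro tendsto_minus matmul.tendsto tendsto_const A[unfolded has_vector_derivative_iff_quotient])
  have "- (matrix_inv (A s) ** ((1 / (s - t)) *\<^sub>R (A s - A t)) ** matrix_inv (A t)) =
      (1 / (s - t)) *\<^sub>R (matrix_inv (A s) - matrix_inv (A t))" if "s \<in> S" for s
    using pos_def_det_nz[OF pd[OF that] c] pos_def_det_nz[OF pd[OF t] c]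
    by (subst matrix_inv_diff) (auto simp: mat_algebra scaleR_diff_right)
  then show "\<forall>\<^sub>F s in at t within S. - (matrix_inv (A s) ** ((1 / (s - t)) *\<^sub>R (A s - A t)) ** matrix_inv (A t)) =
      (1 / (s - t)) *\<^sub>R (matrix_inv (A s) - matrix_inv (A t))"
    by (auto simp: eventually_at_filter)
qed

text \<open>The derivative is an argument of its own and the trace is not constrained, so that
  perturbed pairs can be inserted directly. It is used with \<open>T\<close> equal to
  \<open>t_max\<close>, which removes the choice of a cutoff.\<close>

definition cs_form :: "(nat \<Rightarrow> real^'m) \<Rightarrow> real^'m \<Rightarrow> (real \<Rightarrow> real) \<Rightarrow> real \<Rightarrow> (real \<Rightarrow> real^'m^'m) \<Rightarrow> (real \<Rightarrow> real^'m^'m) \<Rightarrow> real" where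
  "cs_form \<beta> h x T \<Phi> P = 1/2 *
     (integral {0..real CARD('m)} (\<lambda>t. x t * ((xi' \<beta> (\<Phi> t) + outer h h) \<bullet> P t))
      + ln (det (\<Phi> (real CARD('m)) - \<Phi> T))
      + integral {0..T} (\<lambda>t. matrix_inv (integral {t..real CARD('m)} (\<lambda>s. x s *\<^sub>R P s)) \<bullet> P t))"

text \<open>The conditions of admissibility except the normalisation of the trace, with the
  derivative as a parameter. Perturbed and reparametrised paths become further instances of
  it.\<close>

locale cs_path =
  fixes \<beta> :: "nat \<Rightarrow> real^'m" and h :: "real^'m" and Q :: "real^'m^'m"
    and x :: "real \<Rightarrow> real" and \<Phi> P :: "real \<Rightarrow> real^'m^'m" and n :: real
  assumes n_eq: "n = real CARD('m)"
    and beta_summable: "\<And>j. summable (\<lambda>p. 2 ^ p * (\<beta> p $ j)\<^sup>2)"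
    and Q_constraint: "is_constraint Q"
    and order_x: "is_order_parameter (n) x"
    and dPhi: "\<And>t. t \<in> {0..n} \<Longrightarrow> (\<Phi> has_vector_derivative P t) (at t within {0..n})"
    and P_lip: "\<exists>L. L-lipschitz_on {0..n} P"
    and P_psd: "\<And>t. t \<in> {0..n} \<Longrightarrow> psd (P t)"
    and Phi_0: "\<Phi> 0 = 0" and Phi_n: "\<Phi> (n) = Q"
    and det_gap: "0 < det (Q - \<Phi> (t_max (n) x))"
begin

abbreviation T :: real where "T \<equiv> t_max n x"
definition hat :: "real \<Rightarrow> real^'m^'m" where "hat t = integral {t..n} (\<lambda>s. x s *\<^sub>R P s)"

lemma n_pos: "0 < n" by (simp add: n_eq)

lemma x_range: "t \<in> {0..n} \<Longrightarrow> 0 \<le> x t \<and> x t \<le> 1"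
  using order_x by (force simp: is_order_parameter_def)

lemma x_mono: "mono_on {0..n} x" and x_n: "x n = 1"
  using order_x by (auto simp: is_order_parameter_def)

lemma x_le: "0 \<le> s \<Longrightarrow> s \<le> t \<Longrightarrow> t \<le> n \<Longrightarrow> x s \<le> x t"
  using mono_onD[OF x_mono, of s t] by auto

lemma x_right: "t \<in> {0..<n} \<Longrightarrow> (x \<longlongrightarrow> x t) (at_right t)"
  using order_x by (auto simp: is_order_parameter_def continuous_within)

lemma P_cont: "continuous_on {0..n} P"
  using P_lip lipschitz_on_continuous_on by blast

lemma P_bounded: "\<exists>C\<ge>0. \<forall>t\<in>{0..n}. norm (P t) \<le> C"
proof -
  obtain C where C: "\<And>t. t \<in> {0..n} \<Longrightarrow> norm (P t) \<le> C"
    using compact_continuous_image[OF P_cont compact_Icc] compact_imp_bounded bounded_iff by (metis imageI)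
  moreover have "0 \<le> C" using C[of 0] n_pos by (smt (verit) atLeastAtMost_iff norm_ge_zero)
  ultimately show ?thesis by blast
qed

lemma Phi_integral: "0 \<le> s \<Longrightarrow> s \<le> t \<Longrightarrow> t \<le> n \<Longrightarrow> (P has_integral (\<Phi> t - \<Phi> s)) {s..t}"
  by (rule fundamental_theorem_of_calculus) (auto intro!: has_vector_derivative_within_subset[OF dPhi])

lemma Phi_mono: "0 \<le> s \<Longrightarrow> s \<le> t \<Longrightarrow> t \<le> n \<Longrightarrow> psd (\<Phi> t - \<Phi> s)"
  using Phi_integral[of s t] psd_integral[of P "{s..t}"] P_psd by (auto simp: integral_unique has_integral_integrable)

lemma Phi_psd: "t \<in> {0..n} \<Longrightarrow> psd (\<Phi> t)"
  using Phi_mono[of 0 t] Phi_0 by simp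

lemma Phi_cont: "continuous_on {0..n} \<Phi>"
  by (rule continuous_on_vector_derivative) (rule dPhi)

text \<open>The diagonal of \<open>\<Phi> t\<close> lies between those of 0 and \<open>Q\<close>,
  and Cauchy-Schwarz controls the other entries. The path thus stays well inside the disc of
  convergence, of radius 2, of the series for \<xi>'.\<close>

lemma Phi_entry: assumes t: "t \<in> {0..n}" shows "\<bar>\<Phi> t $ i $ j\<bar> \<le> 1"
proof -
  have d: "0 \<le> \<Phi> t $ k $ k \<and> \<Phi> t $ k $ k \<le> 1" for k
    using psd_diag_nonneg[OF Phi_psd[OF t], of k] psd_diag_nonneg[OF Phi_mono[of t n], of k] t Q_constraint
    by (simp add: Phi_n is_constraint_def)
  have "(\<Phi> t $ i $ j)\<^sup>2 \<le> \<Phi> t $ i $ i * \<Phi> t $ j $ j" by (rule psd_entry_bound[OF Phi_psd[OF t]])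
  also have "\<dots> \<le> 1 * 1" using d[of i] d[of j] by (intro mult_mono) auto
  finally show ?thesis by (simp add: abs_square_le_1)
qed

lemma xP_integrable:
  assumes "0 \<le> a" "b \<le> n"
  shows "(\<lambda>s. x s *\<^sub>R P s) integrable_on {a..b}"
  using assms by (intro mono_scaleR_integrable monotone_on_subset[OF x_mono] continuous_on_subset[OF P_cont]) auto

lemma T_range: "0 \<le> T" "T < n" and x_T: "\<And>t. T \<le> t \<Longrightarrow> t \<le> n \<Longrightarrow> x t = 1"
  and x_less_T: "\<And>t. 0 \<le> t \<Longrightarrow> t < T \<Longrightarrow> x t < 1"
proof -
  let ?X = "{t \<in> {0..n}. x t = 1}"
  have nX: "n \<in> ?X" using x_n n_pos by simp
  have bdd: "bdd_below ?X" by (intro bdd_belowI[of _ 0]) auto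
  show T0: "0 \<le> T" unfolding t_max_def using nX by (intro cInf_greatest) auto
  have Tn: "T \<le> n" unfolding t_max_def using nX bdd by (rule cInf_lower)
  \<comment> \<open>For \<open>T = n\<close> the matrix in \<open>det_gap\<close> would be
    0.\<close>
  have "T \<noteq> n" using det_gap det_zero_row(1)[of _ "0::real^'m^'m"] by (auto simp: Phi_n row_def zero_vec_def)
  then show Tn': "T < n" using Tn by simp
  have gt: "x t = 1" if t: "T < t" "t \<le> n" for t
  proof -
    obtain s where "s \<in> ?X" "s < t"
      using t nX bdd cInf_less_iff[of ?X t] unfolding t_max_def by blast
    then show ?thesis using x_le[of s t] x_range[of t] t by auto
  qed
  \<comment> \<open>The infimum that defines \<open>T\<close> is attained, by right continuity of
    \<open>x\<close>.\<close>
  have "x T = 1"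
  proof (rule tendsto_unique[OF trivial_limit_at_right_real])
    show "(x \<longlongrightarrow> x T) (at_right T)" using x_right T0 Tn' by simp
    show "(x \<longlongrightarrow> 1) (at_right T)"
      by (rule tendsto_eventually) (use gt Tn' in \<open>auto simp: eventually_at_right_field intro!: exI[of _ n]\<close>)
  qed
  then show "\<And>t. T \<le> t \<Longrightarrow> t \<le> n \<Longrightarrow> x t = 1" using gt by (metis order_le_less)
  show "x t < 1" if "0 \<le> t" "t < T" for t
  proof (rule ccontr)
    assume "\<not> x t < 1"
    then have "t \<in> ?X" using x_range[of t] that Tn by auto
    then have "T \<le> t" unfolding t_max_def using bdd by (rule cInf_lower)
    then show False using that by simp
  qed
qed

lemma hat_diff: assumes "0 \<le> s" "s \<le> t" "t \<le> n"
  shows "hat s - hat t = integral {s..t} (\<lambda>s. x s *\<^sub>R P s)"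
  using Henstock_Kurzweil_Integration.integral_combine[OF assms(2,3) xP_integrable[OF assms(1)]] by (simp add: hat_def algebra_simps)

lemma hat_mono: assumes "0 \<le> s" "s \<le> t" "t \<le> n" shows "psd (hat s - hat t)"
  unfolding hat_diff[OF assms] using assms x_range P_psd
  by (intro psd_integral xP_integrable psd_scaleR) auto

lemma hat_eq: assumes "T \<le> t" "t \<le> n" shows "hat t = Q - \<Phi> t"
proof -
  have "hat t = integral {t..n} P" unfolding hat_def
    by (rule integral_cong) (use assms x_T in auto)
  then show ?thesis using Phi_integral[of t n] assms T_range by (simp add: integral_unique Phi_n)
qed

lemma hat_lipschitz: "\<exists>C\<ge>0. \<forall>s\<in>{0..n}. \<forall>t\<in>{0..n}. norm (hat s - hat t) \<le> C * \<bar>s - t\<bar>"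
proof -
  obtain C where C: "0 \<le> C" "\<And>t. t \<in> {0..n} \<Longrightarrow> norm (P t) \<le> C" using P_bounded by blast
  have *: "norm (hat s - hat t) \<le> C * (t - s)" if st: "0 \<le> s" "s \<le> t" "t \<le> n" for s t
    unfolding hat_diff[OF st]
  proof (rule order_trans[OF integral_norm_bound_integral[where g="\<lambda>_. C"]])
    show "norm (x r *\<^sub>R P r) \<le> C" if "r \<in> {s..t}" for r
      using x_range[of r] C(2)[of r] that st mult_mono[of "\<bar>x r\<bar>" 1 "norm (P r)" C] by auto
  qed (use st xP_integrable in \<open>auto simp: mult.commute\<close>)
  have "norm (hat s - hat t) \<le> C * \<bar>s - t\<bar>" if "s \<in> {0..n}" "t \<in> {0..n}" for s t
    using *[of s t] *[of t s] that by (cases "s \<le> t") (auto simp: norm_minus_commute)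
  then show ?thesis using C(1) by blast
qed

lemma hat_cont: "continuous_on {0..n} hat"
proof -
  obtain C where "0 \<le> C" "\<forall>s\<in>{0..n}. \<forall>t\<in>{0..n}. norm (hat s - hat t) \<le> C * \<bar>s - t\<bar>" using hat_lipschitz by blast
  then have "C-lipschitz_on {0..n} hat" by (intro lipschitz_onI) (auto simp: dist_norm)
  then show ?thesis by (rule lipschitz_on_continuous_on)
qed

text \<open>\<open>hat\<close> is nonincreasing in the Loewner order, so a lower bound for
  \<open>hat t = Q - \<Phi> t\<close> serves all earlier times.\<close>

lemma hat_pos_def:
  assumes "T \<le> t" "t < n" "0 < det (Q - \<Phi> t)"
  shows "\<exists>c>0. \<forall>s\<in>{0..t}. pos_def c (hat s)"
proof -
  have "psd (Q - \<Phi> t)" using Phi_mono[of t n] assms T_range by (simp add: Phi_n)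
  then obtain c where c: "0 < c" "pos_def c (Q - \<Phi> t)" using psd_det_pos_def[of "Q - \<Phi> t"] assms by auto
  have "pos_def c (hat s)" if "s \<in> {0..t}" for s
    using pos_def_mono[OF c(2), of "hat s"] hat_mono[of s t] hat_eq[of t] that assms by auto
  then show ?thesis using c by blast
qed

lemma inv_hat_cont:
  assumes "T \<le> t" "t < n" "0 < det (Q - \<Phi> t)"
  shows "continuous_on {0..t} (\<lambda>s. matrix_inv (hat s))"
proof -
  obtain c where c: "0 < c" "\<And>s. s \<in> {0..t} \<Longrightarrow> pos_def c (hat s)" using hat_pos_def[OF assms] by blast
  have "continuous_on {0..t} hat" using hat_cont by (rule continuous_on_subset) (use assms in auto)
  then show ?thesis unfolding continuous_on_def
    using c by (auto intro!: matrix_inv_tendsto[OF c(1)] simp: eventually_at_filter)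
qed

text \<open>On \<open>{T..U}\<close> one has \<open>hat t = Q - \<Phi> t\<close>, and by Jacobi's
  formula the last integrand is the derivative of \<open>- ln (det (Q - \<Phi> t))\<close>. Lowering
  the cutoff from \<open>U\<close> to \<open>T\<close> therefore moves the same amount from the
  integral to the logarithm.\<close>

lemma CS_eq:
  assumes pd: "\<And>t. t \<in> {0..n} \<Longrightarrow> path_deriv \<Phi> t = P t"
  shows "CS \<beta> h Q x \<Phi> = cs_form \<beta> h x T \<Phi> P"
proof -
  define U where "U = (SOME U. U \<in> {T<..<n} \<and> det (Q - \<Phi> U) > 0)"
  have "\<exists>U. U \<in> {T<..<n} \<and> det (Q - \<Phi> U) > 0"
  proof -
    have "(\<Phi> \<longlongrightarrow> \<Phi> T) (at T within {0..n})" using Phi_cont T_range by (auto simp: continuous_on_def)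
    then have "(\<Phi> \<longlongrightarrow> \<Phi> T) (at T within {T..n})"
      by (rule tendsto_within_subset) (use T_range in auto)
    then have "(\<Phi> \<longlongrightarrow> \<Phi> T) (at_right T)"
      using T_range at_within_Icc_at_right[of T n] by simp
    then have "((\<lambda>t. det (Q - \<Phi> t)) \<longlongrightarrow> det (Q - \<Phi> T)) (at_right T)" by (intro tendsto_det tendsto_intros)
    from order_tendstoD(1)[OF this det_gap] obtain b where b: "T < b" "\<And>t. T < t \<Longrightarrow> t < b \<Longrightarrow> 0 < det (Q - \<Phi> t)"
      by (auto simp: eventually_at_right_field)
    define U where "U = (T + min b n) / 2"
    have "T < U" "U < b" "U < n" using b T_range by (auto simp: U_def)
    then show ?thesis using b by auto
  qed
  from someI_ex[OF this] have U: "T < U" "U < n" "0 < det (Q - \<Phi> U)" unfolding U_def by auto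
  obtain c where c: "0 < c" "\<And>s. s \<in> {0..U} \<Longrightarrow> pos_def c (hat s)" using hat_pos_def[of U] U by auto
  have ic: "continuous_on {0..U} (\<lambda>s. matrix_inv (hat s))" using inv_hat_cont[of U] U by simp
  have c3: "continuous_on {0..U} (\<lambda>t. matrix_inv (hat t) \<bullet> P t)"
    by (intro continuous_intros ic continuous_on_subset[OF P_cont]) (use U in auto)
  have split: "integral {0..U} (\<lambda>t. matrix_inv (hat t) \<bullet> P t) =
     integral {0..T} (\<lambda>t. matrix_inv (hat t) \<bullet> P t) + integral {T..U} (\<lambda>t. matrix_inv (hat t) \<bullet> P t)"
    using U T_range by (intro Henstock_Kurzweil_Integration.integral_combine[symmetric] integrable_continuous_real c3) auto
  have "((\<lambda>t. matrix_inv (hat t) \<bullet> P t) has_integral (- ln (det (Q - \<Phi> U)) - - ln (det (Q - \<Phi> T)))) {T..U}"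
  proof (rule fundamental_theorem_of_calculus)
    fix t assume t: "t \<in> {T..U}"
    have pos: "pos_def c (Q - \<Phi> t)" using c(2)[of t] hat_eq[of t] t U T_range by simp
    then have dp: "0 < det (Q - \<Phi> t)" using pos_def_det_pos c(1) by blast
    have "((\<lambda>t. Q - \<Phi> t) has_vector_derivative (0 - P t)) (at t within {T..U})"
      by (intro has_vector_derivative_diff has_vector_derivative_const has_vector_derivative_within_subset[OF dPhi])
         (use t U T_range in auto)
    from det_has_vector_derivative[OF this] dp
    have "((\<lambda>t. det (Q - \<Phi> t)) has_real_derivative det (Q - \<Phi> t) * trace (matrix_inv (Q - \<Phi> t) ** - P t)) (at t within {T..U})"
      by simp
    then have "((\<lambda>t. ln (det (Q - \<Phi> t))) has_real_derivative
        inverse (det (Q - \<Phi> t)) * (det (Q - \<Phi> t) * trace (matrix_inv (Q - \<Phi> t) ** - P t))) (at t within {T..U})"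
      using dp by (intro DERIV_ln[THEN DERIV_chain2]) auto
    moreover have "inverse (det (Q - \<Phi> t)) * (det (Q - \<Phi> t) * trace (matrix_inv (Q - \<Phi> t) ** - P t)) = - (matrix_inv (Q - \<Phi> t) \<bullet> P t)"
      using dp pos by (simp add: inner_sym_trace matrix_inv_sym pos_def_def psd_sym mat_algebra linear_neg[OF linear_trace])
    ultimately have "((\<lambda>t. - ln (det (Q - \<Phi> t))) has_real_derivative matrix_inv (Q - \<Phi> t) \<bullet> P t) (at t within {T..U})"
      using DERIV_minus by fastforce
    then show "((\<lambda>t. - ln (det (Q - \<Phi> t))) has_vector_derivative matrix_inv (hat t) \<bullet> P t) (at t within {T..U})"
      using hat_eq[of t] t U by (simp add: has_real_derivative_iff_has_vector_derivative)
  qed (use U in simp)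
  then have I: "integral {T..U} (\<lambda>t. matrix_inv (hat t) \<bullet> P t) = ln (det (Q - \<Phi> T)) - ln (det (Q - \<Phi> U))"
    by (simp add: integral_unique)
  have ph: "Phi_hat x \<Phi> t = hat t" if "0 \<le> t" for t
    unfolding Phi_hat_def hat_def n_eq[symmetric] by (rule integral_cong) (use pd that in auto)
  have "integral {0..n} (\<lambda>t. x t * ((xi' \<beta> (\<Phi> t) + outer h h) \<bullet> path_deriv \<Phi> t)) =
    integral {0..n} (\<lambda>t. x t * ((xi' \<beta> (\<Phi> t) + outer h h) \<bullet> P t))"
    by (rule integral_cong) (simp add: pd)
  moreover have "integral {0..U} (\<lambda>t. matrix_inv (Phi_hat x \<Phi> t) \<bullet> path_deriv \<Phi> t) = integral {0..U} (\<lambda>t. matrix_inv (hat t) \<bullet> P t)"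
    by (rule integral_cong) (use pd ph U in auto)
  ultimately show ?thesis
    unfolding CS_def CS_cutoff_def cs_form_def n_eq[symmetric] U_def[symmetric] hat_def[symmetric] by (simp add: split I Phi_n)
qed

end

subsection \<open>Support of the order parameter and reparametrisation\<close>

definition dist_fun :: "real \<Rightarrow> (real \<Rightarrow> real) \<Rightarrow> real \<Rightarrow> real" where
  "dist_fun m x t = (if t < 0 then 0 else if t > m then 1 else x t)"

lemma dist_fun_mono:
  assumes x: "is_order_parameter m x" and "s \<le> t" shows "dist_fun m x s \<le> dist_fun m x t"
proof -
  have rng: "s \<in> {0..m} \<Longrightarrow> 0 \<le> x s \<and> x s \<le> 1" for s
    using x by (force simp: is_order_parameter_def)
  show ?thesis using assms rng by (auto simp: dist_fun_def is_order_parameter_def mono_on_def)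
qed

lemma dist_fun_right_continuous:
  assumes x: "is_order_parameter m x" shows "continuous (at_right a) (dist_fun m x)"
proof -
  consider "a < 0" | "a \<in> {0..<m}" | "a \<ge> m" "a \<ge> 0" by force
  then show ?thesis
  proof cases
    case 1
    have "eventually (\<lambda>s. dist_fun m x s = 0) (at_right a)"
      unfolding eventually_at_right_field using 1 by (auto simp: dist_fun_def)
    then show ?thesis using 1 by (simp add: continuous_within dist_fun_def tendsto_eventually)
  next
    case 2
    have "eventually (\<lambda>s. x s = dist_fun m x s) (at_right a)"
      unfolding eventually_at_right_field using 2 by (auto simp: dist_fun_def intro!: exI[of _ m])
    moreover have "(x \<longlongrightarrow> x a) (at_right a)"
      using x 2 by (auto simp: is_order_parameter_def continuous_within)
    ultimately have "(dist_fun m x \<longlongrightarrow> x a) (at_right a)" by (rule Lim_transform_eventually[rotated])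
    then show ?thesis using 2 by (simp add: continuous_within dist_fun_def)
  next
    case 3
    have "eventually (\<lambda>s. dist_fun m x s = 1) (at_right a)"
      unfolding eventually_at_right_field using 3 by (auto simp: dist_fun_def intro!: exI[of _ "a+1"])
    moreover have "dist_fun m x a = 1" using 3 x by (auto simp: dist_fun_def is_order_parameter_def)
    ultimately show ?thesis by (simp add: continuous_within tendsto_eventually)
  qed
qed

lemma mu_P_Ioc:
  assumes x: "is_order_parameter m x" and "a \<le> b"
  shows "emeasure (mu_P m x) {a<..b} = ennreal (dist_fun m x b - dist_fun m x a)"
proof -
  have e: "(\<lambda>t. if t < 0 then 0 else if t > m then 1 else x t) = dist_fun m x"
    by (rule ext) (simp add: dist_fun_def)
  show ?thesis unfolding mu_P_def e
    using assms by (intro emeasure_interval_measure_Ioc dist_fun_mono dist_fun_right_continuous)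
qed

lemma sets_mu_P [simp]: "sets (mu_P m x) = sets borel"
  by (simp add: mu_P_def)

text \<open>Open intervals are compared with half-open ones, whose mass is an increment of the
  distribution function. In this form the support can be followed through a time change and yields
  strict growth of \<open>x\<close>.\<close>

lemma supp_mu_P:
  assumes x: "is_order_parameter m x"
  shows "u \<in> supp (mu_P m x) \<longleftrightarrow> (\<forall>d>0. dist_fun m x (u - d) < dist_fun m x (u + d))"
proof safe
  fix d :: real assume u: "u \<in> supp (mu_P m x)" and d: "0 < d"
  have "0 < emeasure (mu_P m x) {u - d<..<u + d}" using u d by (auto simp: supp_def)
  also have "\<dots> \<le> emeasure (mu_P m x) {u - d<..u + d}" by (rule emeasure_mono) auto
  also have "\<dots> = ennreal (dist_fun m x (u + d) - dist_fun m x (u - d))" using mu_P_Ioc[OF x] d by simp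
  finally show "dist_fun m x (u - d) < dist_fun m x (u + d)" by (simp add: ennreal_less_zero_iff)
next
  assume *: "\<forall>d>0. dist_fun m x (u - d) < dist_fun m x (u + d)"
  show "u \<in> supp (mu_P m x)" unfolding supp_def
  proof safe
    fix U :: "real set" assume U: "open U" "u \<in> U"
    then obtain e where e: "0 < e" "ball u e \<subseteq> U" using open_contains_ball by blast
    define d where "d = e / 2"
    have "{u - d<..u + d} \<subseteq> ball u e" using e by (auto simp: d_def dist_real_def)
    then have "emeasure (mu_P m x) {u - d<..u + d} \<le> emeasure (mu_P m x) U"
      using e U by (intro emeasure_mono) auto
    moreover have "0 < emeasure (mu_P m x) {u - d<..u + d}"
      using mu_P_Ioc[OF x, of "u - d" "u + d"] *[rule_format, of d] e by (simp add: d_def)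
    ultimately show "0 < emeasure (mu_P m x) U" by simp
  qed
qed

lemma supp_mu_P_subset:
  assumes x: "is_order_parameter m x" and m: "0 \<le> m" and u: "u \<in> supp (mu_P m x)" shows "u \<in> {0..m}"
proof (rule ccontr)
  assume "u \<notin> {0..m}"
  then consider "u < 0" | "m < u" by force
  then show False
  proof cases
    case 1
    then show ?thesis using u supp_mu_P[OF x, of u] by (auto simp: dist_fun_def dest!: spec[of _ "- u / 2"])
  next
    case 2
    have "m < u - (u - m) / 2" using 2 by (simp add: field_simps)
    then show ?thesis using 2 u m supp_mu_P[OF x, of u] by (auto simp: dist_fun_def dest!: spec[of _ "(u - m) / 2"])
  qed
qed

text \<open>\<open>c\<close> is the mass of the atom, which every interval \<open>{t<..u}\<close>
  contains. The gap does not depend on \<open>t\<close> and so survives passage to the left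
  limit.\<close>

lemma mu_P_atom:
  assumes x: "is_order_parameter m x" and a: "measure (mu_P m x) {u} \<noteq> 0"
  shows "\<exists>c>0. \<forall>t<u. dist_fun m x t + c \<le> dist_fun m x u"
proof -
  define c where "c = measure (mu_P m x) {u}"
  have c: "0 < c" using a by (simp add: c_def zero_less_measure_iff)
  have "dist_fun m x t + c \<le> dist_fun m x u" if t: "t < u" for t
  proof -
    have e: "emeasure (mu_P m x) {t<..u} = ennreal (dist_fun m x u - dist_fun m x t)" using mu_P_Ioc[OF x] t by simp
    have "c \<le> measure (mu_P m x) {t<..u}"
      unfolding c_def using t e by (intro measure_mono_fmeasurable) (auto simp: fmeasurable_def)
    also have "\<dots> = dist_fun m x u - dist_fun m x t"
      using e dist_fun_mono[OF x, of t u] t by (simp add: measure_def)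
    finally show ?thesis by simp
  qed
  then show ?thesis using c by blast
qed

text \<open>\<xi>' acts entrywise; evaluating it at a constant matrix isolates the scalar function
  that acts on the entry \<open>(i, j)\<close>.\<close>

definition xi_entry :: "(nat \<Rightarrow> real^'m) \<Rightarrow> 'm \<Rightarrow> 'm \<Rightarrow> real \<Rightarrow> real" where
  "xi_entry \<beta> i j a = xi' \<beta> (\<chi> k l. a) $ i $ j"

text \<open>The entrywise second derivative \<xi>'': the derivative of \<xi>' at \<open>A\<close> in
  direction \<open>Y\<close> is \<open>hadamard (xi2 \<beta> A) Y\<close>.\<close>

definition xi2 :: "(nat \<Rightarrow> real^'m) \<Rightarrow> real^'m^'m \<Rightarrow> real^'m^'m" where
  "xi2 \<beta> A = (\<chi> i j. deriv (xi_entry \<beta> i j) (A $ i $ j))"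

lemma xi'_entry: "xi' \<beta> A $ i $ j = xi_entry \<beta> i j (A $ i $ j)"
  by (simp add: xi'_def xi_entry_def cong: if_cong)

lemma xi_entry_sym: "xi_entry \<beta> i j = xi_entry \<beta> j i"
  by (rule ext) (simp add: xi_entry_def xi'_def outer_def mult.commute mult.left_commute cong: if_cong)

lemma xi_entry_derivs:
  fixes \<beta> :: "nat \<Rightarrow> real^'m"
  assumes summ: "\<And>j. summable (\<lambda>p. 2 ^ p * (\<beta> p $ j)\<^sup>2)" and a: "\<bar>a\<bar> < 2"
  shows "(xi_entry \<beta> i j has_real_derivative deriv (xi_entry \<beta> i j) a) (at a)"
    and "(deriv (xi_entry \<beta> i j) has_real_derivative deriv (deriv (xi_entry \<beta> i j)) a) (at a)"
proof -
  obtain z0 z1 z2 :: "'m \<Rightarrow> 'm \<Rightarrow> real \<Rightarrow> real" where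
    z: "\<And>A i j. \<bar>A $ i $ j\<bar> < 2 \<Longrightarrow> xi' \<beta> A $ i $ j = z0 i j (A $ i $ j)"
      "\<And>i j a. \<bar>a\<bar> < 2 \<Longrightarrow> (z0 i j has_real_derivative z1 i j a) (at a)"
      "\<And>i j a. \<bar>a\<bar> < 2 \<Longrightarrow> (z1 i j has_real_derivative z2 i j a) (at a)"
    using xi'_entries[of \<beta>, OF summ] by blast
  have op: "open {-2<..<2::real}" by simp
  have e: "z0 i j b = xi_entry \<beta> i j b" if "b \<in> {-2<..<2}" for b
    using z(1)[of "\<chi> k l. b" i j] that by (simp add: xi_entry_def abs_less_iff)
  have d: "(xi_entry \<beta> i j has_real_derivative z1 i j b) (at b)" if "b \<in> {-2<..<2}" for b
    using has_field_derivative_transform_within_open[OF z(2) op that e] that by auto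
  then have z1: "z1 i j b = deriv (xi_entry \<beta> i j) b" if "b \<in> {-2<..<2}" for b
    using DERIV_imp_deriv that by metis
  have aa: "a \<in> {-2<..<2}" using a by auto
  show "(xi_entry \<beta> i j has_real_derivative deriv (xi_entry \<beta> i j) a) (at a)" using d[OF aa] z1[OF aa] by simp
  have "(deriv (xi_entry \<beta> i j) has_real_derivative z2 i j a) (at a)"
    using has_field_derivative_transform_within_open[OF z(3) op aa z1] a by auto
  then show "(deriv (xi_entry \<beta> i j) has_real_derivative deriv (deriv (xi_entry \<beta> i j)) a) (at a)"
    using DERIV_imp_deriv by metis
qed

section \<open>Derivatives of \<xi>' and \<xi>'' along a path\<close>

context cs_path begin

definition H :: "real \<Rightarrow> real^'m^'m" where "H t = xi' \<beta> (\<Phi> t) + outer h h"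

lemma H_deriv:
  assumes t: "t \<in> {0..n}"
  shows "(H has_vector_derivative hadamard (xi2 \<beta> (\<Phi> t)) (P t)) (at t within {0..n})"
proof (rule has_vector_derivative_matrixI)
  fix i j
  have "\<bar>\<Phi> t $ i $ j\<bar> < 2" using Phi_entry[OF t, of i j] by simp
  from DERIV_chain2[OF xi_entry_derivs(1)[OF beta_summable this] has_real_derivative_matrixD[OF dPhi[OF t]]]
  have "((\<lambda>s. xi_entry \<beta> i j (\<Phi> s $ i $ j)) has_real_derivative deriv (xi_entry \<beta> i j) (\<Phi> t $ i $ j) * P t $ i $ j) (at t within {0..n})" .
  from DERIV_add[OF this DERIV_const[of "outer h h $ i $ j"]]
  show "((\<lambda>t. H t $ i $ j) has_real_derivative hadamard (xi2 \<beta> (\<Phi> t)) (P t) $ i $ j) (at t within {0..n})"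
    by (simp add: H_def[abs_def] xi'_entry hadamard_def xi2_def)
qed

lemma H_cont: "continuous_on {0..n} H"
  by (rule continuous_on_vector_derivative) (rule H_deriv)

lemma xi2_deriv:
  assumes t: "t \<in> {0..n}"
  shows "\<exists>D. ((\<lambda>s. xi2 \<beta> (\<Phi> s)) has_vector_derivative D) (at t within {0..n})"
proof -
  have "((\<lambda>s. xi2 \<beta> (\<Phi> s)) has_vector_derivative
     (\<chi> i j. deriv (deriv (xi_entry \<beta> i j)) (\<Phi> t $ i $ j) * P t $ i $ j)) (at t within {0..n})"
  proof (rule has_vector_derivative_matrixI)
    fix i j
    have "\<bar>\<Phi> t $ i $ j\<bar> < 2" using Phi_entry[OF t, of i j] by simp
    from DERIV_chain2[OF xi_entry_derivs(2)[OF beta_summable this] has_real_derivative_matrixD[OF dPhi[OF t]]]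
    show "((\<lambda>s. xi2 \<beta> (\<Phi> s) $ i $ j) has_real_derivative
      (\<chi> i j. deriv (deriv (xi_entry \<beta> i j)) (\<Phi> t $ i $ j) * P t $ i $ j) $ i $ j) (at t within {0..n})"
      by (simp add: xi2_def)
  qed
  then show ?thesis by blast
qed

lemma xi2_cont: "continuous_on {0..n} (\<lambda>s. xi2 \<beta> (\<Phi> s))"
  unfolding continuous_on_eq_continuous_within using xi2_deriv has_vector_derivative_continuous by blast

lemma transpose_xi2: "t \<in> {0..n} \<Longrightarrow> transpose (xi2 \<beta> (\<Phi> t)) = xi2 \<beta> (\<Phi> t)"
  using psd_sym[OF Phi_psd, of t] by (simp add: xi2_def transpose_def vec_eq_iff xi_entry_sym)

text \<open>If the trace of \<open>\<Phi>\<close> follows a regular time change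
  \<open>\<theta>\<close> on the support, then composing \<open>\<Phi>\<close> and \<open>x\<close>
  with the inverse of \<open>\<theta>\<close> makes the trace equal to time on the new support. Each
  term of the functional is invariant under this substitution. Off the support
  \<open>\<theta>\<close> need not agree with the trace, which leaves the freedom to prescribe it
  smoothly.\<close>

lemma regauge:
  assumes d\<theta>: "\<And>t. t \<in> {0..n} \<Longrightarrow> (\<theta> has_real_derivative \<rho> t) (at t within {0..n})"
    and \<rho>: "\<And>t. t \<in> {0..n} \<Longrightarrow> 1 / 2 \<le> \<rho> t" and \<rho>_lip: "R-lipschitz_on {0..n} \<rho>"
    and \<theta>0: "\<theta> 0 = 0" and \<theta>n: "\<theta> n = n"
    and tr: "\<And>s. s \<in> supp (mu_P n x) \<Longrightarrow> trace (\<Phi> s) = \<theta> s"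
  shows "\<exists>y \<Psi>. admissible Q y \<Psi> \<and> CS \<beta> h Q y \<Psi> = cs_form \<beta> h x T \<Phi> P"
proof -
  have \<theta>_diff: "(t - s) / 2 \<le> \<theta> t - \<theta> s" if st: "0 \<le> s" "s \<le> t" "t \<le> n" for s t
  proof -
    have "(\<rho> has_integral (\<theta> t - \<theta> s)) {s..t}"
      using st by (intro fundamental_theorem_of_calculus has_vector_derivative_within_subset[OF d\<theta>[unfolded has_real_derivative_iff_has_vector_derivative]]) auto
    moreover have "((\<lambda>_. 1/2) has_integral (1/2 * (t - s))) {s..t}"
      using has_integral_const_real[of "1/2::real" s t] st by (simp add: mult.commute)
    ultimately have "1/2 * (t - s) \<le> \<theta> t - \<theta> s"
      using has_integral_le[of "\<lambda>_. 1/2" "1/2 * (t - s)" "{s..t}" \<rho> "\<theta> t - \<theta> s"] \<rho> st by auto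
    then show ?thesis by simp
  qed
  have \<theta>_less: "\<theta> s < \<theta> t" if "0 \<le> s" "s < t" "t \<le> n" for s t using \<theta>_diff[of s t] that by simp
  have \<theta>_cont: "continuous_on {0..n} \<theta>" by (auto simp: continuous_on_eq_continuous_within intro: DERIV_continuous[OF d\<theta>])
  have \<theta>_in: "\<theta> t \<in> {0..n}" if "t \<in> {0..n}" for t
    using \<theta>_diff[of 0 t] \<theta>_diff[of t n] that \<theta>0 \<theta>n by auto
  have inj: "inj_on \<theta> {0..n}" by (rule inj_onI) (metis \<theta>_less atLeastAtMost_iff less_irrefl linorder_less_linear)
  have surj: "\<exists>s. 0 \<le> s \<and> s \<le> n \<and> \<theta> s = t" if "t \<in> {0..n}" for t
    using that n_pos \<theta>_cont by (intro IVT') (auto simp: \<theta>0 \<theta>n)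
  define \<phi> where "\<phi> = inv_into {0..n} \<theta>"
  have img: "\<theta> ` {0..n} = {0..n}" using \<theta>_in surj by force
  have \<phi>_in: "\<phi> t \<in> {0..n}" and \<theta>\<phi>: "\<theta> (\<phi> t) = t" if "t \<in> {0..n}" for t
    using inv_into_into[of t \<theta> "{0..n}"] f_inv_into_f[of t \<theta> "{0..n}"] that img by (auto simp: \<phi>_def)
  have \<phi>\<theta>: "\<phi> (\<theta> t) = t" if "t \<in> {0..n}" for t using inv_into_f_f[OF inj that] by (simp add: \<phi>_def)
  have \<phi>0: "\<phi> 0 = 0" using \<phi>\<theta>[of 0] \<theta>0 n_pos by simp
  have \<phi>n: "\<phi> n = n" using \<phi>\<theta>[of n] \<theta>n n_pos by simp
  have \<phi>_le: "\<phi> s \<le> \<phi> t" if "s \<le> t" "s \<in> {0..n}" "t \<in> {0..n}" for s t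
    using \<theta>_less[of "\<phi> t" "\<phi> s"] \<phi>_in \<theta>\<phi> that by (metis atLeastAtMost_iff not_le)
  have \<phi>_less: "\<phi> s < \<phi> t" if "s < t" "s \<in> {0..n}" "t \<in> {0..n}" for s t
    using \<phi>_le[of s t] \<theta>\<phi> that by (metis less_eq_real_def less_irrefl)
  have \<phi>_lip': "\<phi> t - \<phi> s \<le> 2 * (t - s)" if "s \<le> t" "s \<in> {0..n}" "t \<in> {0..n}" for s t
    using \<theta>_diff[of "\<phi> s" "\<phi> t"] \<phi>_le[OF that] \<phi>_in \<theta>\<phi> that by auto
  have \<phi>_lip: "\<bar>\<phi> t - \<phi> s\<bar> \<le> 2 * \<bar>t - s\<bar>" if "s \<in> {0..n}" "t \<in> {0..n}" for s t
    using \<phi>_lip'[of s t] \<phi>_lip'[of t s] \<phi>_le[of s t] \<phi>_le[of t s] that by (cases "s \<le> t") auto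
  have "2-lipschitz_on {0..n} \<phi>" using \<phi>_lip by (intro lipschitz_onI) (auto simp: dist_real_def)
  then have \<phi>_cont: "continuous_on {0..n} \<phi>" by (rule lipschitz_on_continuous_on)
  \<comment> \<open>Obtained from the difference quotient of \<open>\<theta>\<close> composed with
    \<open>\<phi>\<close>, which treats the one-sided derivatives at 0 and \<open>n\<close> like the
    others.\<close>
  have d\<phi>: "(\<phi> has_real_derivative 1 / \<rho> (\<phi> t)) (at t within {0..n})" if t: "t \<in> {0..n}" for t
    unfolding has_field_derivative_iff
  proof (rule Lim_transform_eventually)
    have f: "filterlim \<phi> (at (\<phi> t) within {0..n}) (at t within {0..n})"
      unfolding filterlim_at
    proof
      show "(\<phi> \<longlongrightarrow> \<phi> t) (at t within {0..n})" using \<phi>_cont t by (auto simp: continuous_on_def)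
      show "\<forall>\<^sub>F s in at t within {0..n}. \<phi> s \<in> {0..n} \<and> \<phi> s \<noteq> \<phi> t"
        using \<phi>_in \<theta>\<phi> t by (auto simp: eventually_at_filter intro!: always_eventually) (metis atLeastAtMost_iff)+
    qed
    have "((\<lambda>s. (\<theta> s - \<theta> (\<phi> t)) / (s - \<phi> t)) \<longlongrightarrow> \<rho> (\<phi> t)) (at (\<phi> t) within {0..n})"
      using d\<theta>[OF \<phi>_in[OF t]] by (simp add: has_field_derivative_iff)
    from filterlim_compose[OF this f]
    have "((\<lambda>s. (\<theta> (\<phi> s) - \<theta> (\<phi> t)) / (\<phi> s - \<phi> t)) \<longlongrightarrow> \<rho> (\<phi> t)) (at t within {0..n})" .
    then show "((\<lambda>s. 1 / ((\<theta> (\<phi> s) - \<theta> (\<phi> t)) / (\<phi> s - \<phi> t))) \<longlongrightarrow> 1 / \<rho> (\<phi> t)) (at t within {0..n})"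
      using \<rho>[OF \<phi>_in[OF t]] by (intro tendsto_divide tendsto_const) auto
    show "\<forall>\<^sub>F s in at t within {0..n}. 1 / ((\<theta> (\<phi> s) - \<theta> (\<phi> t)) / (\<phi> s - \<phi> t)) = (\<phi> s - \<phi> t) / (s - t)"
      using \<theta>\<phi> t by (auto simp: eventually_at_filter)
  qed
  define P1 where "P1 t = (1 / \<rho> (\<phi> t)) *\<^sub>R P (\<phi> t)" for t
  obtain L where L: "L-lipschitz_on {0..n} P" using P_lip by blast
  obtain C where C: "0 \<le> C" "\<And>t. t \<in> {0..n} \<Longrightarrow> norm (P t) \<le> C" using P_bounded by blast
  have L0: "0 \<le> L" "0 \<le> R" using L \<rho>_lip lipschitz_on_nonneg by auto
  \<comment> \<open>Since \<open>\<rho> \<ge> 1/2\<close>, the factor \<open>1 / \<rho>\<close> is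
    at most 2 and \<open>\<phi>\<close> is 2-Lipschitz, giving \<open>2 * L * 2\<close>. The
    difference of two reciprocals costs a factor 4, which gives \<open>4 * R * 2\<close> times the
    bound \<open>C\<close> on \<open>P\<close>.\<close>
  have P1_lip: "(4 * L + 8 * R * C)-lipschitz_on {0..n} P1"
  proof (rule lipschitz_onI)
    fix s t assume st: "s \<in> {0..n}" "t \<in> {0..n}"
    let ?a = "1 / \<rho> (\<phi> s)" and ?b = "1 / \<rho> (\<phi> t)"
    have r: "1/2 \<le> \<rho> (\<phi> s)" "1/2 \<le> \<rho> (\<phi> t)" using \<rho> \<phi>_in st by auto
    have pp: "norm (P (\<phi> s) - P (\<phi> t)) \<le> L * (2 * \<bar>s - t\<bar>)"
      using lipschitz_onD[OF L \<phi>_in[OF st(1)] \<phi>_in[OF st(2)]] \<phi>_lip[OF st(2,1)] L0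
      by (auto simp: dist_norm intro: order_trans mult_left_mono)
    have rr: "\<bar>\<rho> (\<phi> s) - \<rho> (\<phi> t)\<bar> \<le> R * (2 * \<bar>s - t\<bar>)"
      using lipschitz_onD[OF \<rho>_lip \<phi>_in[OF st(1)] \<phi>_in[OF st(2)]] \<phi>_lip[OF st(2,1)] L0
      by (auto simp: dist_norm intro: order_trans mult_left_mono)
    have a: "\<bar>?a\<bar> \<le> 2" using r by (auto simp: field_simps)
    have "1/2 * (1/2) \<le> \<rho> (\<phi> s) * \<rho> (\<phi> t)" using r by (intro mult_mono) auto
    moreover have "?a - ?b = (\<rho> (\<phi> t) - \<rho> (\<phi> s)) / (\<rho> (\<phi> s) * \<rho> (\<phi> t))" using r by (simp add: field_simps)
    ultimately have "\<bar>?a - ?b\<bar> \<le> \<bar>\<rho> (\<phi> s) - \<rho> (\<phi> t)\<bar> / (1/4)"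
      by (simp only: abs_divide) (rule frac_le, auto)
    then have ab: "\<bar>?a - ?b\<bar> \<le> 8 * R * \<bar>s - t\<bar>" using rr by simp
    have "P1 s - P1 t = ?a *\<^sub>R (P (\<phi> s) - P (\<phi> t)) + (?a - ?b) *\<^sub>R P (\<phi> t)"
      by (simp add: P1_def algebra_simps)
    then have "norm (P1 s - P1 t) \<le> \<bar>?a\<bar> * norm (P (\<phi> s) - P (\<phi> t)) + \<bar>?a - ?b\<bar> * norm (P (\<phi> t))"
      by (metis norm_scaleR norm_triangle_ineq)
    also have "\<dots> \<le> 2 * (L * (2 * \<bar>s - t\<bar>)) + (8 * R * \<bar>s - t\<bar>) * C"
      using a ab pp C(2)[OF \<phi>_in[OF st(2)]] L0 by (intro add_mono mult_mono) auto
    finally show "dist (P1 s) (P1 t) \<le> (4 * L + 8 * R * C) * dist s t"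
      by (simp add: dist_norm algebra_simps)
  qed (use L0 C in auto)
  have dPsi: "(\<Phi> \<circ> \<phi> has_vector_derivative P1 t) (at t within {0..n})" if t: "t \<in> {0..n}" for t
    unfolding P1_def
  proof (rule vector_diff_chain_within)
    show "(\<phi> has_vector_derivative 1 / \<rho> (\<phi> t)) (at t within {0..n})"
      using d\<phi>[OF t] by (simp add: has_real_derivative_iff_has_vector_derivative)
    show "(\<Phi> has_vector_derivative P (\<phi> t)) (at (\<phi> t) within \<phi> ` {0..n})"
      by (rule has_vector_derivative_within_subset[OF dPhi[OF \<phi>_in[OF t]]]) (use \<phi>_in in auto)
  qed
  have P1_psd: "psd (P1 t)" if t: "t \<in> {0..n}" for t
    unfolding P1_def using \<rho>[OF \<phi>_in[OF t]] by (intro psd_scaleR P_psd \<phi>_in t) auto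
  define y where "y = x \<circ> \<phi>"
  have order_y: "is_order_parameter n y"
    unfolding is_order_parameter_def
  proof safe
    fix t assume t: "t \<in> {0..n}"
    show "y t \<in> {0..1}" using x_range[OF \<phi>_in[OF t]] by (simp add: y_def)
  next
    show "mono_on {0..n} y" using \<phi>_le \<phi>_in by (auto intro!: mono_onI x_le simp: y_def)
    show "y n = 1" by (simp add: y_def \<phi>n x_n)
  next
    fix t assume t: "t \<in> {0..<n}"
    have \<phi>t: "\<phi> t \<in> {0..<n}" using \<phi>_less[of t n] \<phi>_in[of t] t \<phi>n by auto
    have "filterlim \<phi> (at_right (\<phi> t)) (at_right t)"
      unfolding filterlim_at
    proof
      have "(\<phi> \<longlongrightarrow> \<phi> t) (at t within {0..n})" using \<phi>_cont t by (auto simp: continuous_on_def)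
      then have "(\<phi> \<longlongrightarrow> \<phi> t) (at t within {t..n})" by (rule tendsto_within_subset) (use t in auto)
      then show "(\<phi> \<longlongrightarrow> \<phi> t) (at_right t)" using t at_within_Icc_at_right[of t n] by simp
      show "\<forall>\<^sub>F s in at_right t. \<phi> s \<in> {\<phi> t<..} \<and> \<phi> s \<noteq> \<phi> t"
        unfolding eventually_at_right_field using t \<phi>_less[of t] by (intro exI[of _ n]) force
    qed
    then have "(y \<longlongrightarrow> x (\<phi> t)) (at_right t)"
      unfolding y_def o_def by (rule filterlim_compose[OF x_right[OF \<phi>t]])
    then show "continuous (at_right t) y" by (simp add: continuous_within y_def)
  qed
  have yT: "t_max n y = \<theta> T"
  proof -
    have T: "T \<in> {0..n}" using T_range by auto
    have "{t \<in> {0..n}. y t = 1} = {\<theta> T..n}"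
    proof safe
      fix t assume t: "t \<in> {0..n}" "y t = 1"
      have "T \<le> \<phi> t" using x_less_T[of "\<phi> t"] \<phi>_in[OF t(1)] t(2) by (force simp: y_def)
      then show "t \<in> {\<theta> T..n}" using \<theta>_less[of T "\<phi> t"] \<phi>_in[OF t(1)] \<theta>\<phi>[OF t(1)] t(1) T by (auto simp: order_le_less)
    next
      fix t assume t: "t \<in> {\<theta> T..n}"
      then show t': "t \<in> {0..n}" using \<theta>_in[OF T] by auto
      have "T \<le> \<phi> t" using \<phi>_le[of "\<theta> T" t] \<phi>\<theta>[OF T] \<theta>_in[OF T] t t' by auto
      then show "y t = 1" using x_T[of "\<phi> t"] \<phi>_in[OF t'] by (simp add: y_def)
    qed
    then show ?thesis using \<theta>_in[OF T] by (simp add: t_max_def cInf_atLeastAtMost)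
  qed
  have T: "T \<in> {0..n}" using T_range by auto
  interpret B: cs_path \<beta> h Q y "\<Phi> \<circ> \<phi>" P1 n
  proof
    show "\<exists>L. L-lipschitz_on {0..n} P1" using P1_lip by blast
    show "0 < det (Q - (\<Phi> \<circ> \<phi>) (t_max n y))" using det_gap by (simp add: yT \<phi>\<theta>[OF T])
  qed (use n_eq beta_summable Q_constraint order_y dPsi P1_psd \<phi>0 \<phi>n Phi_0 Phi_n in auto)
  note path = is_pathI[of "\<Phi> \<circ> \<phi>" P1 _ Q, folded n_eq]
  have is_path: "is_path Q (\<Phi> \<circ> \<phi>)"
    by (rule path(1)[OF dPsi P1_lip P1_psd]) (auto simp: \<phi>0 \<phi>n Phi_0 Phi_n)
  have pd: "path_deriv (\<Phi> \<circ> \<phi>) t = P1 t" if "t \<in> {0..n}" for t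
    by (rule path(2)[OF dPsi P1_lip P1_psd _ _ that]) (auto simp: \<phi>0 \<phi>n Phi_0 Phi_n)
  \<comment> \<open>As \<open>\<phi>\<close> is 2-Lipschitz, radius \<open>d / 2\<close> about
    \<open>t\<close> is carried into radius \<open>d\<close> about \<open>\<phi> t\<close>, so
    growth of \<open>y\<close> near \<open>t\<close> forces growth of \<open>x\<close> near
    \<open>\<phi> t\<close>. Points outside \<open>{0..n}\<close> are handled by the constant
    extension of the distribution function.\<close>
  have supp: "\<phi> t \<in> supp (mu_P n x)" "t \<in> {0..n}" if t: "t \<in> supp (mu_P n y)" for t
  proof -
    show tI: "t \<in> {0..n}" using supp_mu_P_subset[OF order_y _ t] n_pos by simp
    have "dist_fun n x (\<phi> t - d) < dist_fun n x (\<phi> t + d)" if d: "0 < d" for d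
    proof -
      have 1: "dist_fun n x (\<phi> t - d) \<le> dist_fun n y (t - d / 2)"
      proof (cases "t - d / 2 < 0")
        case True
        then have "\<phi> t - d < 0" using \<phi>_lip'[of 0 t] tI \<phi>0 by auto
        then show ?thesis using True by (simp add: dist_fun_def)
      next
        case False
        then have I: "t - d / 2 \<in> {0..n}" using tI d by auto
        have "\<phi> t - d \<le> \<phi> (t - d / 2)" using \<phi>_lip'[OF _ I tI] d by auto
        then have "dist_fun n x (\<phi> t - d) \<le> dist_fun n x (\<phi> (t - d / 2))" by (rule dist_fun_mono[OF order_x])
        also have "\<dots> = dist_fun n y (t - d / 2)" using I \<phi>_in[OF I] by (auto simp: dist_fun_def y_def)
        finally show ?thesis .
      qed
      have 2: "dist_fun n y (t + d / 2) \<le> dist_fun n x (\<phi> t + d)"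
      proof (cases "t + d / 2 > n")
        case True
        then have "\<phi> t + d > n" using \<phi>_lip'[of t n] tI \<phi>n n_pos by auto
        then show ?thesis using True n_pos d tI by (simp add: dist_fun_def)
      next
        case False
        then have I: "t + d / 2 \<in> {0..n}" using tI d by auto
        have "\<phi> (t + d / 2) \<le> \<phi> t + d" using \<phi>_lip'[OF _ tI I] d by auto
        then have "dist_fun n x (\<phi> (t + d / 2)) \<le> dist_fun n x (\<phi> t + d)" by (rule dist_fun_mono[OF order_x])
        moreover have "dist_fun n x (\<phi> (t + d / 2)) = dist_fun n y (t + d / 2)" using I \<phi>_in[OF I] by (auto simp: dist_fun_def y_def)
        ultimately show ?thesis by simp
      qed
      have "dist_fun n y (t - d / 2) < dist_fun n y (t + d / 2)" using t d supp_mu_P[OF order_y] by simp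
      then show ?thesis using 1 2 by simp
    qed
    then show "\<phi> t \<in> supp (mu_P n x)" using supp_mu_P[OF order_x] by simp
  qed
  have adm: "admissible Q y (\<Phi> \<circ> \<phi>)"
    unfolding admissible_def n_eq[symmetric]
    using order_y is_path supp tr \<theta>\<phi> det_gap by (auto simp: yT \<phi>\<theta>[OF T])
  have sub: "integral {a..b} (\<lambda>t. (1 / \<rho> (\<phi> t)) *\<^sub>R f (\<phi> t)) = integral {\<phi> a..\<phi> b} f"
    if ab: "0 \<le> a" "a \<le> b" "b \<le> n" and f: "f absolutely_integrable_on {\<phi> a..\<phi> b}"
    for a b and f :: "real \<Rightarrow> 'b::euclidean_space"
  proof (rule integral_substitution_mono(1)[OF ab(2) _ _ _ _ f])
    show "(\<phi> has_real_derivative 1 / \<rho> (\<phi> t)) (at t within {a..b})" if "t \<in> {a..b}" for t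
      using DERIV_subset[OF d\<phi>[of t], of "{a..b}"] that ab by auto
    show "0 \<le> 1 / \<rho> (\<phi> t)" if "t \<in> {a..b}" for t using \<rho>[OF \<phi>_in[of t]] that ab by auto
    show "inj_on \<phi> {a..b}" using \<theta>\<phi> ab by (intro inj_on_inverseI[of _ \<theta>]) auto
    show "\<phi> ` {a..b} = {\<phi> a..\<phi> b}"
    proof safe
      fix t assume "t \<in> {a..b}" then show "\<phi> t \<in> {\<phi> a..\<phi> b}" using \<phi>_le ab by auto
    next
      fix s assume s: "s \<in> {\<phi> a..\<phi> b}"
      have sI: "s \<in> {0..n}" using s \<phi>_in[of a] \<phi>_in[of b] ab by auto
      have "a \<le> \<theta> s" using \<phi>_less[of "\<theta> s" a] \<theta>_in[OF sI] \<phi>\<theta>[OF sI] s ab by (auto simp: not_le[symmetric])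
      moreover have "\<theta> s \<le> b" using \<phi>_less[of b "\<theta> s"] \<theta>_in[OF sI] \<phi>\<theta>[OF sI] s ab by (auto simp: not_le[symmetric])
      ultimately show "s \<in> \<phi> ` {a..b}" using \<phi>\<theta>[OF sI] by (intro image_eqI[of _ _ "\<theta> s"]) auto
    qed
  qed
  have I1: "integral {0..n} (\<lambda>t. y t * ((xi' \<beta> ((\<Phi> \<circ> \<phi>) t) + outer h h) \<bullet> P1 t)) =
      integral {0..n} (\<lambda>t. x t * ((xi' \<beta> (\<Phi> t) + outer h h) \<bullet> P t))"
  proof -
    have "(\<lambda>t. x t *\<^sub>R (H t \<bullet> P t)) absolutely_integrable_on {0..n}"
      by (intro mono_scaleR_absolutely_integrable x_mono continuous_intros H_cont P_cont)
    then have "(\<lambda>t. x t *\<^sub>R (H t \<bullet> P t)) absolutely_integrable_on {\<phi> 0..\<phi> n}" by (simp add: \<phi>0 \<phi>n)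
    from sub[OF _ _ _ this] n_pos show ?thesis
      by (simp add: \<phi>0 \<phi>n H_def P1_def y_def mult_ac)
  qed
  have I2: "integral {t..n} (\<lambda>s. y s *\<^sub>R P1 s) = hat (\<phi> t)" if t: "t \<in> {0..n}" for t
  proof -
    have "(\<lambda>s. x s *\<^sub>R P s) absolutely_integrable_on {\<phi> t..\<phi> n}"
      using \<phi>_in[OF t] by (intro mono_scaleR_absolutely_integrable monotone_on_subset[OF x_mono] continuous_on_subset[OF P_cont]) (auto simp: \<phi>n)
    from sub[OF _ _ _ this] t show ?thesis
      by (simp add: \<phi>n hat_def P1_def y_def mult_ac)
  qed
  have I3: "integral {0..\<theta> T} (\<lambda>t. matrix_inv (integral {t..n} (\<lambda>s. y s *\<^sub>R P1 s)) \<bullet> P1 t) =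
     integral {0..T} (\<lambda>t. matrix_inv (hat t) \<bullet> P t)"
  proof -
    have "continuous_on {0..T} (\<lambda>t. matrix_inv (hat t) \<bullet> P t)"
      using T_range det_gap by (intro continuous_intros inv_hat_cont continuous_on_subset[OF P_cont]) auto
    then have "(\<lambda>t. matrix_inv (hat t) \<bullet> P t) absolutely_integrable_on {\<phi> 0..\<phi> (\<theta> T)}"
      by (simp add: \<phi>0 \<phi>\<theta>[OF T] absolutely_integrable_continuous_real)
    from sub[OF _ _ _ this] \<theta>_in[OF T]
    have "integral {0..\<theta> T} (\<lambda>t. (1 / \<rho> (\<phi> t)) *\<^sub>R (matrix_inv (hat (\<phi> t)) \<bullet> P (\<phi> t))) = integral {0..T} (\<lambda>t. matrix_inv (hat t) \<bullet> P t)"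
      by (simp add: \<phi>0 \<phi>\<theta>[OF T])
    moreover have "integral {0..\<theta> T} (\<lambda>t. matrix_inv (integral {t..n} (\<lambda>s. y s *\<^sub>R P1 s)) \<bullet> P1 t) =
        integral {0..\<theta> T} (\<lambda>t. (1 / \<rho> (\<phi> t)) *\<^sub>R (matrix_inv (hat (\<phi> t)) \<bullet> P (\<phi> t)))"
    proof (rule integral_cong)
      fix t assume "t \<in> {0..\<theta> T}"
      then have "t \<in> {0..n}" using \<theta>_in[OF T] by auto
      then show "matrix_inv (integral {t..n} (\<lambda>s. y s *\<^sub>R P1 s)) \<bullet> P1 t = (1 / \<rho> (\<phi> t)) *\<^sub>R (matrix_inv (hat (\<phi> t)) \<bullet> P (\<phi> t))"
        by (simp only: I2 P1_def[of t] inner_scaleR_right real_scaleR_def)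
    qed
    ultimately show ?thesis by simp
  qed
  have "CS \<beta> h Q y (\<Phi> \<circ> \<phi>) = cs_form \<beta> h y (t_max n y) (\<Phi> \<circ> \<phi>) P1" by (rule B.CS_eq[OF pd])
  also have "\<dots> = cs_form \<beta> h x T \<Phi> P"
    unfolding cs_form_def n_eq[symmetric] yT I3 I1 hat_def[symmetric] by (simp add: \<phi>n \<phi>\<theta>[OF T])
  finally show ?thesis using adm by blast
qed

end

subsection \<open>First variation in the path\<close>

lemma integral_upper_has_vector_derivative:
  fixes f :: "real \<Rightarrow> 'a::euclidean_space"
  assumes f: "f integrable_on {a..b}" and t: "a < t" "t < b" and c: "isCont f t"
  shows "((\<lambda>u. integral {u..b} f) has_vector_derivative - f t) (at t)"
proof -
  have "((\<lambda>u. integral {a..u} f) has_vector_derivative f t) (at t within ({a..b} - {}))"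
    by (rule integral_has_vector_derivative_continuous_at[OF f])
       (use t c in \<open>auto intro: continuous_at_imp_continuous_at_within\<close>)
  then have "((\<lambda>u. integral {a..u} f) has_vector_derivative f t) (at t)" using t by (simp add: at_within_Icc_at)
  then have d: "((\<lambda>u. integral {a..b} f - integral {a..u} f) has_vector_derivative 0 - f t) (at t)"
    by (intro has_vector_derivative_diff has_vector_derivative_const)
  have "((\<lambda>u. integral {u..b} f) has_vector_derivative 0 - f t) (at t)"
  proof (rule has_vector_derivative_transform_within_open[OF d, of "{a<..<b}"])
    fix u assume "u \<in> {a<..<b}"
    then show "integral {a..b} f - integral {a..u} f = integral {u..b} f"
      using Henstock_Kurzweil_Integration.integral_combine[of a u b f] f by (simp add: algebra_simps)
  qed (use t in auto)
  then show ?thesis by simp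
qed

lemma continuous_on_integral_upper:
  fixes f :: "real \<Rightarrow> 'a::euclidean_space"
  assumes "f integrable_on {a..b}"
  shows "continuous_on {a..b} (\<lambda>u. integral {u..b} f)"
  using indefinite_integral_continuous_1'[OF assms] .

lemma pos_def_perturb:
  fixes A B :: "real^'m^'m"
  assumes A: "pos_def c A" "0 < c" and B: "transpose B = B"
  shows "\<exists>d>0. \<forall>e. \<bar>e\<bar> \<le> d \<longrightarrow> pos_def (c / 2) (A + e *\<^sub>R B)"
proof -
  have "\<exists>K>0. \<forall>(A::real^'m^'m) (v::real^'m). norm (A *v v) \<le> norm A * norm v * K" by (rule matvec.pos_bounded)
  then obtain K where K: "0 < K" "\<And>v. norm (B *v v) \<le> norm B * norm v * K" by blast
  \<comment> \<open>The perturbation may consume half of the lower bound; the summand 1 avoids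
    division by 0 when \<open>B = 0\<close>.\<close>
  define d where "d = c / (2 * (norm B * K + 1))"
  have nB: "0 < norm B * K + 1" using K by (smt (verit) mult_nonneg_nonneg norm_ge_zero)
  have d: "0 < d" "d * (norm B * K) \<le> c / 2"
  proof -
    show "0 < d" using A nB by (simp add: d_def)
    have "d * (norm B * K) \<le> d * (norm B * K + 1)" using \<open>0 < d\<close> by simp
    also have "\<dots> = c / 2" using nB by (simp add: d_def field_simps)
    finally show "d * (norm B * K) \<le> c / 2" .
  qed
  have "pos_def (c / 2) (A + e *\<^sub>R B)" if e: "\<bar>e\<bar> \<le> d" for e
  proof -
    have low: "c / 2 * (v \<bullet> v) \<le> v \<bullet> ((A + e *\<^sub>R B) *v v)" for v
    proof -
      have "\<bar>e * (v \<bullet> (B *v v))\<bar> \<le> d * (norm v * (norm B * norm v * K))"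
        unfolding abs_mult using e d K Cauchy_Schwarz_ineq2[of v "B *v v"]
        by (intro mult_mono order_trans[OF Cauchy_Schwarz_ineq2] mult_left_mono) auto
      also have "\<dots> = (d * (norm B * K)) * (v \<bullet> v)" by (simp add: dot_square_norm power2_eq_square)
      also have "\<dots> \<le> c / 2 * (v \<bullet> v)" using d by (intro mult_right_mono) auto
      finally have "- (c / 2 * (v \<bullet> v)) \<le> e * (v \<bullet> (B *v v))" by linarith
      moreover have "c * (v \<bullet> v) \<le> v \<bullet> (A *v v)" using A by (simp add: pos_def_def)
      ultimately show ?thesis by (simp add: matvec.add_left matvec.scaleR_left inner_add_right)
    qed
    moreover have "0 \<le> v \<bullet> ((A + e *\<^sub>R B) *v v)" for v
      using low[of v] A by (smt (verit) half_gt_zero inner_ge_zero mult_nonneg_nonneg)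
    moreover have "transpose (A + e *\<^sub>R B) = A + e *\<^sub>R B"
      using A B by (simp add: transp_add transp_scaleR pos_def_def psd_sym)
    ultimately show ?thesis by (simp add: pos_def_def psd_def)
  qed
  then show ?thesis using d by blast
qed

lemma inner_hadamard_swap: "hadamard A B \<bullet> C = hadamard A C \<bullet> B"
  by (simp add: hadamard_def inner_matrix mult_ac)

lemma bounded_on_Icc:
  fixes f :: "real \<Rightarrow> 'a::real_normed_vector"
  assumes "continuous_on {a..b} f"
  shows "\<exists>C\<ge>0. \<forall>t\<in>{a..b}. norm (f t) \<le> C"
proof -
  obtain C where C: "\<And>t. t \<in> {a..b} \<Longrightarrow> norm (f t) \<le> C"
    using compact_continuous_image[OF assms compact_Icc] compact_imp_bounded bounded_iff by (metis imageI)
  have "norm (f t) \<le> max C 0" if "t \<in> {a..b}" for t using C[OF that] by simp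
  then show ?thesis by (intro exI[of _ "max C 0"]) auto
qed

lemma matrix_norm_le_entries:
  assumes "\<And>i j. \<bar>(A::real^'m^'m) $ i $ j\<bar> \<le> c i j"
  shows "norm A \<le> (\<Sum>i\<in>UNIV. \<Sum>j\<in>UNIV. c i j)"
  unfolding norm_vec_def[of A]
  by (rule order_trans[OF L2_set_le_sum]) (auto intro!: sum_mono order_trans[OF norm_le_l1_cart] assms)

text \<open>Entrywise mean value bound on \<open>{-1..1}\<close>. It supplies the dominating
  constant when the functional is differentiated under the integral.\<close>

lemma xi'_lipschitz:
  fixes \<beta> :: "nat \<Rightarrow> real^'m"
  assumes summ: "\<And>j. summable (\<lambda>p. 2 ^ p * (\<beta> p $ j)\<^sup>2)"
  shows "\<exists>C\<ge>0. \<forall>A B. (\<forall>i j. \<bar>A $ i $ j\<bar> \<le> 1) \<longrightarrow> (\<forall>i j. \<bar>B $ i $ j\<bar> \<le> 1) \<longrightarrow>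
     norm (xi' \<beta> A - xi' \<beta> B) \<le> C * norm (A - B)"
proof -
  have ex: "\<exists>C\<ge>0. \<forall>a\<in>{-1..1}. \<forall>b\<in>{-1..1}. \<bar>xi_entry \<beta> i j a - xi_entry \<beta> i j b\<bar> \<le> C * \<bar>a - b\<bar>" for i j
  proof -
    have c: "continuous_on {-1..1} (deriv (xi_entry \<beta> i j))"
      by (intro continuous_at_imp_continuous_on ballI DERIV_isCont[OF xi_entry_derivs(2)[OF summ]]) auto
    obtain C where C: "0 \<le> C" "\<forall>a\<in>{-1..1}. norm (deriv (xi_entry \<beta> i j) a) \<le> C" using bounded_on_Icc[OF c] by blast
    have "norm (xi_entry \<beta> i j a - xi_entry \<beta> i j b) \<le> C * norm (a - b)" if ab: "a \<in> {-1..1}" "b \<in> {-1..1}" for a b :: real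
    proof (rule field_differentiable_bound[of "{-1..1}" _ "deriv (xi_entry \<beta> i j)"])
      fix z :: real assume z: "z \<in> {-1..1}"
      then have "\<bar>z\<bar> < 2" by auto
      then show "(xi_entry \<beta> i j has_field_derivative deriv (xi_entry \<beta> i j) z) (at z within {-1..1})"
        by (rule has_field_derivative_at_within[OF xi_entry_derivs(1)[OF summ]])
      show "norm (deriv (xi_entry \<beta> i j) z) \<le> C" using C(2) z by (rule bspec)
    qed (rule convex_real_interval ab)+
    then show ?thesis using C(1) unfolding real_norm_def by blast
  qed
  define C where "C i j = (SOME C. 0 \<le> C \<and> (\<forall>a\<in>{-1..1}. \<forall>b\<in>{-1..1}. \<bar>xi_entry \<beta> i j a - xi_entry \<beta> i j b\<bar> \<le> C * \<bar>a - b\<bar>))" for i j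
  have P: "0 \<le> C i j \<and> (\<forall>a\<in>{-1..1}. \<forall>b\<in>{-1..1}. \<bar>xi_entry \<beta> i j a - xi_entry \<beta> i j b\<bar> \<le> C i j * \<bar>a - b\<bar>)" for i j
    unfolding C_def by (rule someI_ex[OF ex])
  have C: "0 \<le> C i j"
    "a \<in> {-1..1} \<Longrightarrow> b \<in> {-1..1} \<Longrightarrow> \<bar>xi_entry \<beta> i j a - xi_entry \<beta> i j b\<bar> \<le> C i j * \<bar>a - b\<bar>" for i j a b
    using P[of i j] by blast+
  have "norm (xi' \<beta> A - xi' \<beta> B) \<le> (\<Sum>i\<in>UNIV. \<Sum>j\<in>UNIV. C i j) * norm (A - B)"
    if AB: "\<And>i j. \<bar>A $ i $ j\<bar> \<le> 1" "\<And>i j. \<bar>B $ i $ j\<bar> \<le> 1" for A B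
  proof -
    have "norm (xi' \<beta> A - xi' \<beta> B) \<le> (\<Sum>i\<in>UNIV. \<Sum>j\<in>UNIV. C i j * norm (A - B))"
    proof (rule matrix_norm_le_entries)
      fix i j
      have "\<bar>(A - B) $ i $ j\<bar> \<le> norm (A - B)"
        using order_trans[OF Finite_Cartesian_Product.norm_nth_le[of "(A - B) $ i" j] Finite_Cartesian_Product.norm_nth_le[of "A - B" i]]
        by simp
      then have "C i j * \<bar>A $ i $ j - B $ i $ j\<bar> \<le> C i j * norm (A - B)" using C(1) by (intro mult_left_mono) auto
      moreover have "\<bar>xi_entry \<beta> i j (A $ i $ j) - xi_entry \<beta> i j (B $ i $ j)\<bar> \<le> C i j * \<bar>A $ i $ j - B $ i $ j\<bar>"
        by (rule C(2); unfold atLeastAtMost_iff; use AB[of i j] in linarith)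
      ultimately show "\<bar>(xi' \<beta> A - xi' \<beta> B) $ i $ j\<bar> \<le> C i j * norm (A - B)" by (simp add: xi'_entry)
    qed
    then show ?thesis by (simp add: sum_distrib_right)
  qed
  then show ?thesis using C(1) by (intro exI[of _ "\<Sum>i\<in>UNIV. \<Sum>j\<in>UNIV. C i j"]) (auto intro!: sum_nonneg)
qed

section \<open>The kernel of the first variation\<close>

context cs_path begin

definition iv :: "real \<Rightarrow> real^'m^'m" where "iv t = matrix_inv (hat t)"
definition M :: "real \<Rightarrow> real^'m^'m" where "M t = integral {0..t} (\<lambda>s. iv s ** P s ** iv s)"
definition D :: "real \<Rightarrow> real^'m^'m" where "D t = H t - M t"
text \<open>The derivative of \<open>D\<close>, equal to \<open>L P\<close> for \<open>L X =
  hadamard (xi2 \<beta> (\<Phi> t)) X - iv t ** X ** iv t\<close>. Both parts of \<open>L\<close>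
  are self-adjoint, and no derivative of \<open>x\<close> occurs in it.\<close>

definition dD :: "real \<Rightarrow> real^'m^'m" where "dD t = hadamard (xi2 \<beta> (\<Phi> t)) (P t) - iv t ** P t ** iv t"
definition N :: "real \<Rightarrow> real^'m^'m" where "N t = integral {t..T} (\<lambda>s. (1 - x s) *\<^sub>R dD s)"
text \<open>Integration by parts of the integral of \<open>D\<close> against \<mu> over
  \<open>(t, T]\<close>. The weight \<open>1 - x\<close> vanishes at \<open>T\<close>, so there is
  no boundary term there. Since \<open>D\<close> and \<open>N\<close> are continuous, a jump of
  \<open>x\<close> changes \<open>K\<close> by that jump times \<open>D\<close>.\<close>

definition K :: "real \<Rightarrow> real^'m^'m" where "K t = - ((1 - x t) *\<^sub>R D t + N t)"

lemma T_sub: "t \<in> {0..T} \<Longrightarrow> t \<in> {0..n}"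
  using T_range by auto

lemma iv_cont: "continuous_on {0..T} iv"
  unfolding iv_def using inv_hat_cont[of T] T_range det_gap by simp

lemma P_cont_T: "continuous_on {0..T} P"
  using P_cont by (rule continuous_on_subset) (use T_range in auto)

lemma hat_pos_def_T: "\<exists>c>0. \<forall>s\<in>{0..T}. pos_def c (hat s)"
  using hat_pos_def[of T] T_range det_gap by simp

lemma iv_sym: "t \<in> {0..T} \<Longrightarrow> transpose (iv t) = iv t"
  unfolding iv_def using hat_pos_def_T pos_def_det_nz by (metis matrix_inv_sym pos_def_def psd_sym)

lemma dM_cont: "continuous_on {0..T} (\<lambda>s. iv s ** P s ** iv s)"
  by (intro matmul.continuous_on iv_cont P_cont_T)

lemma M_deriv: "t \<in> {0..T} \<Longrightarrow> (M has_vector_derivative iv t ** P t ** iv t) (at t within {0..T})"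
  unfolding M_def[abs_def] by (rule integral_has_vector_derivative[OF dM_cont])

lemma H_deriv_T: "t \<in> {0..T} \<Longrightarrow> (H has_vector_derivative hadamard (xi2 \<beta> (\<Phi> t)) (P t)) (at t within {0..T})"
  by (rule has_vector_derivative_within_subset[OF H_deriv]) (use T_range in auto)

lemma D_deriv: "t \<in> {0..T} \<Longrightarrow> (D has_vector_derivative dD t) (at t within {0..T})"
  unfolding D_def[abs_def] dD_def by (intro has_vector_derivative_diff H_deriv_T M_deriv)

lemma D_cont: "continuous_on {0..T} D"
  by (rule continuous_on_vector_derivative) (rule D_deriv)

lemma dD_cont: "continuous_on {0..T} dD"
  unfolding dD_def[abs_def]
  by (intro continuous_intros dM_cont hadamard.continuous_on P_cont_T continuous_on_subset[OF xi2_cont]) (use T_range in auto)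

lemma y_scaleR_integrable:
  fixes f :: "real \<Rightarrow> 'a::euclidean_space"
  assumes f: "continuous_on {a..b} f" and ab: "0 \<le> a" "b \<le> n"
  shows "(\<lambda>s. (1 - x s) *\<^sub>R f s) integrable_on {a..b}" "(\<lambda>s. x s *\<^sub>R f s) integrable_on {a..b}"
proof -
  show 1: "(\<lambda>s. x s *\<^sub>R f s) integrable_on {a..b}"
    by (intro mono_scaleR_integrable monotone_on_subset[OF x_mono] f) (use ab in auto)
  show "(\<lambda>s. (1 - x s) *\<^sub>R f s) integrable_on {a..b}"
    unfolding scaleR_diff_left scaleR_one
    by (intro integrable_diff 1 integrable_continuous_real f)
qed

lemma N_cont: "continuous_on {0..T} N"
  unfolding N_def[abs_def] by (intro continuous_on_integral_upper y_scaleR_integrable dD_cont) (use T_range in auto)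

lemma isCont_T: "continuous_on {0..T} f \<Longrightarrow> t \<in> {0<..<T} \<Longrightarrow> isCont f t"
  using continuous_on_interior[of "{0..T}" f t] by simp

lemma x_countable_disc: "countable {t \<in> {0..n}. \<not> continuous (at t within {0..n}) x}"
  by (rule mono_on_ctble_discont[OF x_mono])

lemma isCont_x: "t \<in> {0<..<n} - {t \<in> {0..n}. \<not> continuous (at t within {0..n}) x} \<Longrightarrow> isCont x t"
  using at_within_Icc_at[of 0 t n] by auto

text \<open>The left-hand side is twice the derivative of the functional in the direction \<open>\<Psi>\<close>, as obtained by
  differentiating under the integral sign.\<close>
lemma variation_identity:
  assumes R: "continuous_on {0..n} R" and R0: "(R has_integral 0) {0..n}"
    and \<Psi>: "\<And>t. \<Psi> t = integral {0..t} R" and W: "\<And>t. W t = integral {t..n} (\<lambda>s. x s *\<^sub>R R s)"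
  shows "integral {0..n} (\<lambda>t. x t * (hadamard (xi2 \<beta> (\<Phi> t)) (\<Psi> t) \<bullet> P t + H t \<bullet> R t)) - iv T \<bullet> \<Psi> T
     + integral {0..T} (\<lambda>t. iv t \<bullet> R t - (iv t ** W t ** iv t) \<bullet> P t) = integral {0..T} (\<lambda>t. K t \<bullet> R t)"
proof -
  have RT: "continuous_on {0..T} R" using R by (rule continuous_on_subset) (use T_range in auto)
  have d\<Psi>: "(\<Psi> has_vector_derivative R t) (at t within {0..n})" if "t \<in> {0..n}" for t
    unfolding \<Psi>[abs_def] by (rule integral_has_vector_derivative[OF R that])
  have \<Psi>c: "continuous_on {0..n} \<Psi>" by (rule continuous_on_vector_derivative) (rule d\<Psi>)
  have \<Psi>cT: "continuous_on {0..T} \<Psi>" using \<Psi>c by (rule continuous_on_subset) (use T_range in auto)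
  have \<Psi>0: "\<Psi> 0 = 0" and \<Psi>n: "\<Psi> n = 0" using R0 by (auto simp: \<Psi> integral_unique)
  have xR: "(\<lambda>s. x s *\<^sub>R R s) integrable_on {0..n}" by (rule y_scaleR_integrable(2)[OF R]) auto
  have Wc: "continuous_on {0..n} W" unfolding W[abs_def] by (rule continuous_on_integral_upper[OF xR])
  have WcT: "continuous_on {0..T} W" using Wc by (rule continuous_on_subset) (use T_range in auto)
  \<comment> \<open>Beyond \<open>T\<close> the weight is 1, and the total integral of
    \<open>R\<close> is 0.\<close>
  have WT: "W T = - \<Psi> T"
  proof -
    have "W T = integral {T..n} R" unfolding W by (rule integral_cong) (simp add: x_T)
    also have "\<dots> = integral {0..n} R - integral {0..T} R"
      using Henstock_Kurzweil_Integration.integral_combine[of 0 T n R] T_range R by (simp add: integrable_continuous_real algebra_simps)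
    finally show ?thesis using \<Psi>n by (simp add: \<Psi>)
  qed
  let ?A = "\<lambda>t. hadamard (xi2 \<beta> (\<Phi> t)) (\<Psi> t) \<bullet> P t + H t \<bullet> R t"
  have Ac: "continuous_on {0..n} ?A"
    by (intro continuous_intros hadamard.continuous_on xi2_cont \<Psi>c P_cont H_cont R)
  have AcT: "continuous_on {0..T} ?A" using Ac by (rule continuous_on_subset) (use T_range in auto)
  have McT: "continuous_on {0..T} M" by (rule continuous_on_vector_derivative) (rule M_deriv)
  let ?B = "\<lambda>t. iv t \<bullet> R t - (iv t ** W t ** iv t) \<bullet> P t"
  have Bc: "continuous_on {0..T} ?B" by (intro continuous_intros matmul.continuous_on iv_cont RT WcT P_cont_T)
  let ?S = "{t \<in> {0..n}. \<not> continuous (at t within {0..n}) x}"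
  \<comment> \<open>A primitive, off the jumps of \<open>x\<close>, of the difference between
    \<open>K \<bullet> R\<close> and the integrands on the left. The terms with \<open>N\<close> and
    \<open>D\<close> shift the derivative from \<open>R\<close> to \<open>\<Psi>\<close>; the
    derivatives of \<open>M \<bullet> W\<close> and \<open>iv \<bullet> \<Psi>\<close> cancel what
    \<open>M\<close> contributes to them and leave the variation of the inverse.\<close>
  define G where "G t = - (N t \<bullet> \<Psi> t) - D t \<bullet> \<Psi> t + M t \<bullet> W t - iv t \<bullet> \<Psi> t" for t
  define g where "g t = K t \<bullet> R t - x t * ?A t - ?B t" for t
  have KR: "(\<lambda>t. K t \<bullet> R t) integrable_on {0..T}"
  proof -
    have "(\<lambda>t. - ((1 - x t) *\<^sub>R (D t \<bullet> R t)) - N t \<bullet> R t) integrable_on {0..T}"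
      using T_range
      by (intro integrable_diff integrable_neg y_scaleR_integrable integrable_continuous_real continuous_intros D_cont N_cont RT) auto
    then show ?thesis by (simp add: K_def inner_add_left algebra_simps)
  qed
  have xA: "(\<lambda>t. x t * ?A t) integrable_on {a..b}" if "0 \<le> a" "b \<le> n" for a b
  proof -
    have "continuous_on {a..b} ?A" by (rule continuous_on_subset[OF Ac]) (use that in auto)
    from y_scaleR_integrable(2)[OF this that] show ?thesis by simp
  qed
  have xAT: "(\<lambda>t. x t * ?A t) integrable_on {0..T}" by (rule xA) (use T_range in auto)
  have Bi: "?B integrable_on {0..T}" by (intro integrable_continuous_real Bc)
  have "(g has_integral (G T - G 0)) {0..T}"
  proof (rule has_integral_deriv_countable[OF _ _ x_countable_disc])
    show "0 \<le> T" by (rule T_range)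
    show "continuous_on {0..T} G" unfolding G_def
      by (intro continuous_intros N_cont D_cont McT WcT \<Psi>cT iv_cont)
    show "g integrable_on {0..T}" unfolding g_def by (intro integrable_diff KR xAT Bi)
    fix t assume t: "t \<in> {0<..<T} - ?S"
    then have tT: "t \<in> {0<..<T}" and tT': "t \<in> {0..T}" and tn: "t \<in> {0<..<n}" "t \<in> {0..n}" using T_range by auto
    have xc: "isCont x t" using isCont_x t tn by simp
    have atT: "at t within {0..T} = at t" and atn: "at t within {0..n} = at t"
      using tT tn by (auto simp: at_within_Icc_at)
    show "isCont g t" unfolding g_def K_def
      by (intro continuous_intros xc isCont_T[OF D_cont tT] isCont_T[OF N_cont tT] isCont_T[OF RT tT]
          isCont_T[OF AcT tT] isCont_T[OF Bc tT])
    have dN: "(N has_vector_derivative - ((1 - x t) *\<^sub>R dD t)) (at t)"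
      unfolding N_def[abs_def] 
      by (rule integral_upper_has_vector_derivative[of _ 0 T])
         (use tT T_range in \<open>auto intro!: y_scaleR_integrable dD_cont continuous_intros xc isCont_T[OF dD_cont tT]\<close>)
    have dW: "(W has_vector_derivative - (x t *\<^sub>R R t)) (at t)"
      unfolding W[abs_def] 
      by (rule integral_upper_has_vector_derivative[OF xR])
         (use tn in \<open>auto intro!: continuous_intros xc isCont_T[OF RT tT]\<close>)
    obtain c where c: "0 < c" "\<And>s. s \<in> {0..T} \<Longrightarrow> pos_def c (hat s)" using hat_pos_def_T by blast
    have "((\<lambda>t. integral {t..n} (\<lambda>s. x s *\<^sub>R P s)) has_vector_derivative - (x t *\<^sub>R P t)) (at t)"
      by (rule integral_upper_has_vector_derivative[of _ 0 n])
         (use tn in \<open>auto intro!: xP_integrable continuous_intros xc isCont_T[OF P_cont_T tT]\<close>)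
    then have "(hat has_vector_derivative - (x t *\<^sub>R P t)) (at t within {0..T})" by (simp add: hat_def[abs_def] atT)
    from matrix_inv_has_vector_derivative[OF c tT' this]
    have div: "(iv has_vector_derivative x t *\<^sub>R (iv t ** P t ** iv t)) (at t)"
      by (simp add: iv_def[abs_def] atT mat_algebra)
    have dP: "(\<Psi> has_vector_derivative R t) (at t)" using d\<Psi>[OF tn(2)] by (simp add: atn)
    have dDd: "(D has_vector_derivative dD t) (at t)" using D_deriv[OF tT'] by (simp add: atT)
    have dM: "(M has_vector_derivative iv t ** P t ** iv t) (at t)" using M_deriv[OF tT'] by (simp add: atT)
    have "(G has_vector_derivative
        - (N t \<bullet> R t + - ((1 - x t) *\<^sub>R dD t) \<bullet> \<Psi> t) - (D t \<bullet> R t + dD t \<bullet> \<Psi> t)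
        + (M t \<bullet> - (x t *\<^sub>R R t) + (iv t ** P t ** iv t) \<bullet> W t) - (iv t \<bullet> R t + x t *\<^sub>R (iv t ** P t ** iv t) \<bullet> \<Psi> t)) (at t)"
      unfolding G_def[abs_def]
      by (intro has_vector_derivative_add has_vector_derivative_diff has_vector_derivative_minus
          bounded_bilinear.has_vector_derivative[OF bounded_bilinear_inner] dN dW div dP dDd dM)
    moreover have "- (N t \<bullet> R t + - ((1 - x t) *\<^sub>R dD t) \<bullet> \<Psi> t) - (D t \<bullet> R t + dD t \<bullet> \<Psi> t)
        + (M t \<bullet> - (x t *\<^sub>R R t) + (iv t ** P t ** iv t) \<bullet> W t) - (iv t \<bullet> R t + x t *\<^sub>R (iv t ** P t ** iv t) \<bullet> \<Psi> t) = g t"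
    proof -
      have s1: "hadamard (xi2 \<beta> (\<Phi> t)) (\<Psi> t) \<bullet> P t = hadamard (xi2 \<beta> (\<Phi> t)) (P t) \<bullet> \<Psi> t"
        by (rule inner_hadamard_swap)
      have s2: "(iv t ** W t ** iv t) \<bullet> P t = (iv t ** P t ** iv t) \<bullet> W t"
        using inner_congruence[OF iv_sym[OF tT']] by (simp add: inner_commute)
      show ?thesis unfolding g_def s1 s2 K_def dD_def D_def
        by (simp add: inner_add_left inner_diff_left algebra_simps)
    qed
    ultimately show "(G has_vector_derivative g t) (at t)" by simp
  qed
  moreover have "G T - G 0 = - (H T \<bullet> \<Psi> T) - iv T \<bullet> \<Psi> T"
    by (simp add: G_def \<Psi>0 WT N_def M_def[of 0] D_def inner_diff_left)
  ultimately have I: "integral {0..T} g = - (H T \<bullet> \<Psi> T) - iv T \<bullet> \<Psi> T" by (simp add: integral_unique)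
  have "integral {0..T} g = integral {0..T} (\<lambda>t. K t \<bullet> R t) - integral {0..T} (\<lambda>t. x t * ?A t) - integral {0..T} ?B"
    unfolding g_def by (subst integral_diff, intro integrable_diff KR xAT, rule Bi, subst integral_diff[OF KR xAT]) simp
  \<comment> \<open>On \<open>{T..n}\<close> the integrand is the total derivative of
    \<open>H \<bullet> \<Psi>\<close>, and \<open>\<Psi> n = 0\<close>.\<close>
  moreover have "integral {0..n} (\<lambda>t. x t * ?A t) = integral {0..T} (\<lambda>t. x t * ?A t) - H T \<bullet> \<Psi> T"
  proof -
    have "integral {T..n} (\<lambda>t. x t * ?A t) = integral {T..n} ?A"
      by (rule integral_cong) (simp add: x_T)
    also have "\<dots> = H n \<bullet> \<Psi> n - H T \<bullet> \<Psi> T"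
    proof (rule integral_unique, rule fundamental_theorem_of_calculus)
      fix t assume "t \<in> {T..n}"
      then have t: "t \<in> {0..n}" using T_range by auto
      have "((\<lambda>t. H t \<bullet> \<Psi> t) has_vector_derivative H t \<bullet> R t + hadamard (xi2 \<beta> (\<Phi> t)) (P t) \<bullet> \<Psi> t) (at t within {0..n})"
        by (intro bounded_bilinear.has_vector_derivative[OF bounded_bilinear_inner] H_deriv d\<Psi> t)
      then have "((\<lambda>t. H t \<bullet> \<Psi> t) has_vector_derivative ?A t) (at t within {0..n})"
        by (simp add: inner_hadamard_swap[of _ "P t"] add.commute)
      then show "((\<lambda>t. H t \<bullet> \<Psi> t) has_vector_derivative ?A t) (at t within {T..n})"
        by (rule has_vector_derivative_within_subset) (use T_range in auto)
    qed (use T_range in simp)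
    finally show ?thesis
      using Henstock_Kurzweil_Integration.integral_combine[of 0 T n "\<lambda>t. x t * ?A t"] T_range xA \<Psi>n by simp
  qed
  ultimately show ?thesis using I by simp
qed

end

lemma pos_def_weaken: "pos_def c A \<Longrightarrow> c' \<le> c \<Longrightarrow> pos_def c' A"
  unfolding pos_def_def by (meson inner_ge_zero mult_right_mono order_trans)

locale cs_minimizer = cs_path +
  assumes trace_supp: "\<And>t. t \<in> supp (mu_P n x) \<Longrightarrow> trace (\<Phi> t) = t"
    and minimal: "\<And>y \<Psi>. admissible Q y \<Psi> \<Longrightarrow> cs_form \<beta> h x (t_max n x) \<Phi> P \<le> CS \<beta> h Q y \<Psi>"
begin

text \<open>The path with derivative \<open>P + e R\<close> keeps its end values because
  \<open>R\<close> has integral 0. After a time change it is a competitor, so the difference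
  quotients of the functional are nonnegative; dominated convergence gives their limit, and
  \<open>variation_identity\<close> rewrites it in terms of \<open>K\<close>.\<close>

lemma first_variation:
  assumes Rlip: "LR-lipschitz_on {0..n} R" and R0: "(R has_integral 0) {0..n}"
    and e0: "0 < e0" and psdR: "\<And>e t. 0 \<le> e \<Longrightarrow> e \<le> e0 \<Longrightarrow> t \<in> {0..n} \<Longrightarrow> psd (P t + e *\<^sub>R R t)"
  shows "0 \<le> integral {0..T} (\<lambda>t. K t \<bullet> R t)"
proof -
  have Rc: "continuous_on {0..n} R" by (rule lipschitz_on_continuous_on[OF Rlip])
  have RcT: "continuous_on {0..T} R" using Rc by (rule continuous_on_subset) (use T_range in auto)
  define \<Psi> where "\<Psi> t = integral {0..t} R" for t
  define W where "W t = integral {t..n} (\<lambda>s. x s *\<^sub>R R s)" for t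
  have d\<Psi>: "(\<Psi> has_vector_derivative R t) (at t within {0..n})" if "t \<in> {0..n}" for t
    unfolding \<Psi>_def[abs_def] by (rule integral_has_vector_derivative[OF Rc that])
  have \<Psi>c: "continuous_on {0..n} \<Psi>" by (rule continuous_on_vector_derivative) (rule d\<Psi>)
  have \<Psi>0: "\<Psi> 0 = 0" and \<Psi>n: "\<Psi> n = 0" using R0 by (auto simp: \<Psi>_def integral_unique)
  have xR: "(\<lambda>s. x s *\<^sub>R R s) integrable_on {a..b}" if "0 \<le> a" "b \<le> n" for a b
    by (rule y_scaleR_integrable(2)[OF continuous_on_subset[OF Rc] that]) (use that in auto)
  have Wc: "continuous_on {0..n} W" unfolding W_def[abs_def] by (rule continuous_on_integral_upper[OF xR]) auto
  have WcT: "continuous_on {0..T} W" using Wc by (rule continuous_on_subset) (use T_range in auto)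
  have WT: "W T = - \<Psi> T"
  proof -
    have "W T = integral {T..n} R" unfolding W_def by (rule integral_cong) (simp add: x_T)
    also have "\<dots> = integral {0..n} R - integral {0..T} R"
      using Henstock_Kurzweil_Integration.integral_combine[of 0 T n R] T_range Rc by (simp add: integrable_continuous_real algebra_simps)
    finally show ?thesis using \<Psi>n by (simp add: \<Psi>_def)
  qed
  have Rsym: "transpose (R t) = R t" if t: "t \<in> {0..n}" for t
  proof -
    have "R t = (1 / e0) *\<^sub>R ((P t + e0 *\<^sub>R R t) - P t)" using e0 by simp
    moreover have "transpose (P t + e0 *\<^sub>R R t) = P t + e0 *\<^sub>R R t" using psdR[of e0 t] e0 t by (intro psd_sym) auto
    ultimately show ?thesis by (metis P_psd psd_sym t transp_diff transp_scaleR)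
  qed
  have \<Psi>sym: "transpose (\<Psi> T) = \<Psi> T"
  proof -
    have "R integrable_on {0..T}" by (intro integrable_continuous_real RcT)
    then have "transpose (integral {0..T} R) = integral {0..T} (transpose \<circ> R)"
      using integral_linear[OF _ bounded_linear_transpose] by metis
    also have "\<dots> = integral {0..T} R" by (rule integral_cong) (use Rsym T_sub in auto)
    finally show ?thesis by (simp add: \<Psi>_def)
  qed
  obtain CP where CP: "0 \<le> CP" "\<And>t. t \<in> {0..n} \<Longrightarrow> norm (P t) \<le> CP" using P_bounded by blast
  obtain CR where CR: "0 \<le> CR" "\<And>t. t \<in> {0..n} \<Longrightarrow> norm (R t) \<le> CR" using bounded_on_Icc[OF Rc] by blast
  obtain CY where CY: "0 \<le> CY" "\<And>t. t \<in> {0..n} \<Longrightarrow> norm (\<Psi> t) \<le> CY" using bounded_on_Icc[OF \<Psi>c] by blast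
  obtain CH where CH: "0 \<le> CH" "\<And>t. t \<in> {0..n} \<Longrightarrow> norm (H t) \<le> CH" using bounded_on_Icc[OF H_cont] by blast
  have tRc: "continuous_on {0..n} (\<lambda>t. trace (R t))" by (rule bounded_linear.continuous_on[OF bounded_linear_trace Rc])
  obtain Ct where Ct: "0 \<le> Ct" "\<And>t. t \<in> {0..n} \<Longrightarrow> norm (trace (R t)) \<le> Ct" using bounded_on_Icc[OF tRc] by blast
  obtain Lt where Lt: "Lt-lipschitz_on {0..n} (\<lambda>t. trace (R t))"
  proof -
    have "\<exists>K\<ge>0. \<forall>A::real^'a^'a. norm (trace A) \<le> norm A * K" by (rule bounded_linear.nonneg_bounded[OF bounded_linear_trace])
    then obtain k where k: "0 \<le> k" "\<And>A::real^'a^'a. norm (trace A) \<le> norm A * k" by blast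
    have "(LR * k)-lipschitz_on {0..n} (\<lambda>t. trace (R t))"
    proof (rule lipschitz_onI)
      fix s t assume st: "s \<in> {0..n}" "t \<in> {0..n}"
      have "dist (trace (R s)) (trace (R t)) = norm (trace (R s - R t))" by (simp add: dist_norm linear_diff[OF linear_trace])
      also have "\<dots> \<le> norm (R s - R t) * k" by (rule k)
      also have "\<dots> \<le> (LR * dist s t) * k" using lipschitz_onD[OF Rlip st] k by (intro mult_right_mono) (auto simp: dist_norm)
      finally show "dist (trace (R s)) (trace (R t)) \<le> LR * k * dist s t" by (simp add: mult_ac)
    qed (use k lipschitz_on_nonneg[OF Rlip] in auto)
    then show ?thesis by (rule that)
  qed
  obtain LP where LP: "LP-lipschitz_on {0..n} P" using P_lip by blast
  obtain c0 where c0: "0 < c0" "\<And>s. s \<in> {0..T} \<Longrightarrow> pos_def c0 (hat s)" using hat_pos_def_T by blast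
  have hT: "hat T = Q - \<Phi> T" by (rule hat_eq) (use T_range in auto)
  have "pos_def c0 (Q - \<Phi> T)" using c0(2)[of T] hT T_range by simp
  then obtain d where d: "0 < d" "\<And>e. \<bar>e\<bar> \<le> d \<Longrightarrow> pos_def (c0 / 2) (Q - \<Phi> T + e *\<^sub>R (- \<Psi> T))"
    using pos_def_perturb[of c0 "Q - \<Phi> T" "- \<Psi> T"] c0 \<Psi>sym linear_neg[OF linear_transpose] by metis
  \<comment> \<open>Three constraints on the perturbation: the derivative stays semidefinite,
    \<open>Q - \<Phi> T\<close> stays positive definite, and the speed
    \<open>1 + e * trace (R t)\<close> of the time change stays at least 1/2.\<close>
  define e1 where "e1 = min e0 (min d (1 / (2 * (Ct + 1))))"
  have e1: "0 < e1" "e1 \<le> e0" "e1 \<le> d" "e1 * Ct \<le> 1 / 2"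
  proof -
    show "0 < e1" using e0 d Ct by (simp add: e1_def)
    show "e1 \<le> e0" "e1 \<le> d" by (simp_all add: e1_def)
    have "e1 * Ct \<le> 1 / (2 * (Ct + 1)) * Ct" using Ct by (intro mult_right_mono) (simp_all add: e1_def)
    also have "\<dots> \<le> 1 / 2" using Ct by (simp add: field_simps)
    finally show "e1 * Ct \<le> 1 / 2" .
  qed
  define Pe where "Pe e t = P t + e *\<^sub>R R t" for e t
  define Fe where "Fe e t = \<Phi> t + e *\<^sub>R \<Psi> t" for e t
  define he where "he e t = hat t + e *\<^sub>R W t" for e t
  have he: "integral {t..n} (\<lambda>s. x s *\<^sub>R Pe e s) = he e t" if "t \<in> {0..n}" for e t
  proof -
    have "integral {t..n} (\<lambda>s. x s *\<^sub>R Pe e s) = integral {t..n} (\<lambda>s. x s *\<^sub>R P s + e *\<^sub>R (x s *\<^sub>R R s))"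
      by (simp add: Pe_def scaleR_add_right mult.commute)
    also have "\<dots> = integral {t..n} (\<lambda>s. x s *\<^sub>R P s) + integral {t..n} (\<lambda>s. e *\<^sub>R (x s *\<^sub>R R s))"
      using that by (intro integral_add integrable_cmul xP_integrable xR) auto
    also have "integral {t..n} (\<lambda>s. e *\<^sub>R (x s *\<^sub>R R s)) = e *\<^sub>R integral {t..n} (\<lambda>s. x s *\<^sub>R R s)" by (rule integral_cmul)
    finally show ?thesis unfolding he_def hat_def W_def .
  qed
  have inst: "cs_path \<beta> Q x (Fe e) (Pe e) n" if e: "0 < e" "e \<le> e1" for e
  proof
    show "n = real CARD('a)" by (rule n_eq)
    show "summable (\<lambda>p. 2 ^ p * (\<beta> p $ j)\<^sup>2)" for j by (rule beta_summable)
    show "is_constraint Q" by (rule Q_constraint)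
    show "is_order_parameter n x" by (rule order_x)
    show "(Fe e has_vector_derivative Pe e t) (at t within {0..n})" if t: "t \<in> {0..n}" for t
      unfolding Fe_def[abs_def] Pe_def
      by (intro has_vector_derivative_add dPhi t bounded_linear.has_vector_derivative[OF bounded_linear_scaleR_right d\<Psi>])
    show "\<exists>L. L-lipschitz_on {0..n} (Pe e)"
      unfolding Pe_def[abs_def] using lipschitz_on_add[OF LP lipschitz_on_cmult[OF Rlip]] by blast
    show "psd (Pe e t)" if "t \<in> {0..n}" for t unfolding Pe_def using psdR that e e1 by auto
    show "Fe e 0 = 0" by (simp add: Fe_def \<Psi>0 Phi_0)
    show "Fe e n = Q" by (simp add: Fe_def \<Psi>n Phi_n)
    have "pos_def (c0 / 2) (Q - Fe e T)" using d(2)[of e] e e1 by (simp add: Fe_def algebra_simps)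
    from pos_def_det_pos[OF this] c0(1) show "0 < det (Q - Fe e T)" by simp
  qed
  \<comment> \<open>A lower bound independent of \<open>e\<close> and \<open>t\<close>: it holds at
    \<open>T\<close> by the choice of \<open>d\<close>, and at earlier times because the perturbed
    \<open>hat\<close> is again nonincreasing.\<close>
  have pdh: "pos_def (c0 / 2) (he e t)" if e: "0 < e" "e \<le> e1" and t: "t \<in> {0..T}" for e t
  proof -
    have "pos_def (c0 / 2) (he e T)" using d(2)[of e] e e1 by (simp add: he_def hT WT algebra_simps)
    moreover have "psd (he e t - he e T)"
      using cs_path.hat_mono[OF inst[OF e], of t T] t T_range unfolding cs_path.hat_def[OF inst[OF e]] by (simp add: he)
    ultimately show ?thesis by (rule pos_def_mono)
  qed
  define J where "J e = cs_form \<beta> h x T (Fe e) (Pe e)" for e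
  have le: "cs_form \<beta> h x T \<Phi> P \<le> J e" if e: "0 < e" "e \<le> e1" for e
  proof -
    \<comment> \<open>On the support the perturbed path has trace
      \<open>t + e * trace (\<Psi> t)\<close>; this function is itself taken as the time
      change.\<close>
    have "\<exists>y \<Psi>'. admissible Q y \<Psi>' \<and> CS \<beta> h Q y \<Psi>' = cs_form \<beta> h x T (Fe e) (Pe e)"
    proof (rule cs_path.regauge[OF inst[OF e], where \<theta> = "\<lambda>t. t + e * trace (\<Psi> t)" and \<rho> = "\<lambda>t. 1 + e * trace (R t)"])
      fix t assume t: "t \<in> {0..n}"
      have "((\<lambda>t. trace (\<Psi> t)) has_real_derivative trace (R t)) (at t within {0..n})"
        using bounded_linear.has_vector_derivative[OF bounded_linear_trace d\<Psi>[OF t]]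
        by (simp add: has_real_derivative_iff_has_vector_derivative)
      then show "((\<lambda>t. t + e * trace (\<Psi> t)) has_real_derivative 1 + e * trace (R t)) (at t within {0..n})"
        by (intro DERIV_add DERIV_ident DERIV_cmult)
      have "\<bar>e * trace (R t)\<bar> \<le> e1 * Ct" unfolding abs_mult using Ct(2)[OF t] e Ct(1) by (intro mult_mono) auto
      then show "1 / 2 \<le> 1 + e * trace (R t)" using e1 by linarith
    next
      show "(0 + \<bar>e\<bar> * Lt)-lipschitz_on {0..n} (\<lambda>t. 1 + e * trace (R t))"
        by (intro lipschitz_on_add lipschitz_on_constant lipschitz_on_cmult_real Lt)
      show "0 + e * trace (\<Psi> 0) = 0" "n + e * trace (\<Psi> n) = n" by (simp_all add: \<Psi>0 \<Psi>n linear_0[OF linear_trace])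
      show "trace (Fe e s) = s + e * trace (\<Psi> s)" if "s \<in> supp (mu_P n x)" for s
        using trace_supp[OF that] by (simp add: Fe_def linear_add[OF linear_trace] linear_scale[OF linear_trace])
    qed
    then show ?thesis using minimal unfolding J_def by metis
  qed
  define E where "E k = e1 / real (Suc k)" for k
  have E: "0 < E k" "E k \<le> e1" for k
    using e1(1) by (auto simp: E_def field_simps)
  have Elim: "E \<longlonglongrightarrow> 0" unfolding E_def by (rule LIMSEQ_Suc[OF lim_const_over_n])
  have Eat: "filterlim E (at 0) sequentially" using Elim E(1) by (auto simp: filterlim_at less_imp_neq[symmetric])
  define He where "He e t = xi' \<beta> (Fe e t) + outer h h" for e t
  have Hec: "continuous_on {0..n} (He e)" if "0 < e" "e \<le> e1" for e
    using cs_path.H_cont[OF inst[OF that]] unfolding cs_path.H_def[OF inst[OF that]] He_def by simp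
  have Pec: "continuous_on {0..n} (Pe e)" for e unfolding Pe_def by (intro continuous_intros P_cont Rc)
  define q where "q k t = (1 / E k) *\<^sub>R (He (E k) t - H t)" for k t
  define A where "A k t = x t * (q k t \<bullet> Pe (E k) t + H t \<bullet> R t)" for k t
  define IV where "IV k t = matrix_inv (he (E k) t)" for k t
  \<comment> \<open>By the resolvent identity this is the exact difference quotient of the last
    integrand, not an approximation; likewise \<open>A k\<close> for the first one. Hence only
    limits of integrals remain.\<close>
  define B where "B k t = IV k t \<bullet> R t - (IV k t ** W t ** iv t) \<bullet> P t" for k t
  define G where "G e = ln (det (Q - \<Phi> T - e *\<^sub>R \<Psi> T))" for e
  have qc: "continuous_on {0..n} (q k)" for k unfolding q_def by (intro continuous_intros Hec H_cont E)
  have A_int: "A k integrable_on {0..n}" for k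
  proof -
    have "continuous_on {0..n} (\<lambda>t. q k t \<bullet> Pe (E k) t + H t \<bullet> R t)" by (intro continuous_intros qc Pec H_cont Rc)
    from y_scaleR_integrable(2)[OF this] show ?thesis by (simp add: A_def[abs_def])
  qed
  have xHP: "(\<lambda>t. x t * (H t \<bullet> P t)) integrable_on {0..n}"
    using y_scaleR_integrable(2)[of 0 n "\<lambda>t. H t \<bullet> P t"] by (auto intro!: continuous_intros H_cont P_cont)
  have A_eq: "integral {0..n} (\<lambda>t. x t * (He (E k) t \<bullet> Pe (E k) t)) = integral {0..n} (\<lambda>t. x t * (H t \<bullet> P t)) + E k * integral {0..n} (A k)" for k
  proof -
    have "x t * (He (E k) t \<bullet> Pe (E k) t) = x t * (H t \<bullet> P t) + E k * A k t" for t
    proof -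
      have "He (E k) t = H t + E k *\<^sub>R q k t" using E(1)[of k] by (simp add: q_def)
      then show ?thesis by (simp add: A_def Pe_def inner_add_left inner_add_right algebra_simps)
    qed
    then have "integral {0..n} (\<lambda>t. x t * (He (E k) t \<bullet> Pe (E k) t)) = integral {0..n} (\<lambda>t. x t * (H t \<bullet> P t) + E k * A k t)" by simp
    also have "\<dots> = integral {0..n} (\<lambda>t. x t * (H t \<bullet> P t)) + integral {0..n} (\<lambda>t. E k * A k t)"
      using A_int[of k] by (intro integral_add xHP) (auto intro: integrable_on_mult_right)
    finally show ?thesis by simp
  qed
  have IVc: "continuous_on {0..T} (IV k)" for k
    unfolding IV_def continuous_on_def
  proof
    fix t assume t: "t \<in> {0..T}"
    have c: "continuous_on {0..n} (he (E k))" unfolding he_def by (intro continuous_intros hat_cont Wc)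
    have "continuous_on {0..T} (he (E k))" by (rule continuous_on_subset[OF c]) (use T_range in auto)
    then have l: "(he (E k) \<longlongrightarrow> he (E k) t) (at t within {0..T})" using t by (auto simp: continuous_on_def)
    show "((\<lambda>t. matrix_inv (he (E k) t)) \<longlongrightarrow> matrix_inv (he (E k) t)) (at t within {0..T})"
      by (rule matrix_inv_tendsto[OF _ pdh[OF E t] _ l]) (use c0 pdh[OF E] in \<open>auto simp: eventually_at_filter\<close>)
  qed
  have B_int: "B k integrable_on {0..T}" for k
    unfolding B_def by (intro integrable_continuous_real continuous_intros matmul.continuous_on IVc RcT WcT iv_cont P_cont_T)
  have IV_eq: "IV k t \<bullet> Pe (E k) t = iv t \<bullet> P t + E k * B k t" if t: "t \<in> {0..T}" for k t
  proof -
    have "IV k t - iv t = IV k t ** (hat t - he (E k) t) ** iv t"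
      unfolding IV_def iv_def by (rule matrix_inv_diff) (use pos_def_det_nz[OF pdh[OF E t]] pos_def_det_nz[OF c0(2)[OF t]] c0 in auto)
    also have "\<dots> = - (E k *\<^sub>R (IV k t ** W t ** iv t))" by (simp add: he_def mat_algebra)
    finally have "IV k t = iv t - E k *\<^sub>R (IV k t ** W t ** iv t)" by (simp add: algebra_simps)
    then have "IV k t \<bullet> P t = iv t \<bullet> P t - E k * ((IV k t ** W t ** iv t) \<bullet> P t)" by (metis inner_diff_left inner_scaleR_left)
    then show ?thesis by (simp add: B_def Pe_def inner_add_right algebra_simps)
  qed
  have B_eq: "integral {0..T} (\<lambda>t. IV k t \<bullet> Pe (E k) t) = integral {0..T} (\<lambda>t. iv t \<bullet> P t) + E k * integral {0..T} (B k)" for k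
  proof -
    have "integral {0..T} (\<lambda>t. IV k t \<bullet> Pe (E k) t) = integral {0..T} (\<lambda>t. iv t \<bullet> P t + E k * B k t)"
      by (rule integral_cong) (rule IV_eq)
    also have "\<dots> = integral {0..T} (\<lambda>t. iv t \<bullet> P t) + integral {0..T} (\<lambda>t. E k * B k t)"
    proof (rule integral_add)
      show "(\<lambda>t. iv t \<bullet> P t) integrable_on {0..T}"
        by (intro integrable_continuous_real continuous_intros iv_cont P_cont_T)
      show "(\<lambda>t. E k * B k t) integrable_on {0..T}" by (rule integrable_on_mult_right[OF B_int])
    qed
    finally show ?thesis by simp
  qed
  have nonneg: "0 \<le> integral {0..n} (A k) + (G (E k) - G 0) / E k + integral {0..T} (B k)" for k
  proof -
    have c1: "2 * J (E k) = integral {0..n} (\<lambda>t. x t * (He (E k) t \<bullet> Pe (E k) t)) + G (E k) + integral {0..T} (\<lambda>t. IV k t \<bullet> Pe (E k) t)"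
    proof -
      have "integral {0..T} (\<lambda>t. matrix_inv (integral {t..n} (\<lambda>s. x s *\<^sub>R Pe (E k) s)) \<bullet> Pe (E k) t) = integral {0..T} (\<lambda>t. IV k t \<bullet> Pe (E k) t)"
        by (rule integral_cong) (use he T_sub in \<open>simp add: IV_def\<close>)
      moreover have "Fe (E k) n - Fe (E k) T = Q - \<Phi> T - E k *\<^sub>R \<Psi> T" by (simp add: Fe_def \<Psi>n Phi_n algebra_simps)
      ultimately show ?thesis unfolding J_def cs_form_def n_eq[symmetric] by (simp add: He_def G_def)
    qed
    have c2: "2 * cs_form \<beta> h x T \<Phi> P = integral {0..n} (\<lambda>t. x t * (H t \<bullet> P t)) + G 0 + integral {0..T} (\<lambda>t. iv t \<bullet> P t)"
      unfolding cs_form_def n_eq[symmetric] by (simp add: H_def G_def Phi_n iv_def hat_def)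
    have "0 \<le> 2 * J (E k) - 2 * cs_form \<beta> h x T \<Phi> P" using le[OF E] by simp
    also have "\<dots> = E k * (integral {0..n} (A k) + (G (E k) - G 0) / E k + integral {0..T} (B k))"
      unfolding c1 c2 A_eq B_eq using E(1)[of k] by (simp add: field_simps)
    finally show ?thesis using E(1)[of k] by (simp add: zero_le_mult_iff)
  qed
  have A_lim: "(\<lambda>k. integral {0..n} (A k)) \<longlonglongrightarrow> integral {0..n} (\<lambda>t. x t * (hadamard (xi2 \<beta> (\<Phi> t)) (\<Psi> t) \<bullet> P t + H t \<bullet> R t))"
  proof -
    obtain Cx where Cx: "0 \<le> Cx" "\<And>A B. (\<And>i j. \<bar>A $ i $ j\<bar> \<le> 1) \<Longrightarrow> (\<And>i j. \<bar>B $ i $ j\<bar> \<le> 1) \<Longrightarrow> norm (xi' \<beta> A - xi' \<beta> B) \<le> Cx * norm (A - B)"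
      using xi'_lipschitz[of \<beta>, OF beta_summable] by blast
    \<comment> \<open>The perturbed path satisfies the same entry bounds, being a monotone path from
      0 to \<open>Q\<close>, so the Lipschitz estimate for \<xi>' applies to both arguments.\<close>
    have qb: "norm (q k t) \<le> Cx * CY" if t: "t \<in> {0..n}" for k t
    proof -
      have "norm (He (E k) t - H t) \<le> Cx * norm (Fe (E k) t - \<Phi> t)"
        using Cx(2)[of "Fe (E k) t" "\<Phi> t"] cs_path.Phi_entry[OF inst[OF E] t] Phi_entry[OF t] by (simp add: He_def H_def)
      also have "\<dots> = Cx * (E k * norm (\<Psi> t))" using E(1)[of k] by (simp add: Fe_def)
      also have "\<dots> \<le> Cx * (E k * CY)" using CY(2)[OF t] Cx E(1)[of k] by (intro mult_left_mono) auto
      finally have "norm (He (E k) t - H t) / E k \<le> Cx * (E k * CY) / E k" using E(1)[of k] by (intro divide_right_mono) auto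
      moreover have "norm (q k t) = norm (He (E k) t - H t) / E k" using E(1)[of k] by (simp add: q_def)
      ultimately show ?thesis using E(1)[of k] by simp
    qed
    have Pb: "norm (Pe (E k) t) \<le> CP + e1 * CR" if t: "t \<in> {0..n}" for k t
    proof -
      have "norm (Pe (E k) t) \<le> norm (P t) + E k * norm (R t)"
        unfolding Pe_def using norm_triangle_ineq[of "P t" "E k *\<^sub>R R t"] E(1)[of k] by simp
      also have "\<dots> \<le> CP + e1 * CR" using CP(2)[OF t] CR(2)[OF t] E[of k] by (intro add_mono mult_mono) auto
      finally show ?thesis .
    qed
    show ?thesis
    proof (rule dominated_convergence(2)[where h="\<lambda>_. Cx * CY * (CP + e1 * CR) + CH * CR"])
      fix k t assume t: "t \<in> {0..n}"
      have "\<bar>q k t \<bullet> Pe (E k) t + H t \<bullet> R t\<bar> \<le> norm (q k t) * norm (Pe (E k) t) + norm (H t) * norm (R t)"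
        by (rule order_trans[OF abs_triangle_ineq]) (intro add_mono Cauchy_Schwarz_ineq2)
      also have "\<dots> \<le> Cx * CY * (CP + e1 * CR) + CH * CR"
        using qb[OF t] Pb[OF t] CH(2)[OF t] CR(2)[OF t] CH(1) Cx(1) CY(1) by (intro add_mono mult_mono) auto
      finally have b: "\<bar>q k t \<bullet> Pe (E k) t + H t \<bullet> R t\<bar> \<le> Cx * CY * (CP + e1 * CR) + CH * CR" .
      have "\<bar>x t\<bar> * \<bar>q k t \<bullet> Pe (E k) t + H t \<bullet> R t\<bar> \<le> 1 * (Cx * CY * (CP + e1 * CR) + CH * CR)"
        using b x_range[OF t] by (intro mult_mono) auto
      then show "norm (A k t) \<le> Cx * CY * (CP + e1 * CR) + CH * CR" by (simp add: A_def abs_mult)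
    next
      fix t assume t: "t \<in> {0..n}"
      have "(\<lambda>k. q k t) \<longlonglongrightarrow> hadamard (xi2 \<beta> (\<Phi> t)) (\<Psi> t)"
      proof (rule vec_tendstoI, rule vec_tendstoI)
        fix i j
        let ?a = "\<Phi> t $ i $ j" and ?b = "\<Psi> t $ i $ j"
        have a: "\<bar>?a + 0 * ?b\<bar> < 2" using Phi_entry[OF t, of i j] by simp
        have "((\<lambda>e. ?a + e * ?b) has_real_derivative ?b) (at 0)"
          by (rule derivative_eq_intros refl | simp)+
        from DERIV_chain2[OF xi_entry_derivs(1)[OF beta_summable a] this]
        have "((\<lambda>e. (xi_entry \<beta> i j (?a + e * ?b) - xi_entry \<beta> i j ?a) / e) \<longlongrightarrow> deriv (xi_entry \<beta> i j) ?a * ?b) (at 0)"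
          by (simp add: has_field_derivative_iff)
        from filterlim_compose[OF this Eat]
        show "(\<lambda>k. q k t $ i $ j) \<longlonglongrightarrow> hadamard (xi2 \<beta> (\<Phi> t)) (\<Psi> t) $ i $ j"
          by (simp add: q_def He_def H_def Fe_def xi'_entry hadamard_def xi2_def)
      qed
      moreover have "(\<lambda>k. Pe (E k) t) \<longlonglongrightarrow> P t + 0 *\<^sub>R R t" unfolding Pe_def by (intro tendsto_intros Elim)
      ultimately show "(\<lambda>k. A k t) \<longlonglongrightarrow> x t * (hadamard (xi2 \<beta> (\<Phi> t)) (\<Psi> t) \<bullet> P t + H t \<bullet> R t)"
        unfolding A_def by (intro tendsto_intros) simp_all
    qed (use A_int in auto)
  qed
  have G_lim: "(\<lambda>k. (G (E k) - G 0) / E k) \<longlonglongrightarrow> - (iv T \<bullet> \<Psi> T)"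
  proof -
    have TT: "T \<in> {0..T}" using T_range by simp
    have "((\<lambda>e. Q - \<Phi> T - e *\<^sub>R \<Psi> T) has_vector_derivative 0 - \<Psi> T) (at 0)"
      by (intro has_vector_derivative_diff has_vector_derivative_const)
         (use has_vector_derivative_scaleR[OF DERIV_ident has_vector_derivative_const[of "\<Psi> T"]] in simp)
    from det_has_vector_derivative[OF this] det_gap
    have "((\<lambda>e. det (Q - \<Phi> T - e *\<^sub>R \<Psi> T)) has_real_derivative det (Q - \<Phi> T) * trace (matrix_inv (Q - \<Phi> T) ** - \<Psi> T)) (at 0)"
      by simp
    from DERIV_ln[THEN DERIV_chain2, OF _ this] det_gap
    have "(G has_real_derivative inverse (det (Q - \<Phi> T)) * (det (Q - \<Phi> T) * trace (matrix_inv (Q - \<Phi> T) ** - \<Psi> T))) (at 0)"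
      by (simp add: G_def[abs_def])
    moreover have "inverse (det (Q - \<Phi> T)) * (det (Q - \<Phi> T) * trace (matrix_inv (Q - \<Phi> T) ** - \<Psi> T)) = - (iv T \<bullet> \<Psi> T)"
      using det_gap inner_sym_trace[OF iv_sym[OF TT]]
      by (simp add: iv_def hT mat_algebra linear_neg[OF linear_trace])
    ultimately have "((\<lambda>e. (G e - G 0) / e) \<longlongrightarrow> - (iv T \<bullet> \<Psi> T)) (at 0)"
      by (simp add: has_field_derivative_iff)
    from filterlim_compose[OF this Eat] show ?thesis .
  qed
  have B_lim: "(\<lambda>k. integral {0..T} (B k)) \<longlonglongrightarrow> integral {0..T} (\<lambda>t. iv t \<bullet> R t - (iv t ** W t ** iv t) \<bullet> P t)"
  proof -
    have c: "continuous_on {0..T} (\<lambda>t. P t ** transpose (W t ** iv t))"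
      by (intro matmul.continuous_on P_cont_T bounded_linear.continuous_on[OF bounded_linear_transpose] WcT iv_cont)
    obtain CW where CW: "0 \<le> CW" "\<And>t. t \<in> {0..T} \<Longrightarrow> norm (P t ** transpose (W t ** iv t)) \<le> CW"
      using bounded_on_Icc[OF c] by blast
    define CI where "CI = real CARD('a) * (real CARD('a) * (1 / (c0 / 2)))"
    have CI: "norm (IV k t) \<le> CI" if "t \<in> {0..T}" for k t
      unfolding IV_def CI_def using pdh[OF E that] c0 by (intro norm_matrix_inv_le) auto
    have CI0: "0 \<le> CI" using c0 by (simp add: CI_def)
    show ?thesis
    proof (rule dominated_convergence(2)[where h="\<lambda>_. CI * CR + CI * CW"])
      fix k t assume t: "t \<in> {0..T}"
      have "(IV k t ** W t ** iv t) \<bullet> P t = IV k t \<bullet> (P t ** transpose (W t ** iv t))"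
        by (simp add: inner_mul_right flip: matrix_mul_assoc)
      then have "norm (B k t) \<le> norm (IV k t) * norm (R t) + norm (IV k t) * norm (P t ** transpose (W t ** iv t))"
        unfolding B_def real_norm_def
        by (simp only:) (rule order_trans[OF abs_triangle_ineq4], intro add_mono Cauchy_Schwarz_ineq2)
      also have "\<dots> \<le> CI * CR + CI * CW"
        using CI[OF t] CR(2)[OF T_sub[OF t]] CW(2)[OF t] CI0 by (intro add_mono mult_mono) auto
      finally show "norm (B k t) \<le> CI * CR + CI * CW" .
    next
      fix t assume t: "t \<in> {0..T}"
      have "(\<lambda>k. he (E k) t) \<longlonglongrightarrow> hat t + 0 *\<^sub>R W t" unfolding he_def by (intro tendsto_intros Elim)
      then have l: "(\<lambda>k. he (E k) t) \<longlonglongrightarrow> hat t" by simp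
      have "pos_def (c0 / 2) (hat t)" by (rule pos_def_weaken[OF c0(2)[OF t]]) (use c0(1) in simp)
      then have "(\<lambda>k. IV k t) \<longlonglongrightarrow> iv t"
        unfolding IV_def iv_def using c0 pdh[OF E t] l by (intro matrix_inv_tendsto[of "c0 / 2"]) auto
      then show "(\<lambda>k. B k t) \<longlonglongrightarrow> iv t \<bullet> R t - (iv t ** W t ** iv t) \<bullet> P t"
        unfolding B_def by (intro tendsto_intros matmul.tendsto)
    qed (use B_int in auto)
  qed
  have "0 \<le> integral {0..n} (\<lambda>t. x t * (hadamard (xi2 \<beta> (\<Phi> t)) (\<Psi> t) \<bullet> P t + H t \<bullet> R t)) + - (iv T \<bullet> \<Psi> T)
     + integral {0..T} (\<lambda>t. iv t \<bullet> R t - (iv t ** W t ** iv t) \<bullet> P t)"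
    by (rule LIMSEQ_le_const[OF tendsto_add[OF tendsto_add[OF A_lim G_lim] B_lim]]) (use nonneg in blast)
  then show ?thesis
    using variation_identity[OF Rc R0 \<Psi>_def W_def] by simp
qed

end

subsection \<open>Complementary slackness\<close>

lemma (in bounded_bilinear) lipschitz_on_prod:
  fixes f :: "real \<Rightarrow> 'a" and g :: "real \<Rightarrow> 'b"
  assumes f: "A-lipschitz_on {a..b} f" and g: "B-lipschitz_on {a..b} g"
  shows "\<exists>C. C-lipschitz_on {a..b} (\<lambda>t. prod (f t) (g t))"
proof -
  obtain p where p: "0 \<le> p" "\<forall>t\<in>{a..b}. norm (f t) \<le> p" using bounded_on_Icc[OF lipschitz_on_continuous_on[OF f]] by blast
  obtain q where q: "0 \<le> q" "\<forall>t\<in>{a..b}. norm (g t) \<le> q" using bounded_on_Icc[OF lipschitz_on_continuous_on[OF g]] by blast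
  obtain k where k: "0 \<le> k" "\<And>a b. norm (prod a b) \<le> norm a * norm b * k" using nonneg_bounded by auto
  have AB: "0 \<le> A" "0 \<le> B" using f g lipschitz_on_nonneg by auto
  have "((p * B + A * q) * k)-lipschitz_on {a..b} (\<lambda>t. prod (f t) (g t))"
  proof (rule lipschitz_onI)
    fix s t assume st: "s \<in> {a..b}" "t \<in> {a..b}"
    have "norm (prod (f s) (g s) - prod (f t) (g t)) \<le> norm (prod (f s) (g s - g t)) + norm (prod (f s - f t) (g t))"
      by (rule order_trans[OF _ norm_triangle_ineq]) (simp add: diff_left diff_right)
    also have "\<dots> \<le> norm (f s) * norm (g s - g t) * k + norm (f s - f t) * norm (g t) * k"
      by (intro add_mono k)
    also have "\<dots> \<le> p * (B * dist s t) * k + (A * dist s t) * q * k"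
      using lipschitz_onD[OF f st] lipschitz_onD[OF g st] p q st AB k
      by (intro add_mono mult_right_mono mult_mono) (auto simp: dist_norm)
    finally show "dist (prod (f s) (g s)) (prod (f t) (g t)) \<le> (p * B + A * q) * k * dist s t" by (simp add: dist_norm algebra_simps)
  qed (use p q AB k in auto)
  then show ?thesis by blast
qed

lemmas lipschitz_on_scaleR = bounded_bilinear.lipschitz_on_prod[OF bounded_bilinear_scaleR]

text \<open>A Lipschitz bump of height \<open>d\<close> on \<open>[t, t + 2 d]\<close>. It lies to
  the right of \<open>t\<close> because \<open>K\<close> is only right-continuous.\<close>

definition tent :: "real \<Rightarrow> real \<Rightarrow> real \<Rightarrow> real" where
  "tent t d s = max 0 (d - \<bar>s - (t + d)\<bar>)"

lemma tent_nonneg: "0 \<le> tent t d s"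
  and tent_outside: "s \<le> t \<or> t + 2 * d \<le> s \<Longrightarrow> tent t d s = 0"
  by (auto simp: tent_def)

lemma tent_lipschitz: "1-lipschitz_on S (tent t d)"
  by (rule lipschitz_onI) (auto simp: tent_def dist_real_def max_def)

lemma tent_continuous: "continuous_on S (tent t d)"
  by (rule lipschitz_on_continuous_on[OF tent_lipschitz])

lemma integral_tent_pos:
  assumes "0 \<le> t" "0 < d" "t + 2 * d \<le> T" shows "0 < integral {0..T} (tent t d)"
proof -
  have 0: "0 \<le> integral {0..T} (tent t d)" by (intro integral_nonneg integrable_continuous_real tent_continuous) (simp add: tent_nonneg)
  have "integral {0..T} (tent t d) \<noteq> 0"
  proof
    assume "integral {0..T} (tent t d) = 0"
    then have "(tent t d has_integral 0) (cbox 0 T)"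
      using integrable_integral[OF integrable_continuous_real[OF tent_continuous[of "{0..T}" t d]]] by simp
    then have "tent t d (t + d) = 0"
      by (rule has_integral_0_cbox_imp_0[rotated 2]) (use assms tent_continuous tent_nonneg in auto)
    then show False using assms by (simp add: tent_def)
  qed
  then show ?thesis using 0 by simp
qed

text \<open>A negative right limit would make \<open>k\<close> negative on the whole carrier of a
  sufficiently narrow tent, contradicting the nonnegative integral.\<close>

lemma tent_test:
  fixes k :: "real \<Rightarrow> real"
  assumes t: "0 \<le> t" "t < T" and lim: "(k \<longlongrightarrow> l) (at_right t)"
    and int: "\<And>d. 0 < d \<Longrightarrow> t + 2 * d < T \<Longrightarrow> (\<lambda>s. tent t d s * k s) integrable_on {0..T}"
    and nonneg: "\<And>d. 0 < d \<Longrightarrow> t + 2 * d < T \<Longrightarrow> 0 \<le> integral {0..T} (\<lambda>s. tent t d s * k s)"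
  shows "0 \<le> l"
proof (rule ccontr)
  assume l: "\<not> 0 \<le> l"
  then have "eventually (\<lambda>s. k s < l / 2) (at_right t)" by (intro order_tendstoD(2)[OF lim]) auto
  then obtain b where b: "t < b" "\<And>s. t < s \<Longrightarrow> s < b \<Longrightarrow> k s < l / 2" by (auto simp: eventually_at_right_field)
  define d where "d = (min b T - t) / 4"
  have d: "0 < d" "t + 2 * d < T" "t + 2 * d < b" using b t by (auto simp: d_def min_def field_simps)
  have "0 \<le> integral {0..T} (\<lambda>s. tent t d s * k s)" by (rule nonneg[OF d(1,2)])
  also have "\<dots> \<le> integral {0..T} (\<lambda>s. tent t d s * (l / 2))"
  proof (rule integral_le[OF int[OF d(1,2)]])
    show "(\<lambda>s. tent t d s * (l / 2)) integrable_on {0..T}"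
      by (intro integrable_continuous_real continuous_intros tent_continuous)
    fix s
    show "tent t d s * k s \<le> tent t d s * (l / 2)"
    proof (cases "t < s \<and> s < t + 2 * d")
      case True
      then show ?thesis using b(2)[of s] d by (intro mult_left_mono tent_nonneg) auto
    next
      case False
      then have "tent t d s = 0" by (intro tent_outside) auto
      then show ?thesis by simp
    qed
  qed
  also have "\<dots> = integral {0..T} (tent t d) * (l / 2)" by simp
  also have "\<dots> < 0" using integral_tent_pos[of t d T] d t l by (intro mult_pos_neg) auto
  finally show False by simp
qed

section \<open>Symmetry and right continuity of \<open>K\<close>\<close>

context cs_path begin

lemma H_sym: "t \<in> {0..n} \<Longrightarrow> transpose (H t) = H t"
proof -
  assume t: "t \<in> {0..n}"
  have "\<Phi> t $ i $ j = \<Phi> t $ j $ i" for i j using psd_sym[OF Phi_psd[OF t]] by (simp add: transpose_def vec_eq_iff)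
  then have "transpose (xi' \<beta> (\<Phi> t)) = xi' \<beta> (\<Phi> t)"
    by (simp add: transpose_def vec_eq_iff xi'_entry xi_entry_sym[of \<beta>])
  then show ?thesis by (simp add: H_def transp_add)
qed

lemma ivPiv_sym: "t \<in> {0..T} \<Longrightarrow> transpose (iv t ** P t ** iv t) = iv t ** P t ** iv t"
  using iv_sym psd_sym[OF P_psd[OF T_sub]] by (simp add: matrix_transpose_mul matrix_mul_assoc)

lemma transpose_integral:
  fixes f :: "real \<Rightarrow> real^'b^'b"
  assumes "f integrable_on S" "\<And>t. t \<in> S \<Longrightarrow> transpose (f t) = f t"
  shows "transpose (integral S f) = integral S f"
proof -
  have "transpose (integral S f) = integral S (transpose \<circ> f)"
    using integral_linear[OF assms(1) bounded_linear_transpose] by simp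
  also have "\<dots> = integral S f" by (rule integral_cong) (simp add: assms)
  finally show ?thesis .
qed

lemma D_sym: "t \<in> {0..T} \<Longrightarrow> transpose (D t) = D t"
  unfolding D_def M_def transp_diff
  by (subst transpose_integral)
     (auto intro!: H_sym T_sub integrable_continuous_real continuous_on_subset[OF dM_cont] ivPiv_sym)

lemma dD_sym: "t \<in> {0..T} \<Longrightarrow> transpose (dD t) = dD t"
  unfolding dD_def transp_diff transpose_hadamard
  by (simp only: ivPiv_sym transpose_xi2[OF T_sub] psd_sym[OF P_psd[OF T_sub]])

lemma K_sym: assumes t: "t \<in> {0..T}" shows "transpose (K t) = K t"
proof -
  have "transpose (N t) = N t" unfolding N_def
    by (rule transpose_integral)
       (use t T_range in \<open>auto intro!: y_scaleR_integrable continuous_on_subset[OF dD_cont] simp: transp_scaleR dD_sym\<close>)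
  then show ?thesis using D_sym[OF t]
    by (simp add: K_def transp_add transp_diff transp_scaleR linear_neg[OF linear_transpose])
qed

lemma K_integrable:
  assumes f: "continuous_on {0..T} f" shows "(\<lambda>t. K t \<bullet> f t) integrable_on {0..T}"
proof -
  have "(\<lambda>t. - ((1 - x t) *\<^sub>R (D t \<bullet> f t)) - N t \<bullet> f t) integrable_on {0..T}"
    using T_range
    by (intro integrable_diff integrable_neg y_scaleR_integrable integrable_continuous_real continuous_intros D_cont N_cont f) auto
  then show ?thesis by (simp add: K_def inner_add_left algebra_simps)
qed

lemma at_right_lim: "continuous_on {0..T} f \<Longrightarrow> 0 \<le> t \<Longrightarrow> t < T \<Longrightarrow> (f \<longlongrightarrow> f t) (at_right t)"
proof -
  assume f: "continuous_on {0..T} f" and t: "0 \<le> t" "t < T"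
  have "(f \<longlongrightarrow> f t) (at t within {0..T})" using f t by (auto simp: continuous_on_def)
  then have "(f \<longlongrightarrow> f t) (at t within {t..T})" by (rule tendsto_within_subset) (use t in auto)
  then show ?thesis using at_within_Icc_at_right[of t T] t by simp
qed

lemma K_right: assumes t: "0 \<le> t" "t < T" shows "(K \<longlongrightarrow> K t) (at_right t)"
proof -
  have "(x \<longlongrightarrow> x t) (at_right t)" using x_right[of t] t T_range by auto
  then show ?thesis unfolding K_def
    by (intro tendsto_intros at_right_lim[OF D_cont t] at_right_lim[OF N_cont t])
qed

text \<open>Only the value of the path at \<open>T\<close> matters beyond \<open>T\<close>, and its increment there is positive
  definite; so any excess picked up before \<open>T\<close> can be compensated after \<open>T\<close>.\<close>
lemma weighted_tail_pos_def:
  "\<exists>c>0. pos_def c (integral {0..n} (\<lambda>t. max 0 (t - T) *\<^sub>R P t))"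
proof -
  let ?S = "integral {0..n} (\<lambda>t. max 0 (t - T) *\<^sub>R P t)"
  have cont: "continuous_on {0..n} (\<lambda>t. max 0 (t - T) *\<^sub>R P t)" by (intro continuous_intros P_cont)
  then have int: "(\<lambda>t. max 0 (t - T) *\<^sub>R P t) integrable_on {0..n}" by (rule integrable_continuous_real)
  have psd: "psd ?S" by (rule psd_integral[OF int]) (auto intro!: psd_scaleR P_psd)
  have "v = 0" if v: "?S *v v = 0" for v
  proof -
    have bl: "bounded_linear (\<lambda>A::real^'m^'m. v \<bullet> (A *v v))"
      by (rule bounded_linear_compose[OF bounded_linear_inner_right matvec.bounded_linear_left])
    have "integral {0..n} (\<lambda>t. v \<bullet> ((max 0 (t - T) *\<^sub>R P t) *v v)) = v \<bullet> (?S *v v)"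
      using integral_linear[OF int bl] by (simp add: o_def)
    then have z: "((\<lambda>t. v \<bullet> ((max 0 (t - T) *\<^sub>R P t) *v v)) has_integral 0) (cbox 0 n)"
      using integrable_linear[OF int bl] v by (simp add: o_def has_integral_iff)
    \<comment> \<open>A continuous nonnegative integrand with integral 0 vanishes identically; its
      factor \<open>max 0 (t - T)\<close> is positive exactly beyond \<open>T\<close>. Integrating
      over \<open>{T..n}\<close> then makes \<open>v\<close> a null vector of
      \<open>Q - \<Phi> T\<close>.\<close>
    have Pv: "v \<bullet> (P t *v v) = 0" if t: "t \<in> {T<..n}" for t
    proof -
      have "v \<bullet> ((max 0 (t - T) *\<^sub>R P t) *v v) = 0"
      proof (rule has_integral_0_cbox_imp_0[OF _ _ z])
        show "continuous_on (cbox 0 n) (\<lambda>t. v \<bullet> ((max 0 (t - T) *\<^sub>R P t) *v v))"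
          using cont by (auto intro!: continuous_intros matvec.continuous_on)
        show "0 \<le> v \<bullet> ((max 0 (s - T) *\<^sub>R P s) *v v)" if "s \<in> box 0 n" for s
          using that by (intro psd_nonneg psd_scaleR P_psd) auto
        show "t \<in> cbox 0 n" using t T_range by auto
        show "box 0 n \<noteq> {}" using n_pos by simp
      qed
      then show ?thesis using t by (simp add: matvec.scaleR_left)
    qed
    have i: "(P has_integral (Q - \<Phi> T)) {T..n}" using Phi_integral[of T n] T_range by (simp add: Phi_n)
    have "((\<lambda>t. v \<bullet> (P t *v v)) has_integral v \<bullet> ((Q - \<Phi> T) *v v)) {T..n}"
      using has_integral_linear[OF i bl] by (simp add: o_def)
    moreover have "((\<lambda>t. v \<bullet> (P t *v v)) has_integral 0) {T..n}"
      by (rule has_integral_spike_finite[of "{T}" _ _ "\<lambda>_. 0"]) (use Pv in auto)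
    ultimately have "v \<bullet> ((Q - \<Phi> T) *v v) = 0" by (rule has_integral_unique)
    moreover obtain c where c: "0 < c" "pos_def c (Q - \<Phi> T)"
      using psd_det_pos_def[of "Q - \<Phi> T"] Phi_mono[of T n] T_range det_gap by (auto simp: Phi_n)
    ultimately have "c * (v \<bullet> v) \<le> 0" by (metis pos_def_def)
    then have "v \<bullet> v \<le> 0" using c(1) by (simp add: mult_le_0_iff)
    then show ?thesis by (metis inner_eq_zero_iff inner_ge_zero order_antisym)
  qed
  then have "det ?S \<noteq> 0" by (metis invertible_det_nz invertible_left_inverse matrix_left_invertible_ker)
  then show ?thesis using psd_det_pos_def[OF psd] by blast
qed

end

context cs_minimizer begin

text \<open>Inserting \<open>Y\<close> and removing \<open>g P\<close> changes the end value of the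
  path. The change is repaired beyond \<open>T\<close>, where the direction may be altered without
  affecting the integral over \<open>{0..T}\<close>: a large multiple of the existing increment is
  removed and a constant semidefinite matrix is put in its place.\<close>

lemma cone_variation:
  assumes Y: "LY-lipschitz_on {0..n} Y" "\<And>t. t \<in> {0..n} \<Longrightarrow> psd (Y t)"
    and g: "Lg-lipschitz_on {0..n} g" "\<And>t. t \<in> {0..n} \<Longrightarrow> 0 \<le> g t"
    and van: "\<And>t. T \<le> t \<Longrightarrow> t \<le> n \<Longrightarrow> Y t = 0" "\<And>t. T \<le> t \<Longrightarrow> t \<le> n \<Longrightarrow> g t = 0"
  shows "0 \<le> integral {0..T} (\<lambda>t. K t \<bullet> (Y t - g t *\<^sub>R P t))"
proof -
  define \<eta> where "\<eta> t = max 0 (t - T)" for t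
  obtain LP where LP: "LP-lipschitz_on {0..n} P" using P_lip by blast
  have \<eta>L: "1-lipschitz_on {0..n} \<eta>" by (rule lipschitz_onI) (auto simp: \<eta>_def dist_real_def max_def)
  have \<eta>c: "continuous_on {0..n} \<eta>" by (rule lipschitz_on_continuous_on[OF \<eta>L])
  have \<eta>0: "0 \<le> \<eta> t" for t by (simp add: \<eta>_def)
  have Yc: "continuous_on {0..n} Y" and gc: "continuous_on {0..n} g"
    by (rule lipschitz_on_continuous_on[OF Y(1)], rule lipschitz_on_continuous_on[OF g(1)])
  define S where "S = integral {0..n} (\<lambda>t. \<eta> t *\<^sub>R P t)"
  define A0 where "A0 = integral {0..n} (\<lambda>t. Y t - g t *\<^sub>R P t)"
  define I where "I = integral {0..n} \<eta>"
  have I: "0 < I"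
  proof -
    have "0 \<le> I" unfolding I_def by (intro integral_nonneg integrable_continuous_real \<eta>c \<eta>0)
    moreover have "I \<noteq> 0"
    proof
      assume "I = 0"
      then have "(\<eta> has_integral 0) (cbox 0 n)"
        using integrable_integral[OF integrable_continuous_real[OF \<eta>c]] by (simp add: I_def)
      then have "\<eta> n = 0"
        by (rule has_integral_0_cbox_imp_0[rotated 2]) (use \<eta>c \<eta>0 n_pos in auto)
      then show False using T_range by (simp add: \<eta>_def)
    qed
    ultimately show ?thesis by simp
  qed
  obtain c where c: "0 < c" "pos_def c S" using weighted_tail_pos_def by (auto simp: S_def \<eta>_def)
  have int1: "(\<lambda>t. Y t - g t *\<^sub>R P t) integrable_on {0..n}" by (intro integrable_continuous_real continuous_intros Yc gc P_cont)
  have int2: "(\<lambda>t. \<eta> t *\<^sub>R P t) integrable_on {0..n}" by (intro integrable_continuous_real continuous_intros \<eta>c P_cont)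
  have "transpose (- A0) = - A0"
  proof -
    have "transpose A0 = A0" unfolding A0_def
      by (rule transpose_integral[OF int1]) (simp add: transp_diff transp_scaleR psd_sym Y(2) P_psd)
    then show ?thesis by (simp add: linear_neg[OF linear_transpose])
  qed
  from pos_def_perturb[OF c(2,1) this] obtain d where d: "0 < d" "pos_def (c / 2) (S + d *\<^sub>R (- A0))" by force
  define c1 where "c1 = 1 / d"
  have c1: "0 < c1" using d by (simp add: c1_def)
  \<comment> \<open>The unique constant for which the repaired direction has integral 0. It is
    semidefinite because \<open>c1 = 1 / d\<close> is large enough for \<open>c1\<close> times the
    positive definite \<open>S\<close> to dominate \<open>A0\<close>.\<close>
  define Z where "Z = (1 / I) *\<^sub>R (c1 *\<^sub>R S - A0)"
  have Z: "psd Z"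
  proof -
    have "c1 *\<^sub>R S - A0 = c1 *\<^sub>R (S + d *\<^sub>R (- A0))" using d by (simp add: c1_def scaleR_diff_right)
    then show ?thesis unfolding Z_def using d c1 I by (auto intro!: psd_scaleR simp: pos_def_def)
  qed
  define R where "R t = Y t - g t *\<^sub>R P t + \<eta> t *\<^sub>R (Z - c1 *\<^sub>R P t)" for t
  have "\<exists>L. L-lipschitz_on {0..n} R"
  proof -
    obtain L1 where L1: "L1-lipschitz_on {0..n} (\<lambda>t. g t *\<^sub>R P t)" using lipschitz_on_scaleR[OF g(1) LP] by blast
    have zl: "(0 + \<bar>c1\<bar> * LP)-lipschitz_on {0..n} (\<lambda>t. Z - c1 *\<^sub>R P t)"
      by (intro lipschitz_on_diff lipschitz_on_constant lipschitz_on_cmult LP)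
    obtain L2 where L2: "L2-lipschitz_on {0..n} (\<lambda>t. \<eta> t *\<^sub>R (Z - c1 *\<^sub>R P t))" using lipschitz_on_scaleR[OF \<eta>L zl] by blast
    show ?thesis unfolding R_def[abs_def] using lipschitz_on_add[OF lipschitz_on_diff[OF Y(1) L1] L2] by blast
  qed
  then obtain LR where LR: "LR-lipschitz_on {0..n} R" by blast
  have R0: "(R has_integral 0) {0..n}"
  proof -
    have 1: "((\<lambda>t. Y t - g t *\<^sub>R P t) has_integral A0) {0..n}" unfolding A0_def by (rule integrable_integral[OF int1])
    have 2: "((\<lambda>t. \<eta> t *\<^sub>R Z) has_integral I *\<^sub>R Z) {0..n}"
      unfolding I_def by (intro has_integral_scaleR_left integrable_integral integrable_continuous_real \<eta>c)
    have 3: "((\<lambda>t. c1 *\<^sub>R (\<eta> t *\<^sub>R P t)) has_integral c1 *\<^sub>R S) {0..n}"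
      unfolding S_def by (intro has_integral_cmul integrable_integral int2)
    have "((\<lambda>t. (Y t - g t *\<^sub>R P t) + (\<eta> t *\<^sub>R Z - c1 *\<^sub>R (\<eta> t *\<^sub>R P t))) has_integral A0 + (I *\<^sub>R Z - c1 *\<^sub>R S)) {0..n}"
      by (intro has_integral_add has_integral_diff 1 2 3)
    moreover have "A0 + (I *\<^sub>R Z - c1 *\<^sub>R S) = 0" using I by (simp add: Z_def)
    ultimately show ?thesis by (simp add: R_def[abs_def] scaleR_diff_right mult.commute)
  qed
  obtain Cg where Cg: "0 \<le> Cg" "\<forall>t\<in>{0..n}. norm (g t) \<le> Cg" using bounded_on_Icc[OF gc] by blast
  \<comment> \<open>Everything subtracted is a multiple of \<open>P\<close>, with coefficient at
    most \<open>Cg + c1 * n\<close>; for \<open>e \<le> e0\<close> less than the full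
    \<open>P\<close> is removed.\<close>
  define e0 where "e0 = 1 / (Cg + c1 * n + 1)"
  have den: "0 < Cg + c1 * n + 1" using Cg c1 n_pos by (simp add: add_nonneg_pos)
  have e0: "0 < e0" using den by (simp add: e0_def)
  have psdR: "psd (P t + e *\<^sub>R R t)" if e: "0 \<le> e" "e \<le> e0" and t: "t \<in> {0..n}" for e t
  proof -
    have "\<eta> t \<le> n" using t T_range by (simp add: \<eta>_def)
    moreover have "g t \<le> Cg" using bspec[OF Cg(2) t] by simp
    ultimately have "g t + c1 * \<eta> t \<le> Cg + c1 * n" using c1 by (intro add_mono mult_left_mono) auto
    then have "e * (g t + c1 * \<eta> t) \<le> e0 * (Cg + c1 * n + 1)"
      using e e0 g(2)[OF t] \<eta>0[of t] c1 by (intro mult_mono) auto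
    also have "\<dots> = 1" using den by (simp add: e0_def)
    finally have "0 \<le> 1 - e * (g t + c1 * \<eta> t)" by simp
    then have "psd ((1 - e * (g t + c1 * \<eta> t)) *\<^sub>R P t + e *\<^sub>R (Y t + \<eta> t *\<^sub>R Z))"
      using e by (intro psd_add psd_scaleR P_psd Y(2) Z \<eta>0 t) auto
    moreover have "(1 - e * (g t + c1 * \<eta> t)) *\<^sub>R P t + e *\<^sub>R (Y t + \<eta> t *\<^sub>R Z) = P t + e *\<^sub>R R t"
      by (simp add: R_def algebra_simps)
    ultimately show ?thesis by simp
  qed
  have "0 \<le> integral {0..T} (\<lambda>t. K t \<bullet> R t)" by (rule first_variation[OF LR R0 e0 psdR])
  also have "\<dots> = integral {0..T} (\<lambda>t. K t \<bullet> (Y t - g t *\<^sub>R P t))"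
    by (rule integral_cong) (simp add: R_def \<eta>_def)
  finally show ?thesis .
qed

text \<open>The test direction is \<open>tent t d s *\<^sub>R A\<close> with nothing removed;
  letting the tent shrink to \<open>t\<close> gives the pointwise inequality.\<close>

lemma K_inner_nonneg:
  assumes t: "0 \<le> t" "t < T" and A: "psd A" shows "0 \<le> K t \<bullet> A"
proof (rule tent_test[OF t])
  show "((\<lambda>s. K s \<bullet> A) \<longlongrightarrow> K t \<bullet> A) (at_right t)" by (intro tendsto_intros K_right t)
  fix d assume d: "0 < d" "t + 2 * d < T"
  have eq: "tent t d s * (K s \<bullet> A) = K s \<bullet> (tent t d s *\<^sub>R A - 0 *\<^sub>R P s)" for s by simp
  show "(\<lambda>s. tent t d s * (K s \<bullet> A)) integrable_on {0..T}"
    unfolding eq by (intro K_integrable continuous_intros tent_continuous P_cont_T)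
  obtain L where L: "L-lipschitz_on {0..n} (\<lambda>s. tent t d s *\<^sub>R A)"
    using lipschitz_on_scaleR[OF tent_lipschitz lipschitz_on_constant] by blast
  show "0 \<le> integral {0..T} (\<lambda>s. tent t d s * (K s \<bullet> A))"
    unfolding eq
    by (rule cone_variation[OF L _ lipschitz_on_constant])
       (use d A in \<open>auto intro!: psd_scaleR tent_nonneg simp: tent_outside\<close>)
qed

lemma K_psd: assumes t: "0 \<le> t" "t < T" shows "psd (K t)"
  unfolding psd_def
proof safe
  show "transpose (K t) = K t" using K_sym t by simp
  fix v
  show "0 \<le> v \<bullet> (K t *v v)"
    using K_inner_nonneg[OF t psd_outer[of v]] by (simp add: inner_commute[of "K t"] inner_outer)
qed

text \<open>Here nothing is inserted and a tent multiple of \<open>P\<close> is removed, which gives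
  the inequality opposite to that from semidefiniteness.\<close>

lemma K_P_zero:
  assumes t: "0 \<le> t" "t < T" shows "K t \<bullet> P t = 0"
proof -
  have tI: "t \<in> {0..n}" using t T_range by auto
  have "0 \<le> - (K t \<bullet> P t)"
  proof (rule tent_test[OF t])
    show "((\<lambda>s. - (K s \<bullet> P s)) \<longlongrightarrow> - (K t \<bullet> P t)) (at_right t)"
      by (intro tendsto_intros K_right t at_right_lim[OF P_cont_T t])
    fix d assume d: "0 < d" "t + 2 * d < T"
    have eq: "tent t d s * - (K s \<bullet> P s) = K s \<bullet> (0 - tent t d s *\<^sub>R P s)" for s by simp
    show "(\<lambda>s. tent t d s * - (K s \<bullet> P s)) integrable_on {0..T}"
      unfolding eq by (intro K_integrable continuous_intros tent_continuous P_cont_T)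
    show "0 \<le> integral {0..T} (\<lambda>s. tent t d s * - (K s \<bullet> P s))"
      unfolding eq
      by (rule cone_variation[OF lipschitz_on_constant _ tent_lipschitz])
         (use d in \<open>auto intro!: tent_nonneg simp: tent_outside\<close>)
  qed
  then show ?thesis using psd_inner_nonneg[OF K_psd[OF t] P_psd[OF tI]] by simp
qed

end

subsection \<open>Excluding a jump\<close>

lemma psd_matrix_inv:
  assumes "psd A" "det (A::real^'m^'m) \<noteq> 0" shows "psd (matrix_inv A)"
  unfolding psd_def
proof safe
  show "transpose (matrix_inv A) = matrix_inv A" by (rule matrix_inv_sym[OF psd_sym[OF assms(1)] assms(2)])
  fix v
  have "v = A *v (matrix_inv A *v v)" by (simp add: matrix_vector_mul_assoc matrix_inv_mult[OF assms(2)])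
  then have "v \<bullet> (matrix_inv A *v v) = (matrix_inv A *v v) \<bullet> (A *v (matrix_inv A *v v))" by (metis inner_commute)
  then show "0 \<le> v \<bullet> (matrix_inv A *v v)" using psd_nonneg[OF assms(1)] by simp
qed

lemma psd_congruence_zero:
  fixes A B :: "real^'m^'m"
  assumes A: "psd A" and z: "B ** A ** transpose B = 0" shows "A ** transpose B = 0"
proof -
  have "A *v (transpose B *v v) = 0" for v
  proof (rule psd_null_vector[OF A])
    have "(transpose B *v v) \<bullet> (A *v (transpose B *v v)) = v \<bullet> (B ** A ** transpose B *v v)"
      by (metis dot_lmul_matrix matrix_vector_mul_assoc transpose_matrix_vector transpose_transpose)
    then show "(transpose B *v v) \<bullet> (A *v (transpose B *v v)) = 0" by (simp add: z matvec.zero_left)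
  qed
  then show ?thesis unfolding matrix_eq by (simp only: matrix_vector_mul_assoc[symmetric] matvec.zero_left) simp
qed

text \<open>The second factor is semidefinite. If the inner product vanished, so would
  \<open>V R V R V\<close>; reading this as a congruence first of \<open>V\<close> and then of
  \<open>R\<close> strips the outer factors until \<open>R V = 0\<close>, and \<open>R\<close> is
  invertible.\<close>

lemma cubic_trace_pos:
  fixes V R :: "real^'m^'m"
  assumes V: "psd V" "V \<noteq> 0" and R: "psd R" and AR: "R ** A = mat 1"
  shows "0 < V \<bullet> (R ** V ** R ** V ** R)"
proof -
  have sV: "transpose V = V" and sR: "transpose R = R" using V R by (auto intro: psd_sym)
  have psd: "psd (R ** V ** R ** V ** R)"
    using psd_congruence[OF R, of "R ** V"] by (simp add: matrix_transpose_mul sV sR matrix_mul_assoc)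
  have "V \<bullet> (R ** V ** R ** V ** R) \<noteq> 0"
  proof
    assume "V \<bullet> (R ** V ** R ** V ** R) = 0"
    then have "V ** (R ** V ** R ** V ** R) = 0" by (rule psd_inner_zero'[OF V(1) psd])
    then have "V ** (R ** V ** R ** V ** R) ** A = 0 ** A" by simp
    then have "V ** R ** V ** R ** V ** (R ** A) = 0" by (simp add: matrix_mul_assoc matmul.zero_left)
    then have "(V ** R) ** V ** transpose (V ** R) = 0" by (simp add: AR matrix_transpose_mul sV sR matrix_mul_assoc)
    from psd_congruence_zero[OF V(1) this] have "V ** R ** transpose V = 0" by (simp add: matrix_transpose_mul sV sR matrix_mul_assoc)
    from psd_congruence_zero[OF R this] have "R ** V = 0" by (simp add: sV)
    moreover have "A ** R = mat 1" using AR matrix_left_right_inverse by blast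
    ultimately have "V = 0" by (metis matmul.zero_right matrix_mul_assoc matrix_mul_lid)
    then show False using V by simp
  qed
  then show ?thesis using psd_inner_nonneg[OF V(1) psd] by simp
qed

context cs_path begin

lemma iv_lipschitz: "\<exists>L. L-lipschitz_on {0..T} iv"
proof -
  obtain c where c: "0 < c" "\<And>s. s \<in> {0..T} \<Longrightarrow> pos_def c (hat s)" using hat_pos_def_T by blast
  obtain C where C: "0 \<le> C" "\<And>A B. pos_def c A \<Longrightarrow> pos_def c B \<Longrightarrow> norm (matrix_inv A - matrix_inv (B::real^'m^'m)) \<le> C * norm (A - B)"
    using matrix_inv_lipschitz[OF c(1)] by blast
  obtain L where L: "0 \<le> L" "\<forall>s\<in>{0..n}. \<forall>t\<in>{0..n}. norm (hat s - hat t) \<le> L * \<bar>s - t\<bar>" using hat_lipschitz by blast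
  have "(C * L)-lipschitz_on {0..T} iv"
  proof (rule lipschitz_onI)
    fix s t assume st: "s \<in> {0..T}" "t \<in> {0..T}"
    have "norm (iv s - iv t) \<le> C * norm (hat s - hat t)" unfolding iv_def by (rule C(2)[OF c(2)[OF st(1)] c(2)[OF st(2)]])
    also have "\<dots> \<le> C * (L * \<bar>s - t\<bar>)" using L T_sub[OF st(1)] T_sub[OF st(2)] C(1) by (intro mult_left_mono) auto
    finally show "dist (iv s) (iv t) \<le> C * L * dist s t" by (simp add: dist_norm mult_ac)
  qed (use C L in auto)
  then show ?thesis by blast
qed

text \<open>Only increments from the fixed point \<open>u\<close> are needed, so differentiability
  of the \<xi>'' factor at \<open>u\<close> is enough; the other factors are Lipschitz.\<close>

lemma dD_pointwise_lipschitz: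
  assumes u: "u \<in> {0..T}"
  shows "\<exists>d>0. \<exists>C. \<forall>t\<in>{0..T}. \<bar>t - u\<bar> < d \<longrightarrow> norm (dD t - dD u) \<le> C * \<bar>t - u\<bar>"
proof -
  obtain LP where LP: "LP-lipschitz_on {0..n} P" using P_lip by blast
  have LPT: "LP-lipschitz_on {0..T} P" by (rule lipschitz_on_subset[OF LP]) (use T_range in auto)
  obtain Li where Li: "Li-lipschitz_on {0..T} iv" using iv_lipschitz by blast
  obtain L1 where L1: "L1-lipschitz_on {0..T} (\<lambda>t. iv t ** P t)" using matmul.lipschitz_on_prod[OF Li LPT] by blast
  obtain L2 where L2: "L2-lipschitz_on {0..T} (\<lambda>t. iv t ** P t ** iv t)" using matmul.lipschitz_on_prod[OF L1 Li] by blast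
  obtain CP where CP: "0 \<le> CP" "\<And>t. t \<in> {0..n} \<Longrightarrow> norm (P t) \<le> CP" using P_bounded by blast
  have "\<exists>k\<ge>0. \<forall>(A::real^'m^'m) B. norm (hadamard A B) \<le> norm A * norm B * k" by (rule hadamard.nonneg_bounded)
  then obtain k where k: "0 \<le> k" "\<And>(A::real^'m^'m) B. norm (hadamard A B) \<le> norm A * norm B * k" by blast
  let ?X = "\<lambda>t. xi2 \<beta> (\<Phi> t)"
  obtain D2 where D2: "(?X has_vector_derivative D2) (at u within {0..n})" using xi2_deriv[OF T_sub[OF u]] by blast
  then have "((\<lambda>s. norm ((1 / (s - u)) *\<^sub>R (?X s - ?X u))) \<longlongrightarrow> norm D2) (at u within {0..n})"
    unfolding has_vector_derivative_iff_quotient by (rule tendsto_norm)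
  from order_tendstoD(2)[OF this, of "norm D2 + 1"]
  have "\<forall>\<^sub>F s in at u within {0..n}. norm ((1 / (s - u)) *\<^sub>R (?X s - ?X u)) < norm D2 + 1" by simp
  then obtain d where d: "0 < d" "\<And>s. s \<in> {0..n} \<Longrightarrow> s \<noteq> u \<Longrightarrow> dist s u < d \<Longrightarrow> norm ((1 / (s - u)) *\<^sub>R (?X s - ?X u)) < norm D2 + 1"
    by (auto simp: eventually_at)
  have X: "norm (?X s - ?X u) \<le> (norm D2 + 1) * \<bar>s - u\<bar>" if "s \<in> {0..n}" "\<bar>s - u\<bar> < d" for s
  proof (cases "s = u")
    case False
    have "norm (?X s - ?X u) / \<bar>s - u\<bar> < norm D2 + 1" using d(2)[of s] that False by (simp add: dist_real_def divide_inverse mult.commute)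
    then show ?thesis using False by (simp add: field_simps)
  qed simp
  have "norm (dD t - dD u) \<le> ((norm D2 + 1) * CP * k + norm (?X u) * LP * k + L2) * \<bar>t - u\<bar>"
    if t: "t \<in> {0..T}" "\<bar>t - u\<bar> < d" for t
  proof -
    have e: "dD t - dD u = hadamard (?X t - ?X u) (P t) + hadamard (?X u) (P t - P u) - (iv t ** P t ** iv t - iv u ** P u ** iv u)"
      by (simp add: dD_def hadamard.diff_left hadamard.diff_right)
    have "norm (dD t - dD u) \<le> norm (hadamard (?X t - ?X u) (P t)) + norm (hadamard (?X u) (P t - P u)) + norm (iv t ** P t ** iv t - iv u ** P u ** iv u)"
      unfolding e using norm_triangle_ineq4[of "hadamard (?X t - ?X u) (P t) + hadamard (?X u) (P t - P u)" "iv t ** P t ** iv t - iv u ** P u ** iv u"]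
        norm_triangle_ineq[of "hadamard (?X t - ?X u) (P t)" "hadamard (?X u) (P t - P u)"] by linarith
    also have "\<dots> \<le> norm (?X t - ?X u) * norm (P t) * k + norm (?X u) * norm (P t - P u) * k + norm (iv t ** P t ** iv t - iv u ** P u ** iv u)"
      by (intro add_mono k order_refl)
    also have "\<dots> \<le> ((norm D2 + 1) * \<bar>t - u\<bar>) * CP * k + norm (?X u) * (LP * \<bar>t - u\<bar>) * k + L2 * \<bar>t - u\<bar>"
      using X[OF T_sub[OF t(1)] t(2)] CP(2)[OF T_sub[OF t(1)]] lipschitz_onD[OF LPT t(1) u] lipschitz_onD[OF L2 t(1) u] k(1) CP(1)
      by (intro add_mono mult_right_mono mult_left_mono mult_mono) (auto simp: dist_norm)
    finally show ?thesis by (simp add: algebra_simps)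
  qed
  then show ?thesis using d(1) by blast
qed

text \<open>The constant \<open>k\<close> will be the value of \<open>x\<close> at the end of the
  interval away from u. Then \<open>k - x\<close> is, up to sign, the nonnegative weight multiplying
  \<open>dD\<close> in the expansion of \<open>K\<close> around u.\<close>

lemma DN_increments:
  assumes ab: "0 \<le> a" "a \<le> b" "b \<le> T"
  shows "D b = D a + integral {a..b} dD" and "N a = N b + integral {a..b} (\<lambda>s. (1 - x s) *\<^sub>R dD s)"
    and "((\<lambda>s. (k - x s) *\<^sub>R dD s) has_integral (integral {a..b} (\<lambda>s. (1 - x s) *\<^sub>R dD s) - (1 - k) *\<^sub>R integral {a..b} dD)) {a..b}"
proof -
  have c: "continuous_on {a..b} dD" by (rule continuous_on_subset[OF dD_cont]) (use ab in auto)
  have "(dD has_integral (D b - D a)) {a..b}"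
    by (rule fundamental_theorem_of_calculus[OF ab(2)])
       (use ab in \<open>auto intro!: has_vector_derivative_within_subset[OF D_deriv]\<close>)
  then show "D b = D a + integral {a..b} dD" by (simp add: integral_unique)
  have i: "(\<lambda>s. (1 - x s) *\<^sub>R dD s) integrable_on {p..q}" if "0 \<le> p" "q \<le> T" for p q
    using that T_range by (intro y_scaleR_integrable continuous_on_subset[OF dD_cont]) auto
  show "N a = N b + integral {a..b} (\<lambda>s. (1 - x s) *\<^sub>R dD s)"
    using Henstock_Kurzweil_Integration.integral_combine[of a b T "\<lambda>s. (1 - x s) *\<^sub>R dD s"] ab i[of a T] by (simp add: N_def add.commute)
  have "((\<lambda>s. (1 - x s) *\<^sub>R dD s - (1 - k) *\<^sub>R dD s) has_integral (integral {a..b} (\<lambda>s. (1 - x s) *\<^sub>R dD s) - (1 - k) *\<^sub>R integral {a..b} dD)) {a..b}"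
    using ab by (intro has_integral_diff has_integral_cmul integrable_integral i integrable_continuous_real c) auto
  then show "((\<lambda>s. (k - x s) *\<^sub>R dD s) has_integral (integral {a..b} (\<lambda>s. (1 - x s) *\<^sub>R dD s) - (1 - k) *\<^sub>R integral {a..b} dD)) {a..b}"
    by (simp add: scaleR_diff_left)
qed

text \<open>\<open>V\<close> is held fixed and only the operator \<open>L\<close> is differentiated.
  \<open>k\<close> is the one-sided value of \<open>x\<close> at \<open>u\<close>; it occurs only
  through the derivative of the inverse, twice by the product rule, and so distinguishes the two
  sides of a jump.\<close>

lemma kernel_deriv:
  assumes u: "u \<in> S" and S: "S \<subseteq> {0..T}" and D2: "((\<lambda>s. xi2 \<beta> (\<Phi> s)) has_vector_derivative D2) (at u within {0..n})"
    and hat: "(hat has_vector_derivative - (k *\<^sub>R V)) (at u within S)"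
  shows "((\<lambda>s. hadamard (xi2 \<beta> (\<Phi> s)) V - iv s ** V ** iv s) has_vector_derivative
      hadamard D2 V - (2 * k) *\<^sub>R (iv u ** V ** iv u ** V ** iv u)) (at u within S)"
proof -
  obtain c where c: "0 < c" "\<And>s. s \<in> {0..T} \<Longrightarrow> pos_def c (hat s)" using hat_pos_def_T by blast
  have "((\<lambda>s. matrix_inv (hat s)) has_vector_derivative - (matrix_inv (hat u) ** - (k *\<^sub>R V) ** matrix_inv (hat u))) (at u within S)"
    by (rule matrix_inv_has_vector_derivative[OF c(1) _ u hat]) (use c(2) S in auto)
  then have div: "(iv has_vector_derivative k *\<^sub>R (iv u ** V ** iv u)) (at u within S)"
    by (simp add: iv_def[abs_def] mat_algebra)
  have dX: "((\<lambda>s. xi2 \<beta> (\<Phi> s)) has_vector_derivative D2) (at u within S)"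
    by (rule has_vector_derivative_within_subset[OF D2]) (use S T_range in auto)
  have "((\<lambda>s. hadamard (xi2 \<beta> (\<Phi> s)) V - (iv s ** V) ** iv s) has_vector_derivative
     hadamard D2 V - ((iv u ** V) ** (k *\<^sub>R (iv u ** V ** iv u)) + ((k *\<^sub>R (iv u ** V ** iv u)) ** V) ** iv u)) (at u within S)"
    by (intro has_vector_derivative_diff matmul.has_vector_derivative div
        bounded_linear.has_vector_derivative[OF hadamard.bounded_linear_left dX]
        bounded_linear.has_vector_derivative[OF matmul.bounded_linear_left div])
  moreover have "(iv u ** V) ** (k *\<^sub>R (iv u ** V ** iv u)) + ((k *\<^sub>R (iv u ** V ** iv u)) ** V) ** iv u = (2 * k) *\<^sub>R (iv u ** V ** iv u ** V ** iv u)"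
    by (simp add: mat_algebra flip: scaleR_add_left)
  ultimately show ?thesis by simp
qed

end

context cs_minimizer begin

text \<open>\<open>one_sided_sign\<close> is applied on the right of \<open>u\<close> and, with time
  reversed, on the left. The \<xi>'' contributions to the two conclusions cancel, and the jump
  remains with the wrong sign.\<close>

lemma no_jump:
  assumes u: "0 < u" "u < T"
    and right: "\<And>t. u < t \<Longrightarrow> t < T \<Longrightarrow> x u < x t"
    and lim_left: "(x \<longlongrightarrow> l) (at_left u)" and left: "\<And>t. 0 \<le> t \<Longrightarrow> t < u \<Longrightarrow> x t < l"
    and l: "l < x u" and V0: "P u \<noteq> 0"
  shows False
proof -
  have uT: "u \<in> {0..T}" "u \<in> {0..n}" "u \<in> {0<..<T}" using u T_range by auto
  define V where "V = P u"
  define E where "E = dD u"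
  define \<Delta> where "\<Delta> = x u - l"
  define Km where "Km = K u - \<Delta> *\<^sub>R D u"
  have \<Delta>: "0 < \<Delta>" using l by (simp add: \<Delta>_def)
  have ltR: "at u within {u..T} = at_right u" using u by (simp add: at_within_Icc_at_right)
  have ltL: "at u within {0..u} = at_left u" using u by (simp add: at_within_Icc_at_left)
  have contR: "(f \<longlongrightarrow> f u) (at_right u)" and contL: "(f \<longlongrightarrow> f u) (at_left u)" if "continuous_on {0..T} f" for f :: "real \<Rightarrow> 'z::topological_space"
    using continuous_on_interior[OF that, of u] uT(3) by (auto simp: isCont_def filterlim_at_split)
  have K_left: "(K \<longlongrightarrow> Km) (at_left u)"
  proof -
    have "(K \<longlongrightarrow> - ((1 - l) *\<^sub>R D u + N u)) (at_left u)"
      unfolding K_def by (intro tendsto_intros lim_left contL[OF D_cont] contL[OF N_cont])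
    then show ?thesis by (simp add: Km_def K_def \<Delta>_def algebra_simps)
  qed
  have ev_left: "\<forall>\<^sub>F t in at_left u. 0 \<le> t \<and> t < u" using u by (auto simp: eventually_at_left_field intro!: exI[of _ 0])
  have psdKm: "psd Km"
    by (rule psd_limit[OF trivial_limit_at_left_real K_left]) (use ev_left u in \<open>auto elim!: eventually_mono intro!: K_psd\<close>)
  have psdV: "psd V" unfolding V_def by (rule P_psd[OF uT(2)])
  have KpV: "K u \<bullet> V = 0" unfolding V_def by (rule K_P_zero) (use u in auto)
  have KmV: "Km \<bullet> V = 0"
  proof (rule tendsto_unique[OF trivial_limit_at_left_real])
    show "((\<lambda>t. K t \<bullet> P t) \<longlongrightarrow> Km \<bullet> V) (at_left u)" unfolding V_def by (intro tendsto_intros K_left contL[OF P_cont_T])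
    show "((\<lambda>t. K t \<bullet> P t) \<longlongrightarrow> 0) (at_left u)"
      by (rule tendsto_eventually) (use ev_left u in \<open>auto elim!: eventually_mono intro!: K_P_zero\<close>)
  qed
  have symE: "transpose E = E" unfolding E_def by (rule dD_sym[OF uT(1)])
  obtain LP where LP: "LP-lipschitz_on {0..n} P" using P_lip by blast
  obtain d C where d: "0 < d" and C: "\<And>t. t \<in> {0..T} \<Longrightarrow> \<bar>t - u\<bar> < d \<Longrightarrow> norm (dD t - E) \<le> C * \<bar>t - u\<bar>"
    using dD_pointwise_lipschitz[OF uT(1)] unfolding E_def by blast
  define L where "L = max LP C"
  define \<eta> where "\<eta> = min d (min u (T - u))"
  have \<eta>: "0 < \<eta>" "\<eta> \<le> d" "\<eta> \<le> u" "\<eta> \<le> T - u" using d u by (auto simp: \<eta>_def)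
  have Wl: "norm (P t - V) \<le> L * \<bar>t - u\<bar>" if "t \<in> {0..n}" for t
  proof -
    have "norm (P t - V) \<le> LP * \<bar>t - u\<bar>" using lipschitz_onD[OF LP that uT(2)] by (simp add: V_def dist_norm)
    also have "\<dots> \<le> L * \<bar>t - u\<bar>" unfolding L_def by (intro mult_right_mono) auto
    finally show ?thesis .
  qed
  have Fl: "norm (dD t - E) \<le> L * \<bar>t - u\<bar>" if "t \<in> {0..T}" "\<bar>t - u\<bar> < d" for t
    by (rule order_trans[OF C[OF that]]) (auto simp: L_def intro!: mult_right_mono)
  define U where "U s = hadamard (xi2 \<beta> (\<Phi> s)) V - iv s ** V ** iv s" for s
  obtain D2 where D2: "((\<lambda>s. xi2 \<beta> (\<Phi> s)) has_vector_derivative D2) (at u within {0..n})" using xi2_deriv[OF uT(2)] by blast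
  define Y where "Y = iv u ** V ** iv u ** V ** iv u"
  \<comment> \<open>Self-adjointness moves the operator from \<open>P t\<close> to the fixed
    \<open>V\<close>. Only the increment of \<open>U\<close> remains to be differentiated, and
    \<open>P\<close> needs no derivative.\<close>
  have FU: "dD t \<bullet> V - E \<bullet> P t = P t \<bullet> (U t - U u)" if t: "t \<in> {0..T}" for t
  proof -
    have "dD t \<bullet> V = U t \<bullet> P t"
      unfolding dD_def U_def inner_diff_left
      using inner_hadamard_swap[of _ "P t" V] inner_congruence[OF iv_sym[OF t], of "P t" V] by (simp add: inner_commute[of "P t"])
    moreover have "E = U u" by (simp add: E_def dD_def U_def V_def)
    ultimately show ?thesis by (simp add: inner_diff_right inner_commute)
  qed
  have dUr: "(U has_vector_derivative hadamard D2 V - (2 * x u) *\<^sub>R Y) (at u within {u..T})"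
    unfolding U_def[abs_def] Y_def
  proof (rule kernel_deriv[OF _ _ D2])
    have "((\<lambda>t. integral {u..t} (\<lambda>s. x s *\<^sub>R P s)) has_vector_derivative x u *\<^sub>R P u) (at u within ({u..T} - {}))"
    proof (rule integral_has_vector_derivative_continuous_at)
      show "continuous (at u within {u..T} - {}) (\<lambda>s. x s *\<^sub>R P s)"
        using x_right[of u] uT T_range contR[OF P_cont_T] ltR by (auto simp: continuous_within intro!: tendsto_scaleR)
    qed (use u T_range in \<open>auto intro!: xP_integrable\<close>)
    then have "((\<lambda>t. hat u - integral {u..t} (\<lambda>s. x s *\<^sub>R P s)) has_vector_derivative 0 - x u *\<^sub>R P u) (at u within {u..T})"
      by (intro has_vector_derivative_diff has_vector_derivative_const) simp
    then have "((\<lambda>t. hat u - integral {u..t} (\<lambda>s. x s *\<^sub>R P s)) has_vector_derivative - (x u *\<^sub>R V)) (at u within {u..T})"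
      by (simp add: V_def)
    then show "(hat has_vector_derivative - (x u *\<^sub>R V)) (at u within {u..T})"
    proof (rule has_vector_derivative_transform[rotated 2])
      show "hat t = hat u - integral {u..t} (\<lambda>s. x s *\<^sub>R P s)" if "t \<in> {u..T}" for t
        using hat_diff[of u t] that u T_range by (simp add: algebra_simps)
    qed (use u in auto)
  qed (use u in auto)
  have dUl: "(U has_vector_derivative hadamard D2 V - (2 * l) *\<^sub>R Y) (at u within {0..u})"
    unfolding U_def[abs_def] Y_def
  proof (rule kernel_deriv[OF _ _ D2])
    \<comment> \<open>Replacing the value of \<open>x\<close> at \<open>u\<close> by its left limit
      makes the integrand left-continuous at \<open>u\<close> and leaves every integral
      unchanged.\<close>
    define f where "f s = (if s = u then l else x s) *\<^sub>R P s" for s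
    have f: "(f has_integral (hat t - hat u)) {t..u}" if t: "t \<in> {0..u}" for t
    proof (rule has_integral_spike_finite[of "{u}"])
      show "((\<lambda>s. x s *\<^sub>R P s) has_integral (hat t - hat u)) {t..u}"
        using hat_diff[of t u] t u T_range integrable_integral[OF xP_integrable[of t u]] by simp
    qed (auto simp: f_def)
    have "((\<lambda>t. integral {0..t} f) has_vector_derivative f u) (at u within ({0..u} - {}))"
    proof (rule integral_has_vector_derivative_continuous_at)
      have "((\<lambda>s. x s *\<^sub>R P s) \<longlongrightarrow> l *\<^sub>R P u) (at_left u)" by (intro tendsto_scaleR lim_left contL[OF P_cont_T])
      then have "(f \<longlongrightarrow> f u) (at_left u)"
        by (rule Lim_transform_eventually[where f = "\<lambda>s. x s *\<^sub>R P s", THEN back_subst[of "\<lambda>z. (f \<longlongrightarrow> z) (at_left u)"]])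
           (auto simp: f_def eventually_at_filter)
      then show "continuous (at u within {0..u} - {}) f" using ltL by (simp add: continuous_within)
    qed (use u f[of 0] in auto)
    then have "((\<lambda>t. hat 0 - integral {0..t} f) has_vector_derivative 0 - f u) (at u within {0..u})"
      by (intro has_vector_derivative_diff has_vector_derivative_const) simp
    then have "((\<lambda>t. hat 0 - integral {0..t} f) has_vector_derivative - (l *\<^sub>R V)) (at u within {0..u})"
      by (simp add: V_def f_def)
    then show "(hat has_vector_derivative - (l *\<^sub>R V)) (at u within {0..u})"
    proof (rule has_vector_derivative_transform[rotated 2])
      fix t assume t: "t \<in> {0..u}"
      have "integral {0..t} f + integral {t..u} f = integral {0..u} f"
        using t f[of 0] u by (intro Henstock_Kurzweil_Integration.integral_combine) auto
      then show "hat t = hat 0 - integral {0..t} f"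
        using f[of 0] f[OF t] u by (simp add: integral_unique algebra_simps)
    qed (use u in auto)
  qed (use u in auto)
  have qr: "((\<lambda>t. P t \<bullet> ((1 / (t - u)) *\<^sub>R (U t - U u))) \<longlongrightarrow> V \<bullet> (hadamard D2 V - (2 * x u) *\<^sub>R Y)) (at_right u)"
    using dUr unfolding has_vector_derivative_iff_quotient ltR V_def by (intro tendsto_inner contR[OF P_cont_T])
  have ql: "((\<lambda>t. P t \<bullet> ((1 / (t - u)) *\<^sub>R (U t - U u))) \<longlongrightarrow> V \<bullet> (hadamard D2 V - (2 * l) *\<^sub>R Y)) (at_left u)"
    using dUl unfolding has_vector_derivative_iff_quotient ltL V_def by (intro tendsto_inner contL[OF P_cont_T])
  have fr: "filterlim (\<lambda>s. s + u) (at_right u) (at_right 0)"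
    by (simp add: at_right_to_0[of u] filterlim_def)
  have fl: "filterlim (\<lambda>s. - s + u) (at_left u) (at_right 0)"
    unfolding filterlim_at
  proof
    have "((\<lambda>s. - s + u) \<longlongrightarrow> - 0 + u) (at_right 0)" by (intro tendsto_intros)
    then show "((\<lambda>s. - s + u) \<longlongrightarrow> u) (at_right 0)" by simp
    show "\<forall>\<^sub>F s in at_right 0. - s + u \<in> {..<u} \<and> - s + u \<noteq> u" by (auto simp: eventually_at_right_field intro!: exI[of _ 1])
  qed
  have xi: "(\<lambda>t. k - x t) integrable_on {a..b}" if "0 \<le> a" "b \<le> n" for a b k
    using y_scaleR_integrable(2)[of a b "\<lambda>_. 1::real"] that by (intro integrable_diff integrable_const_ivl) auto
  have R: "0 \<le> V \<bullet> (hadamard D2 V - (2 * x u) *\<^sub>R Y)"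
  proof (rule one_sided_sign[where \<eta> = \<eta> and K = "\<lambda>s. K (s + u)" and W = "\<lambda>s. P (s + u)" and F = "\<lambda>s. dD (s + u)"
        and w = "\<lambda>s r. x (s + u) - x (r + u)" and m = "\<lambda>s. x (s + u) - x u" and Kp = "K u" and Km = Km and ?D0.0 = "D u"
        and \<Delta> = \<Delta> and V = V and E = E and L = L])
    fix s assume s: "0 < s" "s < \<eta>"
    then have sT: "u < s + u" "s + u < T" using \<eta> u by auto
    then have sI: "s + u \<in> {0..T}" "s + u \<in> {0..n}" using u T_range by auto
    show "psd (K (s + u))" "K (s + u) \<bullet> P (s + u) = 0" using sT u by (auto intro!: K_psd K_P_zero)
    show "psd (P (s + u))" by (rule P_psd[OF sI(2)])
    show "norm (P (s + u) - V) \<le> L * s" using Wl[OF sI(2)] s by simp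
    have ab: "0 \<le> u" "u \<le> s + u" "s + u \<le> T" using sT u by auto
    note inc = DN_increments[OF ab]
    from has_integral_shift_real_ivl[OF inc(3)[of "x (s + u)"], of u]
    have int: "((\<lambda>r. (x (s + u) - x (r + u)) *\<^sub>R dD (r + u)) has_integral
      (integral {u..s + u} (\<lambda>s. (1 - x s) *\<^sub>R dD s) - (1 - x (s + u)) *\<^sub>R integral {u..s + u} dD)) {0..s}" by simp
    then show "(\<lambda>r. (x (s + u) - x (r + u)) *\<^sub>R dD (r + u)) integrable_on {0..s}" by blast
    show "K (s + u) = K u + (x (s + u) - x u) *\<^sub>R D u + integral {0..s} (\<lambda>r. (x (s + u) - x (r + u)) *\<^sub>R dD (r + u))"
      unfolding integral_unique[OF int] K_def inc(1,2) by (simp add: algebra_simps)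
    show "(\<lambda>r. x (s + u) - x (r + u)) integrable_on {0..s}"
      using has_integral_shift_real_ivl[OF integrable_integral[OF xi[of u "s + u" "x (s + u)"]], of u] ab T_range by auto
    \<comment> \<open>Right continuity brings \<open>x (d + u)\<close> close to \<open>x u\<close>,
      which lies strictly below \<open>x (s + u)\<close>.\<close>
    show "\<exists>d>0. d \<le> s \<and> 0 < x (s + u) - x (d + u)"
    proof -
      have "(x \<longlongrightarrow> x u) (at_right u)" using x_right uT T_range by auto
      from order_tendstoD(2)[OF this right[OF sT]] obtain b where b: "u < b" "\<And>t. u < t \<Longrightarrow> t < b \<Longrightarrow> x t < x (s + u)"
        by (auto simp: eventually_at_right_field)
      define e where "e = min s ((b - u) / 2)"
      have "0 < e" "e \<le> s" "e + u < b" using s b by (auto simp: e_def min_def field_simps)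
      then show ?thesis using b(2)[of "e + u"] by auto
    qed
    fix r :: real assume r: "0 \<le> r"
    show "0 \<le> x (s + u) - x (r + u) \<and> x (s + u) - x (r + u) \<le> x (s + u) - x u" if "r \<le> s"
      using that r s sI u x_le[of "r + u" "s + u"] x_le[of u "r + u"] by auto
    show "x (s + u) - x (r' + u) \<le> x (s + u) - x (r + u)" if "r \<le> r'" "r' \<le> s" for r'
      using that r s sI u x_le[of "r + u" "r' + u"] by auto
  next
    fix s assume s: "0 \<le> s" "s < \<eta>"
    show "norm (dD (s + u) - E) \<le> L * s" using Fl[of "s + u"] s \<eta> u by auto
  next
    have "((\<lambda>t. x t - x u) \<longlongrightarrow> x u - x u) (at_right u)" using x_right uT T_range by (intro tendsto_intros) auto
    from filterlim_compose[OF this fr] show "((\<lambda>s. x (s + u) - x u) \<longlongrightarrow> 0) (at_right 0)" by simp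
    show "((\<lambda>s. (dD (s + u) \<bullet> V - E \<bullet> P (s + u)) / s) \<longlongrightarrow> V \<bullet> (hadamard D2 V - (2 * x u) *\<^sub>R Y)) (at_right 0)"
    proof (rule Lim_transform_eventually[OF filterlim_compose[OF qr fr]])
      show "\<forall>\<^sub>F s in at_right 0. P (s + u) \<bullet> ((1 / (s + u - u)) *\<^sub>R (U (s + u) - U u)) = (dD (s + u) \<bullet> V - E \<bullet> P (s + u)) / s"
        unfolding eventually_at_right_field using FU u by (intro exI[of _ "T - u"]) auto
    qed
    show "K u - Km = \<Delta> *\<^sub>R D u" by (simp add: Km_def)
    show "psd (K u)" by (rule K_psd) (use u in auto)
  qed (use \<eta> psdKm \<Delta> psdV KpV KmV symE in auto)
  have Lft: "0 \<le> - (V \<bullet> (hadamard D2 V - (2 * l) *\<^sub>R Y))"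
  \<comment> \<open>Time reversal exchanges the roles of \<open>Km\<close> and \<open>K u\<close>
    and turns \<open>D u\<close> into \<open>- D u\<close>. In the weight the value at
    \<open>r = 0\<close> is \<open>l\<close> instead of \<open>x u\<close>, without which it would
    exceed \<open>l - x (- s + u)\<close>. Division by \<open>s = u - t\<close> accounts for the
    minus sign in the conclusion.\<close>
  proof (rule one_sided_sign[where \<eta> = \<eta> and K = "\<lambda>s. K (- s + u)" and W = "\<lambda>s. P (- s + u)" and F = "\<lambda>s. dD (- s + u)"
        and w = "\<lambda>s r. (if r = 0 then l else x (- r + u)) - x (- s + u)" and m = "\<lambda>s. l - x (- s + u)" and Kp = Km and Km = "K u" and ?D0.0 = "- D u"
        and \<Delta> = \<Delta> and V = V and E = E and L = L])
    fix s assume s: "0 < s" "s < \<eta>"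
    then have sT: "0 < - s + u" "- s + u < u" using \<eta> u by auto
    then have sI: "- s + u \<in> {0..T}" "- s + u \<in> {0..n}" using u T_range by auto
    show "psd (K (- s + u))" "K (- s + u) \<bullet> P (- s + u) = 0" using sT u by (auto intro!: K_psd K_P_zero)
    show "psd (P (- s + u))" by (rule P_psd[OF sI(2)])
    show "norm (P (- s + u) - V) \<le> L * s" using Wl[OF sI(2)] s by simp
    have ab: "0 \<le> - s + u" "- s + u \<le> u" "u \<le> T" using sT u by auto
    note inc = DN_increments[OF ab]
    let ?A = "integral {- s + u..u} dD" and ?B = "integral {- s + u..u} (\<lambda>s. (1 - x s) *\<^sub>R dD s)"
    have "((\<lambda>t. - ((x (- s + u) - x t) *\<^sub>R dD t)) has_integral - (?B - (1 - x (- s + u)) *\<^sub>R ?A)) {- s + u..u}"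
      by (rule has_integral_neg[OF inc(3)])
    then have "((\<lambda>t. (x t - x (- s + u)) *\<^sub>R dD t) has_integral ((1 - x (- s + u)) *\<^sub>R ?A - ?B)) {- s + u..u}"
      by (simp flip: scaleR_minus_left)
    from has_integral_shift_real_ivl[OF this, of u]
    have "((\<lambda>r. (x (r + u) - x (- s + u)) *\<^sub>R dD (r + u)) has_integral ((1 - x (- s + u)) *\<^sub>R ?A - ?B)) {- s..- 0}" by simp
    then have "((\<lambda>r. (x (- r + u) - x (- s + u)) *\<^sub>R dD (- r + u)) has_integral ((1 - x (- s + u)) *\<^sub>R ?A - ?B)) {0..s}"
      using has_integral_reflect_real[where f = "\<lambda>r. (x (r + u) - x (- s + u)) *\<^sub>R dD (r + u)" and a = "- s" and b = 0] by simp
    then have int: "((\<lambda>r. ((if r = 0 then l else x (- r + u)) - x (- s + u)) *\<^sub>R dD (- r + u)) has_integral ((1 - x (- s + u)) *\<^sub>R ?A - ?B)) {0..s}"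
      by (rule has_integral_spike_finite[of "{0}", rotated 2]) auto
    then show "(\<lambda>r. ((if r = 0 then l else x (- r + u)) - x (- s + u)) *\<^sub>R dD (- r + u)) integrable_on {0..s}" by blast
    have Dm: "D (- s + u) = D u - ?A" using inc(1) by simp
    show "K (- s + u) = Km + (l - x (- s + u)) *\<^sub>R - D u + integral {0..s} (\<lambda>r. ((if r = 0 then l else x (- r + u)) - x (- s + u)) *\<^sub>R dD (- r + u))"
      unfolding integral_unique[OF int] K_def Dm inc(2) Km_def \<Delta>_def by (simp add: algebra_simps)
    show "(\<lambda>r. (if r = 0 then l else x (- r + u)) - x (- s + u)) integrable_on {0..s}"
    proof -
      have "(\<lambda>t. - (x (- s + u) - x t)) integrable_on {- s + u..u}" using ab T_range by (intro integrable_neg xi) auto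
      then have "(\<lambda>t. x t - x (- s + u)) integrable_on {- s + u..u}" by simp
      then obtain I where "((\<lambda>t. x t - x (- s + u)) has_integral I) {- s + u..u}" by blast
      from has_integral_shift_real_ivl[OF this, of u]
      have "((\<lambda>r. x (r + u) - x (- s + u)) has_integral I) {- s..- 0}" by simp
      then have "((\<lambda>r. x (- r + u) - x (- s + u)) has_integral I) {0..s}"
        using has_integral_reflect_real[where f = "\<lambda>r. x (r + u) - x (- s + u)" and a = "- s" and b = 0] by simp
      then have "((\<lambda>r. (if r = 0 then l else x (- r + u)) - x (- s + u)) has_integral I) {0..s}"
        by (rule has_integral_spike_finite[of "{0}", rotated 2]) auto
      then show ?thesis by blast
    qed
    show "\<exists>d>0. d \<le> s \<and> 0 < (if d = 0 then l else x (- d + u)) - x (- s + u)"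
    proof -
      have "x (- s + u) < l" using left sT by auto
      from order_tendstoD(1)[OF lim_left this] obtain b where b: "b < u" "\<And>t. b < t \<Longrightarrow> t < u \<Longrightarrow> x (- s + u) < x t"
        by (auto simp: eventually_at_left_field)
      define e where "e = min s ((u - b) / 2)"
      have "0 < e" "e \<le> s" "b < - e + u" using s b by (auto simp: e_def min_def field_simps)
      then show ?thesis using b(2)[of "- e + u"] by (intro exI[of _ e]) auto
    qed
    fix r :: real assume r: "0 \<le> r"
    show "0 \<le> (if r = 0 then l else x (- r + u)) - x (- s + u) \<and> (if r = 0 then l else x (- r + u)) - x (- s + u) \<le> l - x (- s + u)" if "r \<le> s"
      using that r s sT sI u left[of "- r + u"] left[of "- s + u"] x_le[of "- s + u" "- r + u"] T_range by auto
    show "(if r' = 0 then l else x (- r' + u)) - x (- s + u) \<le> (if r = 0 then l else x (- r + u)) - x (- s + u)" if "r \<le> r'" "r' \<le> s" for r'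
      using that r s sT sI u left[of "- r' + u"] x_le[of "- r' + u" "- r + u"] T_range by auto
  next
    fix s assume s: "0 \<le> s" "s < \<eta>"
    show "norm (dD (- s + u) - E) \<le> L * s" using Fl[of "- s + u"] s \<eta> u by auto
  next
    have "((\<lambda>t. l - x t) \<longlongrightarrow> l - l) (at_left u)" by (intro tendsto_intros lim_left)
    from filterlim_compose[OF this fl] show "((\<lambda>s. l - x (- s + u)) \<longlongrightarrow> 0) (at_right 0)" by simp
    show "((\<lambda>s. (dD (- s + u) \<bullet> V - E \<bullet> P (- s + u)) / s) \<longlongrightarrow> - (V \<bullet> (hadamard D2 V - (2 * l) *\<^sub>R Y))) (at_right 0)"
    proof (rule Lim_transform_eventually[OF tendsto_minus[OF filterlim_compose[OF ql fl]]])
      show "\<forall>\<^sub>F s in at_right 0. - (P (- s + u) \<bullet> ((1 / (- s + u - u)) *\<^sub>R (U (- s + u) - U u))) = (dD (- s + u) \<bullet> V - E \<bullet> P (- s + u)) / s"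
        unfolding eventually_at_right_field using FU u by (intro exI[of _ u]) auto
    qed
    show "Km - K u = \<Delta> *\<^sub>R - D u" by (simp add: Km_def)
    show "psd (K u)" by (rule K_psd) (use u in auto)
  qed (use \<eta> psdKm \<Delta> psdV KpV KmV symE in auto)
  have "0 < V \<bullet> Y"
  proof -
    obtain c where c: "0 < c" "pos_def c (hat u)" using hat_pos_def_T uT(1) by blast
    have dn: "det (hat u) \<noteq> 0" by (rule pos_def_det_nz[OF c(2,1)])
    have ph: "psd (hat u)" using c(2) by (simp add: pos_def_def)
    show ?thesis unfolding Y_def
    proof (rule cubic_trace_pos[OF psdV])
      show "V \<noteq> 0" using V0 by (simp add: V_def)
      show "psd (iv u)" unfolding iv_def by (rule psd_matrix_inv[OF ph dn])
      show "iv u ** hat u = mat 1" unfolding iv_def by (rule matrix_inv_mult(2)[OF dn])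
    qed
  qed
  \<comment> \<open>Adding \<open>R\<close> and \<open>Lft\<close> eliminates \<open>D2\<close>, the
    derivative of \<xi>'' along the path, of which nothing is known.\<close>
  moreover have "x u * (V \<bullet> Y) \<le> l * (V \<bullet> Y)" using R Lft by (simp add: inner_diff_right)
  ultimately show False using l by simp
qed

end

theorem proposition16:
  fixes \<beta> :: "nat \<Rightarrow> real^'m"
    and h :: "real^'m"
    and Q :: "real^'m^'m"
    and x :: "real \<Rightarrow> real"
    and \<Phi> :: "real \<Rightarrow> real^'m^'m"
    and u_minus u_plus :: "nat \<Rightarrow> real"
    and u0 :: real
  assumes beta_odd: "\<And>p. 2 \<le> p \<Longrightarrow> odd p \<Longrightarrow> \<beta> p = 0"
    and beta_summable: "\<And>j. summable (\<lambda>p. 2 ^ p * (\<beta> p $ j)\<^sup>2)"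
    and Q: "is_constraint Q"
    and minimizer: "is_CS_minimizer \<beta> h Q x \<Phi>"
    and incr: "strict_mono u_minus"
    and decr: "\<And>k l. k < l \<Longrightarrow> u_plus l < u_plus k"
    and supp_minus: "\<And>l. u_minus l \<in> supp (mu_P (real CARD('m)) x)"
    and supp_plus: "\<And>l. u_plus l \<in> supp (mu_P (real CARD('m)) x)"
    and lim_minus: "u_minus \<longlonglongrightarrow> u0"
    and lim_plus: "u_plus \<longlonglongrightarrow> u0"
  shows "measure (mu_P (real CARD('m)) x) {u0} = 0"
proof (rule ccontr)
  assume atom: "measure (mu_P (real CARD('m)) x) {u0} \<noteq> 0"
  define n where "n = real CARD('m)"
  have adm: "is_order_parameter n x" "is_path Q \<Phi>" "\<And>t. t \<in> supp (mu_P n x) \<Longrightarrow> trace (\<Phi> t) = t"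
      "0 < det (Q - \<Phi> (t_max n x))"
    and min: "\<And>y \<Psi>. admissible Q y \<Psi> \<Longrightarrow> CS \<beta> h Q x \<Phi> \<le> CS \<beta> h Q y \<Psi>"
    using minimizer by (auto simp: is_CS_minimizer_def admissible_def n_def)
  note path = is_pathD[OF adm(2), folded n_def]
  have inst: "cs_path \<beta> Q x \<Phi> (path_deriv \<Phi>) n"
    by unfold_locales (use beta_summable Q adm path n_def in auto)
  interpret cs_minimizer \<beta> h Q x \<Phi> "path_deriv \<Phi>" n
  proof (intro cs_minimizer.intro inst cs_minimizer_axioms.intro)
    show "trace (\<Phi> t) = t" if "t \<in> supp (mu_P n x)" for t using adm(3) that .
    show "cs_form \<beta> h x (t_max n x) \<Phi> (path_deriv \<Phi>) \<le> CS \<beta> h Q y \<Psi>" if "admissible Q y \<Psi>" for y \<Psi>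
      using min[OF that] cs_path.CS_eq[OF inst, of h] by simp
  qed
  note sm = supp_minus[folded n_def] and sp = supp_plus[folded n_def]
  have minus_less: "u_minus k < u0" for k
  proof -
    have "u_minus (Suc k) \<le> u0" using incseq_le[OF strict_mono_mono[OF incr] lim_minus] .
    then show ?thesis using strict_monoD[OF incr, of k "Suc k"] by simp
  qed
  have plus_greater: "u0 < u_plus k" for k
  proof -
    have "decseq u_plus" unfolding decseq_def
    proof safe
      fix i j :: nat assume "i \<le> j"
      then show "u_plus j \<le> u_plus i" using decr[of i j] by (cases "i = j") auto
    qed
    then have "u0 \<le> u_plus (Suc k)" using lim_plus by (rule decseq_ge)
    then show ?thesis using decr[of k "Suc k"] by simp
  qed
  have in_I: "t \<in> {0..n}" if "t \<in> supp (mu_P n x)" for t using supp_mu_P_subset[OF order_x _ that] n_pos by simp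
  have u0: "0 < u0" "u0 < n"
    using in_I[OF sm[of 0]] in_I[OF sp[of 0]] minus_less[of 0] plus_greater[of 0] by auto
  \<comment> \<open>A support point strictly inside the interval suffices: \<open>d\<close> is its
    distance to the nearer end.\<close>
  have supp_incr: "x a < x b" if "0 \<le> a" "a < t" "t < b" "b \<le> n" "t \<in> supp (mu_P n x)" for a t b
  proof -
    define d where "d = min (t - a) (b - t)"
    have d: "0 < d" "a \<le> t - d" "t + d \<le> b" using that by (auto simp: d_def)
    have "x a = dist_fun n x a" "x b = dist_fun n x b" using that by (auto simp: dist_fun_def)
    moreover have "dist_fun n x a \<le> dist_fun n x (t - d)" "dist_fun n x (t + d) \<le> dist_fun n x b"
      using d by (auto intro!: dist_fun_mono[OF order_x])
    moreover have "dist_fun n x (t - d) < dist_fun n x (t + d)" using that(5) d supp_mu_P[OF order_x] by blast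
    ultimately show ?thesis by simp
  qed
  have right: "x u0 < x t" if t: "u0 < t" "t < n" for t
  proof -
    obtain k where "u_plus k < t" using order_tendstoD(2)[OF lim_plus t(1)] by (auto simp: eventually_sequentially)
    then show ?thesis using supp_incr[of u0 "u_plus k" t] plus_greater sp u0 t by auto
  qed
  \<comment> \<open>\<open>x\<close> still grows to the right of \<open>u0\<close>, so
    \<open>x u0\<close> is below 1.\<close>
  have u0T: "u0 < T"
  proof (rule ccontr)
    assume "\<not> u0 < T"
    then have "x u0 = 1" using x_T u0 by simp
    moreover have "x u0 < x ((u0 + n) / 2)" using u0 by (intro right) auto
    ultimately show False using x_range[of "(u0 + n) / 2"] u0 by simp
  qed
  define l where "l = Sup (x ` {0..<u0})"
  have bdd: "bdd_above (x ` {0..<u0})" using x_range u0 by (intro bdd_aboveI[of _ 1]) auto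
  have ne: "x ` {0..<u0} \<noteq> {}" using u0 by auto
  have le_l: "x t \<le> l" if "0 \<le> t" "t < u0" for t unfolding l_def using that by (intro cSup_upper bdd) auto
  have left: "x t < l" if t: "0 \<le> t" "t < u0" for t
  proof -
    obtain k where k: "t < u_minus k" using order_tendstoD(1)[OF lim_minus t(2)] by (auto simp: eventually_sequentially)
    \<comment> \<open>The midpoint leaves room for \<open>u_minus k\<close> strictly inside the
      interval while staying below \<open>u0\<close>.\<close>
    have "x t < x ((u_minus k + u0) / 2)" using k minus_less[of k] t u0 sm by (intro supp_incr[of t "u_minus k"]) auto
    also have "\<dots> \<le> l" using k minus_less[of k] t by (intro le_l) auto
    finally show ?thesis .
  qed
  have lim_left: "(x \<longlongrightarrow> l) (at_left u0)"
  proof (rule order_tendstoI)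
    fix a assume "a < l"
    then obtain s where s: "0 \<le> s" "s < u0" "a < x s" unfolding l_def using less_cSup_iff[OF ne bdd] by auto
    have "a < x t" if "s < t" "t < u0" for t using x_le[of s t] s that u0 by auto
    then show "\<forall>\<^sub>F t in at_left u0. a < x t" using s by (auto simp: eventually_at_left_field)
  next
    fix a assume "l < a"
    then have "x t < a" if "0 < t" "t < u0" for t using le_l[of t] that by simp
    then show "\<forall>\<^sub>F t in at_left u0. x t < a"
      using u0 by (auto simp: eventually_at_left_field intro!: exI[of _ 0])
  qed
  have l_less: "l < x u0"
  proof -
    obtain c where c: "0 < c" "\<And>t. t < u0 \<Longrightarrow> dist_fun n x t + c \<le> dist_fun n x u0"
      using mu_P_atom[OF order_x atom[folded n_def]] by blast
    have "l \<le> x u0 - c" unfolding l_def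
    proof (rule cSup_least[OF ne])
      fix v assume "v \<in> x ` {0..<u0}"
      then obtain t where t: "v = x t" "0 \<le> t" "t < u0" by auto
      then show "v \<le> x u0 - c" using c(2)[of t] u0 by (simp add: dist_fun_def)
    qed
    then show ?thesis using c(1) by simp
  qed
  \<comment> \<open>By continuity \<open>trace (\<Phi> t) = t\<close> holds at \<open>u0\<close> as
    at the points \<open>u_plus k\<close>, so the difference quotients along this sequence have
    trace 1, which a zero derivative excludes.\<close>
  have "path_deriv \<Phi> u0 \<noteq> 0"
  proof
    assume z: "path_deriv \<Phi> u0 = 0"
    have uI: "u0 \<in> {0..n}" using u0 by simp
    have pl: "filterlim u_plus (at u0 within {0..n}) sequentially"
      unfolding filterlim_at using lim_plus plus_greater in_I[OF sp] by (auto intro!: always_eventually simp: less_imp_neq[symmetric])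
    have "(\<Phi> \<longlongrightarrow> \<Phi> u0) (at u0 within {0..n})" using Phi_cont uI by (auto simp: continuous_on_def)
    from filterlim_compose[OF this pl] have "(\<lambda>k. \<Phi> (u_plus k)) \<longlonglongrightarrow> \<Phi> u0" .
    then have "(\<lambda>k. trace (\<Phi> (u_plus k))) \<longlonglongrightarrow> trace (\<Phi> u0)" by (rule bounded_linear.tendsto[OF bounded_linear_trace])
    then have "u_plus \<longlonglongrightarrow> trace (\<Phi> u0)" using adm(3)[OF sp] by simp
    then have tr0: "trace (\<Phi> u0) = u0" using lim_plus LIMSEQ_unique by blast
    have "((\<lambda>s. (1 / (s - u0)) *\<^sub>R (\<Phi> s - \<Phi> u0)) \<longlongrightarrow> 0) (at u0 within {0..n})"
      using dPhi[OF uI] by (simp add: has_vector_derivative_iff_quotient z)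
    from bounded_linear.tendsto[OF bounded_linear_trace filterlim_compose[OF this pl]]
    have "(\<lambda>k. trace ((1 / (u_plus k - u0)) *\<^sub>R (\<Phi> (u_plus k) - \<Phi> u0))) \<longlonglongrightarrow> 0" by (simp add: linear_0[OF linear_trace])
    moreover have "trace ((1 / (u_plus k - u0)) *\<^sub>R (\<Phi> (u_plus k) - \<Phi> u0)) = 1" for k
      using plus_greater[of k] adm(3)[OF sp] tr0 by (simp add: linear_scale[OF linear_trace] linear_diff[OF linear_trace])
    ultimately show False by (simp add: LIMSEQ_const_iff)
  qed
  then show False
    by (intro no_jump[OF u0(1) u0T _ lim_left left l_less]) (use right T_range in auto)
qed

end
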